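(* Let $k$ be a field of characteristic zero, let $R=k[x_1,x_2,x_3]$, and let $I\subset R$ be a homogeneous ideal such that $R/I$ is an artinian Gorenstein algebra with socle degree $e$ and Hilbert function $h_i=\dim_k (R/I)_i$. Assume that there is some integer $s$ such that $$3\le s\le \frac e2-1 \qquad\text{and}\qquad h_s\le 3s-1 .$$ Then $R/I$ has the Weak Lefschetz Property.
   Context: $R=k[x_1,x_2,x_3]$ has the standard grading. An artinian standard graded algebra $A=\bigoplus_{i\ge 0}A_i$ has the Weak Lefschetz Property (WLP) if for a general linear form $L\in A_1$ (i.e. for all $L$ in some non-empty Zariski-open subset of the space of linear forms) the multiplication map $\times L:A_i\to A_{i+1}$ has maximal rank (is injective or surjective) for every $i$. The algebra is Gorenstein if its socle is one-dimensional over $k$; its socle degree is the largest $e$ with $A_e\neq 0$. *)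

theory Defs
  imports
    "HOL-Library.Poly_Mapping"
    "HOL-Library.Numeral_Type"
    "HOL-Algebra.QuotRing"
    "HOL-Algebra.Embedded_Algebras"
    "HOL-Algebra.Algebraic_Closure_Type"
begin

text \<open>
  Polynomials over \<open>'k\<close> in variables indexed by \<open>'n\<close>: finitely supported maps from exponent
  vectors to coefficients. With the index type \<open>3\<close> this is \<open>k[x\<^sub>1, x\<^sub>2, x\<^sub>3]\<close>.
\<close>

type_synonym ('n, 'k) mpoly = "('n \<Rightarrow>\<^sub>0 nat) \<Rightarrow>\<^sub>0 'k"

abbreviation poly_ring :: "('n, 'k::comm_ring_1) mpoly ring" where
  "poly_ring \<equiv> ring_of_type_algebra"

definition mon_degree :: "('n \<Rightarrow>\<^sub>0 nat) \<Rightarrow> nat" where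
  "mon_degree m = (\<Sum>i\<in>Poly_Mapping.keys m. Poly_Mapping.lookup m i)"

definition forms :: "nat \<Rightarrow> ('n, 'k::comm_ring_1) mpoly set" where
  "forms d = {f. \<forall>m\<in>Poly_Mapping.keys f. mon_degree m = d}"

definition homogeneous_ideal :: "('n, 'k::comm_ring_1) mpoly set \<Rightarrow> bool" where
  "homogeneous_ideal I \<longleftrightarrow> (\<exists>S. S \<subseteq> (\<Union>d. forms d) \<and> I = Idl\<^bsub>poly_ring\<^esub> S)"

abbreviation quot_alg :: "('n, 'k::comm_ring_1) mpoly set \<Rightarrow> ('n, 'k) mpoly set ring" where
  "quot_alg I \<equiv> poly_ring Quot I"

definition residue_class :: "('n, 'k::comm_ring_1) mpoly set \<Rightarrow> ('n, 'k) mpoly \<Rightarrow> ('n, 'k) mpoly set" where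
  "residue_class I f = I +>\<^bsub>poly_ring\<^esub> f"

definition graded_piece :: "('n, 'k::comm_ring_1) mpoly set \<Rightarrow> nat \<Rightarrow> ('n, 'k) mpoly set set" where
  "graded_piece I i = residue_class I ` forms i"

text \<open>
  The image of \<open>k\<close> in \<open>R/I\<close>. If \<open>I\<close> is proper it is a subfield isomorphic to \<open>k\<close>, and
  dimensions over it, in the sense of \<^term>\<open>ring.dimension\<close>, are dimensions over \<open>k\<close>.
\<close>

definition scalar :: "('n, 'k::comm_ring_1) mpoly set \<Rightarrow> 'k \<Rightarrow> ('n, 'k) mpoly set" where
  "scalar I c = residue_class I (Poly_Mapping.single 0 c)"

definition hilbert_function :: "('n, 'k::comm_ring_1) mpoly set \<Rightarrow> nat \<Rightarrow> nat" where
  "hilbert_function I i = ring.dim (quot_alg I) (range (scalar I)) (graded_piece I i)"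

definition artinian :: "('a, 'b) ring_scheme \<Rightarrow> bool" where
  "artinian A \<longleftrightarrow> \<not> (\<exists>J :: nat \<Rightarrow> 'a set. \<forall>n. ideal (J n) A \<and> J (Suc n) \<subset> J n)"

text \<open>The socle of \<open>R/I\<close> is the annihilator of its irrelevant ideal.\<close>

definition socle :: "('n, 'k::comm_ring_1) mpoly set \<Rightarrow> ('n, 'k) mpoly set set" where
  "socle I = {a \<in> carrier (quot_alg I).
     \<forall>i>0. \<forall>x\<in>graded_piece I i. x \<otimes>\<^bsub>quot_alg I\<^esub> a = \<zero>\<^bsub>quot_alg I\<^esub>}"

definition gorenstein :: "('n, 'k::comm_ring_1) mpoly set \<Rightarrow> bool" where
  "gorenstein I \<longleftrightarrow> ring.dimension (quot_alg I) 1 (range (scalar I)) (socle I)"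

definition has_socle_degree :: "('n, 'k::comm_ring_1) mpoly set \<Rightarrow> nat \<Rightarrow> bool" where
  "has_socle_degree I e \<longleftrightarrow>
     graded_piece I e \<noteq> {\<zero>\<^bsub>quot_alg I\<^esub>} \<and> (\<forall>j>e. graded_piece I j = {\<zero>\<^bsub>quot_alg I\<^esub>})"

text \<open>
  The Zariski topology on the finite-dimensional vector space \<open>(R/I)\<^sub>1\<close>, without choosing
  coordinates: its polynomial functions are generated by constants and linear functionals, and
  the open sets are the loci where some member of a family of polynomial functions is nonzero.
  Functions are only meaningful on \<open>(R/I)\<^sub>1\<close>; their values elsewhere are arbitrary.
\<close>

definition linear_functionals :: "('n, 'k::comm_ring_1) mpoly set \<Rightarrow> (('n, 'k) mpoly set \<Rightarrow> 'k) set" where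
  "linear_functionals I = {\<phi>.
     (\<forall>a\<in>graded_piece I 1. \<forall>b\<in>graded_piece I 1. \<phi> (a \<oplus>\<^bsub>quot_alg I\<^esub> b) = \<phi> a + \<phi> b) \<and>
     (\<forall>c. \<forall>a\<in>graded_piece I 1. \<phi> (scalar I c \<otimes>\<^bsub>quot_alg I\<^esub> a) = c * \<phi> a)}"

inductive_set polynomial_functions :: "('n, 'k::comm_ring_1) mpoly set \<Rightarrow> (('n, 'k) mpoly set \<Rightarrow> 'k) set"
  for I where
  const: "(\<lambda>_. c) \<in> polynomial_functions I"
| linear: "\<phi> \<in> linear_functionals I \<Longrightarrow> \<phi> \<in> polynomial_functions I"
| add: "\<lbrakk>f \<in> polynomial_functions I; g \<in> polynomial_functions I\<rbrakk>
    \<Longrightarrow> (\<lambda>L. f L + g L) \<in> polynomial_functions I"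
| mult: "\<lbrakk>f \<in> polynomial_functions I; g \<in> polynomial_functions I\<rbrakk>
    \<Longrightarrow> (\<lambda>L. f L * g L) \<in> polynomial_functions I"

definition zariski_open :: "('n, 'k::comm_ring_1) mpoly set \<Rightarrow> ('n, 'k) mpoly set set \<Rightarrow> bool" where
  "zariski_open I U \<longleftrightarrow>
     (\<exists>P\<subseteq>polynomial_functions I. U = {L \<in> graded_piece I 1. \<exists>f\<in>P. f L \<noteq> 0})"

definition max_rank_mult :: "('n, 'k::comm_ring_1) mpoly set \<Rightarrow> ('n, 'k) mpoly set \<Rightarrow> nat \<Rightarrow> bool" where
  "max_rank_mult I L i \<longleftrightarrow>
     inj_on (\<lambda>a. L \<otimes>\<^bsub>quot_alg I\<^esub> a) (graded_piece I i) \<or>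
     (\<lambda>a. L \<otimes>\<^bsub>quot_alg I\<^esub> a) ` graded_piece I i = graded_piece I (i + 1)"

definition weak_lefschetz :: "('n, 'k::comm_ring_1) mpoly set \<Rightarrow> bool" where
  "weak_lefschetz I \<longleftrightarrow>
     (\<exists>U. zariski_open I U \<and> U \<noteq> {} \<and> (\<forall>L\<in>U. \<forall>i. max_rank_mult I L i))"

end

theory Submission
  imports Defs "Berlekamp_Zassenhaus.Unique_Factorization_Poly"
begin

text \<open>
  Setting \<open>x\<^sub>3 = 1\<close> turns \<open>R/I\<close> into the algebra of a linear functional on polynomials in two
  variables, and duality together with the one-dimensional socle reduces the Weak Lefschetz Property
  to the injectivity of the multiplication \<open>A\<^sub>t \<rightarrow> A\<^bsub>t+1\<^esub>\<close>, \<open>t = \<lfloor>(e - 1)/2\<rfloor>\<close>, by a single line.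
  Suppose that it fails for every line.  Let \<open>\<beta>\<^sub>j\<close> be the codimension of the restriction of \<open>I\<^sub>j\<close> to
  a general line.  By Green's restriction theorem \<open>h\<^sub>s \<le> 3 s - 1\<close> forces \<open>\<beta>\<^sub>s \<le> 2\<close>, and from then on
  \<open>\<beta>\<close> does not increase; by duality the kernel in degree \<open>t\<close> has dimension \<open>\<beta>\<^bsub>e-t\<^esub>\<close>, so
  \<open>c = \<beta>\<^bsub>t+1\<^esub>\<close> is \<open>1\<close> or \<open>2\<close>.  Where \<open>\<beta>\<close> is stationary, the restriction of \<open>I\<close> to a general line
  consists of the multiples of one form of degree \<open>c\<close>; these forms glue to a common factor \<open>D\<close> of
  \<open>I\<^bsub>t+1\<^esub>\<close>.  The only other case, \<open>\<beta>\<^bsub>t-1\<^esub> = \<beta>\<^sub>t = 2\<close> and \<open>\<beta>\<^bsub>t+1\<^esub> = 1\<close> with \<open>e = 2 t + 1\<close>, is brought to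
  the same form by deforming the line to first order.  The residual ideal \<open>I : D\<close> is again Gorenstein,
  of socle degree \<open>e - c\<close>, and its Hilbert function drops strictly from degree \<open>t - c\<close> to \<open>t - c + 1\<close>.
  As its values are small it never increases afterwards, which contradicts its symmetry.
\<close>

section \<open>Finite-dimensional subspaces\<close>

text \<open>The constant 3 s - 1 is the case c = 2 of the condition 2 h <= 2 (c + 1) n - c (c - 1),
  under which \<open>generic_restriction\<close> bounds the codimension on a general line by c. The
  condition is inherited: division by D turns it into the same condition with 2 - c in place of 2,
  so on a general line the residual ideal has codimension at most 1. The second quantity is the
  dimension \<kappa> of the kernel of multiplication by a line. The Hilbert function changes by
  \<beta> - \<kappa> at each step, and a nonzero kernel stays nonzero up to the socle degree,
  because below that degree nothing is killed by all linear forms. After a drop therefore \<beta> <=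
  1 <= \<kappa>, and the residual Hilbert function cannot rise again. The obstacle is a drop of
  \<beta> exactly in the middle, where minimal growth says nothing about degree t + 1. The room left
  by s <= e/2 - 1 then supplies degree t - 1, hence a conic dividing the ideal in degree t, and the
  argument continues modulo this conic.\<close>

definition sumset :: "'a::ab_group_add set \<Rightarrow> 'a set \<Rightarrow> 'a set" where
  "sumset S T = {x + y | x y. x \<in> S \<and> y \<in> T}"

lemma sumsetI: "x \<in> S \<Longrightarrow> y \<in> T \<Longrightarrow> x + y \<in> sumset S T"
  unfolding sumset_def by blast

lemma sumsetE:
  assumes "z \<in> sumset S T" obtains x y where "x \<in> S" "y \<in> T" "z = x + y"
  using assms unfolding sumset_def by blast

text \<open>The ambient polynomial spaces are infinite-dimensional and \<open>dim\<close> is a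
  default value on sets without a finite basis, so finiteness is carried as a property of each
  subset.\<close>

definition fin_dim :: "('a::comm_ring_1 \<Rightarrow> 'b::ab_group_add \<Rightarrow> 'b) \<Rightarrow> 'b set \<Rightarrow> bool" where
  "fin_dim scale S \<longleftrightarrow> (\<exists>B. finite B \<and> S \<subseteq> module.span scale B)"

context vector_space
begin

lemma fdimI: "finite B \<Longrightarrow> S \<subseteq> span B \<Longrightarrow> fin_dim scale S"
  unfolding fin_dim_def by blast

lemma fdim_subset: "fin_dim scale T \<Longrightarrow> S \<subseteq> T \<Longrightarrow> fin_dim scale S"
  unfolding fin_dim_def by blast

lemma fdim_independent:
  assumes "fin_dim scale S" "B \<subseteq> S" "independent B"
  shows "finite B" "card B \<le> dim S"
proof -
  obtain C where "finite C" "S \<subseteq> span C" using assms(1) unfolding fin_dim_def by blast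
  then show fin: "finite B" using independent_span_bound assms(2,3) by blast
  obtain D where D: "D \<subseteq> S" "independent D" "S \<subseteq> span D" "card D = dim S"
    using basis_exists by blast
  have "finite D" using D(1,2) \<open>finite C\<close> \<open>S \<subseteq> span C\<close> independent_span_bound by blast
  then show "card B \<le> dim S" using independent_span_bound[of D B] D assms(2,3) by auto
qed

lemma fdim_basis_extend:
  assumes "fin_dim scale S" "B \<subseteq> S" "independent B"
  obtains C where "B \<subseteq> C" "C \<subseteq> S" "independent C" "S \<subseteq> span C" "finite C" "card C = dim S"
proof -
  obtain C where C: "B \<subseteq> C" "C \<subseteq> S" "independent C" "S \<subseteq> span C"
    using maximal_independent_subset_extend[OF assms(2,3)] by blast
  moreover have "finite C" using fdim_independent assms(1) C by blast
  moreover have "card C = dim S" using basis_card_eq_dim C by blast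
  ultimately show ?thesis using that by blast
qed

lemma fdim_basis:
  assumes "fin_dim scale S"
  obtains C where "C \<subseteq> S" "independent C" "S \<subseteq> span C" "finite C" "card C = dim S"
proof -
  obtain C where "C \<subseteq> S" "independent C" "S \<subseteq> span C" "finite C" "card C = dim S"
    using fdim_basis_extend[OF assms empty_subsetI independent_empty] .
  then show ?thesis by (rule that)
qed

lemma dim_mono_fdim:
  assumes "fin_dim scale T" "S \<subseteq> T" shows "dim S \<le> dim T"
proof -
  obtain C where "T \<subseteq> span C" "finite C" "card C = dim T" using fdim_basis[OF assms(1)] .
  then show ?thesis using dim_le_card[of S C] assms(2) by auto
qed

lemma subspace_eq_fdim:
  assumes "fin_dim scale T" "subspace S" "S \<subseteq> T" "dim T \<le> dim S"
  shows "S = T"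
proof (rule ccontr)
  assume "S \<noteq> T"
  then obtain v where v: "v \<in> T" "v \<notin> S" using assms(3) by blast
  obtain C where C: "C \<subseteq> S" "independent C" "S \<subseteq> span C" "finite C" "card C = dim S"
    using fdim_basis[OF fdim_subset[OF assms(1,3)]] .
  have "v \<notin> span C" using v C assms(2) span_minimal by blast
  then have "independent (insert v C)" "v \<notin> C"
    using C independent_insertI span_base by auto
  then have "card (insert v C) \<le> dim T"
    using fdim_independent(2)[OF assms(1), of "insert v C"] v C assms(3) by auto
  then show False using C assms(4) \<open>v \<notin> C\<close> by simp
qed

lemma dim_strict_fdim:
  assumes "fin_dim scale T" "subspace S" "S \<subset> T"
  shows "dim S < dim T"
  using subspace_eq_fdim[of T S] assms by (metis not_le psubset_eq)

lemma subspace_sumset: "subspace S \<Longrightarrow> subspace T \<Longrightarrow> subspace (sumset S T)"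
  unfolding sumset_def by (rule subspace_sums)

lemma sumset_upper1: "subspace T \<Longrightarrow> S \<subseteq> sumset S T"
  unfolding sumset_def using subspace_0 by force

lemma sumset_upper2: "subspace S \<Longrightarrow> T \<subseteq> sumset S T"
  unfolding sumset_def using subspace_0 by force

lemma sumset_least: "subspace U \<Longrightarrow> S \<subseteq> U \<Longrightarrow> T \<subseteq> U \<Longrightarrow> sumset S T \<subseteq> U"
  unfolding sumset_def using subspace_add by blast

lemma fdim_sumset:
  assumes "fin_dim scale S" "fin_dim scale T" shows "fin_dim scale (sumset S T)"
proof -
  obtain B C where B: "finite B" "S \<subseteq> span B" and C: "finite C" "T \<subseteq> span C"
    using assms unfolding fin_dim_def by blast
  have "sumset S T \<subseteq> span (B \<union> C)"
    using B C span_mono[of B "B \<union> C"] span_mono[of C "B \<union> C"]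
    by (intro sumset_least subspace_span) auto
  then show ?thesis using B C fdimI[of "B \<union> C"] by blast
qed

text \<open>A basis B of the intersection is extended to bases C of S and D of T. In a relation on
  \<open>C \<union> D\<close> the part over \<open>D - C\<close> lies in S as well as in T, hence in
  the span of B, and therefore vanishes.\<close>

lemma dim_sumset_Int:
  assumes S: "subspace S" "fin_dim scale S" and T: "subspace T" "fin_dim scale T"
  shows "dim (sumset S T) + dim (S \<inter> T) = dim S + dim T"
proof -
  have ST: "fin_dim scale (S \<inter> T)" using S fdim_subset by blast
  obtain B where B: "B \<subseteq> S \<inter> T" "independent B" "S \<inter> T \<subseteq> span B" "finite B" "card B = dim (S \<inter> T)"
    by (rule fdim_basis[OF ST])
  obtain C where C: "B \<subseteq> C" "C \<subseteq> S" "independent C" "S \<subseteq> span C" "finite C" "card C = dim S"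
    by (rule fdim_basis_extend[OF S(2) _ B(2)]) (use B in blast)
  obtain D where D: "B \<subseteq> D" "D \<subseteq> T" "independent D" "T \<subseteq> span D" "finite D" "card D = dim T"
    by (rule fdim_basis_extend[OF T(2) _ B(2)]) (use B in blast)
  have CD: "C \<inter> D = B"
  proof
    show "C \<inter> D \<subseteq> B"
    proof
      fix v assume v: "v \<in> C \<inter> D"
      show "v \<in> B"
      proof (rule ccontr)
        assume "v \<notin> B"
        moreover have "v \<in> span B" using v C D B by blast
        ultimately have "v \<in> span (C - {v})" using span_mono[of B "C - {v}"] C(1) by blast
        then show False using C(3) v unfolding dependent_def by blast
      qed
    qed
  qed (use C D in blast)
  have indep: "independent (C \<union> D)"
  proof (rule independent_if_scalars_zero)
    show fin: "finite (C \<union> D)" using C D by blast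
    fix f x assume sum0: "(\<Sum>x\<in>C \<union> D. f x *s x) = 0" and x: "x \<in> C \<union> D"
    have split: "C \<union> D = C \<union> (D - C)" by blast
    have eq: "(\<Sum>x\<in>C. f x *s x) + (\<Sum>x\<in>D - C. f x *s x) = 0"
      using sum0 unfolding split by (subst (asm) sum.union_disjoint) (use C D in auto)
    define w where "w = (\<Sum>x\<in>D - C. f x *s x)"
    have wT: "w \<in> T" unfolding w_def using D T by (intro subspace_sum subspace_scale) auto
    have "(\<Sum>x\<in>C. f x *s x) \<in> S" using C S by (intro subspace_sum subspace_scale) auto
    moreover have "w = - (\<Sum>x\<in>C. f x *s x)" using eq unfolding w_def by (simp only: eq_neg_iff_add_eq_0 add.commute)
    ultimately have "w \<in> S" using S subspace_neg by auto
    then have "w \<in> span B" using wT B by blast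
    moreover have "w \<in> span (D - B)" unfolding w_def using CD
      by (intro span_sum span_scale span_base) auto
    ultimately have w0: "w = 0"
    proof -
      assume a: "w \<in> span B" "w \<in> span (D - B)"
      obtain g where g: "w = (\<Sum>x\<in>B. g x *s x)" using a(1) span_finite[OF B(4)] by auto
      obtain h where h: "w = (\<Sum>x\<in>D - B. h x *s x)" using a(2) span_finite[of "D - B"] D(5) by auto
      have "(\<Sum>x\<in>D. (if x \<in> B then g x else - h x) *s x)
          = (\<Sum>x\<in>B. g x *s x) + (\<Sum>x\<in>D - B. - h x *s x)"
        using sum.subset_diff[OF D(1) D(5), of "\<lambda>x. (if x \<in> B then g x else - h x) *s x"]
        by (simp add: add.commute)
      also have "\<dots> = 0" using g h by (simp add: sum_negf)
      finally have sum0: "(\<Sum>x\<in>D. (if x \<in> B then g x else - h x) *s x) = 0" .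
      have "g x = 0" if "x \<in> B" for x
        using independentD[OF D(3) D(5) subset_refl sum0, of x] that D(1) by auto
      then show ?thesis using g by simp
    qed
    have D0: "f y = 0" if "y \<in> D - C" for y
      using independentD[OF D(3), of "D - C" f y] D(5) w0 that unfolding w_def by auto
    have "(\<Sum>x\<in>C. f x *s x) = 0" using eq w0 unfolding w_def by simp
    then have C0: "f y = 0" if "y \<in> C" for y
      using independentD[OF C(3) C(5), of f y] that by auto
    show "f x = 0" using x C0 D0 by blast
  qed
  have sub: "C \<union> D \<subseteq> sumset S T"
    using C D sumset_upper1[OF T(1), of S] sumset_upper2[OF S(1), of T] by blast
  have sp: "sumset S T \<subseteq> span (C \<union> D)"
    using C D span_mono[of C "C \<union> D"] span_mono[of D "C \<union> D"]
    by (intro sumset_least subspace_span) auto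
  have "dim (sumset S T) = card (C \<union> D)"
    using basis_card_eq_dim[OF sub sp indep] by simp
  moreover have "card (C \<union> D) + card (C \<inter> D) = card C + card D"
    using card_Un_Int C D by metis
  ultimately show ?thesis using B C D CD by simp
qed

lemma hyperplane_dim:
  assumes "subspace S" "fin_dim scale S"
    and f: "\<And>x y. f (x + y) = f x + f y" "\<And>c x. f (c *s x) = c * f x"
  shows "dim S \<le> dim {x \<in> S. f x = 0} + 1"
proof (cases "\<exists>v\<in>S. f v \<noteq> 0")
  case True
  then obtain v where v: "v \<in> S" "f v \<noteq> 0" by blast
  let ?K = "{x \<in> S. f x = 0}"
  have "fin_dim scale ?K" by (rule fdim_subset[OF assms(2)]) blast
  then obtain C where C: "C \<subseteq> ?K" "independent C" "?K \<subseteq> span C" "finite C" "card C = dim ?K"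
    by (rule fdim_basis)
  have "S \<subseteq> span (insert v C)"
  proof
    fix x assume x: "x \<in> S"
    let ?y = "x - (f x / f v) *s v"
    have "f ?y = f (x + (- (f x / f v)) *s v)" by simp
    also have "\<dots> = f x + (- (f x / f v)) * f v" by (simp only: f)
    finally have "f ?y = 0" using v by simp
    moreover have "?y \<in> S" using x v assms(1) subspace_diff subspace_scale by blast
    ultimately have "?y \<in> span C" using C by blast
    then show "x \<in> span (insert v C)" using span_breakdown_eq by blast
  qed
  then have "dim S \<le> card (insert v C)" using C dim_le_card by blast
  also have "\<dots> \<le> dim ?K + 1" using C(4,5) by (simp add: card_insert_if)
  finally show ?thesis .
next
  case False
  then have "{x \<in> S. f x = 0} = S" by auto
  then show ?thesis by simp
qed

lemma subspace_functional_kernel: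
  assumes "subspace S" and f: "\<And>x y. f (x + y) = f x + f y" "\<And>c x. f (c *s x) = c * f x"
  shows "subspace {x \<in> S. f x = (0::'a)}"
proof -
  have "f 0 = 0" using f(2)[of 0 0] by simp
  then show ?thesis using assms unfolding subspace_def by auto
qed

lemma hyperplanes_dim:
  assumes "finite B" "subspace S" "fin_dim scale S"
    and f: "\<And>b x y. b \<in> B \<Longrightarrow> f b (x + y) = f b x + f b y"
           "\<And>b c x. b \<in> B \<Longrightarrow> f b (c *s x) = c * f b x"
  shows "dim S \<le> dim {x \<in> S. \<forall>b\<in>B. f b x = 0} + card B \<and> subspace {x \<in> S. \<forall>b\<in>B. f b x = 0}"
  using assms(1) f
proof (induction B)
  case (insert b B)
  let ?T = "{x \<in> S. \<forall>b\<in>B. f b x = 0}"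
  have T: "dim S \<le> dim ?T + card B" "subspace ?T" using insert by auto
  have "fin_dim scale ?T" by (rule fdim_subset[OF assms(3)]) blast
  then have "dim ?T \<le> dim {x \<in> ?T. f b x = 0} + 1"
    by (rule hyperplane_dim[OF T(2)]) (simp_all add: insert.prems)
  moreover have "subspace {x \<in> ?T. f b x = 0}"
    by (rule subspace_functional_kernel[OF T(2)]) (simp_all add: insert.prems)
  moreover have "{x \<in> ?T. f b x = 0} = {x \<in> S. \<forall>b\<in>insert b B. f b x = 0}" by auto
  ultimately show ?case using T insert by simp
qed (use assms in simp)

text \<open>With a basis of U that extends one of the left radical, only the vectors outside the
  radical impose conditions on W. The right radical is cut out by that many linear
  equations.\<close>

lemma pairing_rank_le:
  assumes U: "subspace U" "fin_dim scale U" and W: "subspace W" "fin_dim scale W"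
    and l: "\<And>x y z. \<beta> (x + y) z = \<beta> x z + \<beta> y z" "\<And>c x z. \<beta> (c *s x) z = c * \<beta> x z"
    and r: "\<And>x y z. \<beta> z (x + y) = \<beta> z x + \<beta> z y" "\<And>c x z. \<beta> z (c *s x) = c * \<beta> z x"
  shows "dim W + dim {u \<in> U. \<forall>w\<in>W. \<beta> u w = 0} \<le> dim U + dim {w \<in> W. \<forall>u\<in>U. \<beta> u w = 0}"
proof -
  let ?U0 = "{u \<in> U. \<forall>w\<in>W. \<beta> u w = 0}"
  have "fin_dim scale ?U0" by (rule fdim_subset[OF U(2)]) blast
  then obtain B where B: "B \<subseteq> ?U0" "independent B" "?U0 \<subseteq> span B" "finite B" "card B = dim ?U0"
    by (rule fdim_basis)
  then have "B \<subseteq> U" by blast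
  then obtain C where C: "B \<subseteq> C" "C \<subseteq> U" "independent C" "U \<subseteq> span C" "finite C" "card C = dim U"
    by (rule fdim_basis_extend[OF U(2) _ B(2)])
  have "{w \<in> W. \<forall>b\<in>C - B. \<beta> b w = 0} \<subseteq> {w \<in> W. \<forall>u\<in>U. \<beta> u w = 0}"
  proof clarify
    fix w u assume w: "w \<in> W" "\<forall>b\<in>C - B. \<beta> b w = 0" and u: "u \<in> U"
    have b: "\<beta> b w = 0" if "b \<in> C" for b using w B(1) that by blast
    have "u \<in> span C" using u C by blast
    then show "\<beta> u w = 0"
    proof (induction rule: span_induct_alt)
      case base show ?case using l(2)[of 0 0 w] by simp
    next
      case (step c x y) then show ?case using b by (simp add: l)
    qed
  qed
  then have "dim {w \<in> W. \<forall>b\<in>C - B. \<beta> b w = 0} \<le> dim {w \<in> W. \<forall>u\<in>U. \<beta> u w = 0}"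
    by (rule dim_mono_fdim[OF fdim_subset[OF W(2)], rotated]) blast
  moreover have "dim W \<le> dim {w \<in> W. \<forall>b\<in>C - B. \<beta> b w = 0} + card (C - B)"
    using hyperplanes_dim[of "C - B" W \<beta>, OF _ W r] C(5) by simp
  moreover have "card (C - B) + dim ?U0 = dim U"
    using card_Diff_subset[OF B(4) C(1)] card_mono[OF C(5) C(1)] B(5) C(6) by simp
  ultimately show ?thesis by linarith
qed

text \<open>Row rank equals column rank: the inequality is applied to the pairing and to its
  transpose. The pairing may be degenerate on both sides.\<close>

lemma pairing_rank:
  assumes U: "subspace U" "fin_dim scale U" and W: "subspace W" "fin_dim scale W"
    and l: "\<And>x y z. \<beta> (x + y) z = \<beta> x z + \<beta> y z" "\<And>c x z. \<beta> (c *s x) z = c * \<beta> x z"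
    and r: "\<And>x y z. \<beta> z (x + y) = \<beta> z x + \<beta> z y" "\<And>c x z. \<beta> z (c *s x) = c * \<beta> z x"
  shows "dim W + dim {u \<in> U. \<forall>w\<in>W. \<beta> u w = 0} = dim U + dim {w \<in> W. \<forall>u\<in>U. \<beta> u w = 0}"
  using pairing_rank_le[OF U W, of \<beta>, OF l r] pairing_rank_le[OF W U, of "\<lambda>x y. \<beta> y x", OF r l] by simp

end

context vector_space_pair
begin

lemma fdim_image:
  assumes "Vector_Spaces.linear s1 s2 f" "fin_dim s1 S"
  shows "fin_dim s2 (f ` S)"
proof -
  obtain B where B: "finite B" "S \<subseteq> vs1.span B" using assms(2) unfolding fin_dim_def by (elim exE conjE)
  show ?thesis
    using finite_imageI[OF B(1)] linear_spans_image[OF assms(1) B(2)] by (rule vs2.fdimI)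
qed

lemma rank_nullity_fdim:
  assumes f: "Vector_Spaces.linear s1 s2 f" and S: "vs1.subspace S" "fin_dim s1 S"
  shows "vs2.dim (f ` S) + vs1.dim {x \<in> S. f x = 0} = vs1.dim S"
proof -
  let ?K = "{x \<in> S. f x = 0}"
  have "fin_dim s1 ?K" by (rule vs1.fdim_subset[OF S(2)]) blast
  then obtain B where B: "B \<subseteq> ?K" "vs1.independent B" "?K \<subseteq> vs1.span B" "finite B" "card B = vs1.dim ?K"
    by (rule vs1.fdim_basis)
  then have "B \<subseteq> S" by blast
  then obtain C where C: "B \<subseteq> C" "C \<subseteq> S" "vs1.independent C" "S \<subseteq> vs1.span C" "finite C" "card C = vs1.dim S"
    by (rule vs1.fdim_basis_extend[OF S(2) _ B(2)])
  let ?D = "C - B"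
  have fB: "f b = 0" if "b \<in> B" for b using that B by blast
  have inj: "inj_on f (vs1.span ?D)"
  proof (rule linear_inj_on_iff_eq_0[OF f, THEN iffD2])
    show "vs1.subspace (vs1.span ?D)" by simp
    show "\<forall>x\<in>vs1.span ?D. f x = 0 \<longrightarrow> x = 0"
    proof clarify
      fix x assume x: "x \<in> vs1.span ?D" "f x = 0"
      have "vs1.span ?D \<subseteq> S" using C S by (intro vs1.span_minimal) auto
      then have "x \<in> vs1.span B" using x B by blast
      then obtain g where g: "x = (\<Sum>x\<in>B. s1 (g x) x)" using vs1.span_finite[OF B(4)] by auto
      obtain h where h: "x = (\<Sum>x\<in>?D. s1 (h x) x)" using x(1) vs1.span_finite[of ?D] C(5) by auto
      have "(\<Sum>x\<in>C. s1 (if x \<in> B then g x else - h x) x)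
          = (\<Sum>x\<in>B. s1 (g x) x) + (\<Sum>x\<in>?D. s1 (- h x) x)"
        using sum.subset_diff[OF C(1) C(5), of "\<lambda>x. s1 (if x \<in> B then g x else - h x) x"]
        by (simp add: add.commute)
      also have "\<dots> = 0" using g h by (simp add: sum_negf)
      finally have sum0: "(\<Sum>x\<in>C. s1 (if x \<in> B then g x else - h x) x) = 0" .
      have "g x = 0" if "x \<in> B" for x
        using vs1.independentD[OF C(3) C(5) subset_refl sum0, of x] that C(1) by auto
      then show "x = 0" using g by simp
    qed
  qed
  have ind: "vs2.independent (f ` ?D)"
  proof -
    have D: "vs1.independent ?D" using vs1.independent_mono[of C ?D] C(3) by simp
    interpret module_hom s1 s2 f using f by (simp add: module_hom_iff_linear)
    show ?thesis using independent_injective_image[of ?D] D inj by simp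
  qed
  have injD: "inj_on f ?D" using inj vs1.span_superset[of ?D] unfolding inj_on_def by (meson subsetD)
  have "f ` S \<subseteq> vs2.span (f ` ?D)"
  proof -
    have fSC: "f ` S \<subseteq> vs2.span (f ` C)" using linear_spans_image[of f S C] f C(4) by simp
    have fCD: "f ` C \<subseteq> vs2.span (f ` ?D)"
    proof clarify
      fix c assume "c \<in> C"
      then show "f c \<in> vs2.span (f ` ?D)"
        using fB vs2.span_zero vs2.span_base[of "f c" "f ` ?D"] by (cases "c \<in> B") auto
    qed
    have "vs2.span (f ` C) \<subseteq> vs2.span (f ` ?D)" using fCD by (rule vs2.span_minimal) (rule vs2.subspace_span)
    with fSC show ?thesis by (rule order_trans)
  qed
  moreover have "f ` ?D \<subseteq> f ` S" using C(2) by blast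
  ultimately have "vs2.dim (f ` S) = card (f ` ?D)"
    using vs2.basis_card_eq_dim[of "f ` ?D" "f ` S"] ind by simp
  also have "\<dots> = card C - card B" using card_image[OF injD] card_Diff_subset[OF B(4) C(1)] by simp
  finally show ?thesis using B C card_mono[OF C(5) C(1)] by simp
qed

lemma dim_image_inj_fdim:
  assumes f: "Vector_Spaces.linear s1 s2 f" and S: "vs1.subspace S" "fin_dim s1 S" and "\<And>x. x \<in> S \<Longrightarrow> f x = 0 \<Longrightarrow> x = 0"
  shows "vs2.dim (f ` S) = vs1.dim S"
proof -
  have "f 0 = 0" using linear_0[OF f] .
  then have "{x \<in> S. f x = 0} = {0}" using assms vs1.subspace_0 by auto
  then have "vs1.dim {x \<in> S. f x = 0} = 0"
    using vs1.dim_eq_card_independent[of "{}"] vs1.dim_span[of "{}"] vs1.independent_empty by simp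
  then show ?thesis using rank_nullity_fdim[OF f S] by simp
qed

end

section \<open>Plane polynomials filtered by total degree\<close>

text \<open>Scalars enter as constants of both polynomial layers, which makes
  \<open>'k poly poly\<close> a vector space over \<open>'k\<close>.\<close>

definition scaleP :: "'k::field \<Rightarrow> 'k poly poly \<Rightarrow> 'k poly poly" where
  "scaleP c F = smult [:c:] F"

interpretation VR: vector_space "scaleP :: 'k::field \<Rightarrow> _"
  by unfold_locales
    (simp_all add: scaleP_def smult_add_right smult_add_left[symmetric] mult_ac)

interpretation VX: vector_space "smult :: 'k::field \<Rightarrow> _"
  by unfold_locales (simp_all add: smult_add_right smult_add_left)

interpretation VRX: vector_space_pair "scaleP :: 'k::field \<Rightarrow> _" "smult :: 'k::field \<Rightarrow> _"
  by unfold_locales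

interpretation VRR: vector_space_pair "scaleP :: 'k::field \<Rightarrow> _" "scaleP :: 'k::field \<Rightarrow> _"
  by unfold_locales

interpretation VXX: vector_space_pair "smult :: 'k::field \<Rightarrow> _" "smult :: 'k::field \<Rightarrow> _"
  by unfold_locales

lemma coeff_scaleP: "coeff (coeff (scaleP c F) i) j = c * coeff (coeff F i) j"
  by (simp add: scaleP_def)

lemma scaleP_mult: "scaleP c F * G = scaleP c (F * G)" "F * scaleP c G = scaleP c (F * G)"
  by (simp_all add: scaleP_def)

lemma scaleP_minus1: "scaleP (- 1) F = - F"
  by (intro poly_eqI) (simp add: coeff_scaleP)

text \<open>These are the forms of degree d in three variables with the last one set to 1. The
  degree is an integer: negative degrees give the zero space, and the duality between j and e - j
  needs no case distinction.\<close>

definition tpolys :: "int \<Rightarrow> 'k::field poly poly set" where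
  "tpolys d = {F. \<forall>i j. coeff (coeff F i) j \<noteq> 0 \<longrightarrow> int (i + j) \<le> d}"

definition upolys :: "int \<Rightarrow> 'k::field poly set" where
  "upolys d = {f. \<forall>i. coeff f i \<noteq> 0 \<longrightarrow> int i \<le> d}"

lemma tpolysD: "F \<in> tpolys d \<Longrightarrow> coeff (coeff F i) j \<noteq> 0 \<Longrightarrow> int i + int j \<le> d"
  unfolding tpolys_def by auto

lemma upolysD: "f \<in> upolys d \<Longrightarrow> coeff f i \<noteq> 0 \<Longrightarrow> int i \<le> d"
  unfolding upolys_def by blast

lemma subspace_tpolys: "VR.subspace (tpolys d)"
proof (rule VR.subspaceI)
  fix F G :: "'k::field poly poly" assume "F \<in> tpolys d" "G \<in> tpolys d"
  then show "F + G \<in> tpolys d" unfolding tpolys_def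
    by (simp add: coeff_add) (metis add.right_neutral add_cancel_right_left)
qed (auto simp: tpolys_def coeff_scaleP)

lemma subspace_upolys: "VX.subspace (upolys d)"
proof (rule VX.subspaceI)
  fix F G :: "'k::field poly" assume "F \<in> upolys d" "G \<in> upolys d"
  then show "F + G \<in> upolys d" unfolding upolys_def
    by (simp add: coeff_add) (metis add.right_neutral add_cancel_right_left)
qed (auto simp: upolys_def)

lemmas tpolys_add = VR.subspace_add[OF subspace_tpolys]
  and tpolys_diff = VR.subspace_diff[OF subspace_tpolys]
  and tpolys_scale = VR.subspace_scale[OF subspace_tpolys]
  and tpolys_0 = VR.subspace_0[OF subspace_tpolys]

lemmas upolys_add = VX.subspace_add[OF subspace_upolys]
  and upolys_diff = VX.subspace_diff[OF subspace_upolys]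
  and upolys_smult = VX.subspace_scale[OF subspace_upolys]
  and upolys_0 = VX.subspace_0[OF subspace_upolys]

lemma tpolys_mono: "d \<le> d' \<Longrightarrow> tpolys d \<subseteq> tpolys d'"
  unfolding tpolys_def by (auto intro: order_trans)

lemma upolys_mono: "d \<le> d' \<Longrightarrow> upolys d \<subseteq> upolys d'"
  unfolding upolys_def by (auto intro: order_trans)

lemma tpolys_neg: assumes "d < 0" shows "tpolys d = {0}"
proof -
  have "F = 0" if "F \<in> tpolys d" for F :: "'k::field poly poly"
  proof (intro poly_eqI)
    fix i j show "coeff (coeff F i) j = coeff (coeff 0 i) j"
      using that assms unfolding tpolys_def by force
  qed
  then show ?thesis using tpolys_0[of d] by blast
qed

lemma coeff2_mult:
  "coeff (coeff (F * G) k) l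
    = (\<Sum>i\<le>k. \<Sum>j\<le>l. coeff (coeff F i) j * coeff (coeff G (k - i)) (l - j))"
  by (simp add: coeff_mult coeff_sum)

lemma tpolys_mult: assumes "F \<in> tpolys m" "G \<in> tpolys n" shows "F * G \<in> tpolys (m + n)"
  unfolding tpolys_def
proof clarify
  fix k l assume "coeff (coeff (F * G) k) l \<noteq> 0"
  then obtain i j where ij: "i \<le> k" "j \<le> l" "coeff (coeff F i) j * coeff (coeff G (k - i)) (l - j) \<noteq> 0"
    unfolding coeff2_mult by (metis (no_types, lifting) atMost_iff sum.neutral)
  then have "int i + int j \<le> m" "int (k - i) + int (l - j) \<le> n"
    using tpolysD[OF assms(1)] tpolysD[OF assms(2)] mult_not_zero by blast+
  then show "int (k + l) \<le> m + n" using ij by linarith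
qed

lemma upolys_mult: assumes "f \<in> upolys m" "g \<in> upolys n" shows "f * g \<in> upolys (m + n)"
  unfolding upolys_def
proof clarify
  fix k assume "coeff (f * g) k \<noteq> 0"
  then obtain i where i: "i \<le> k" "coeff f i * coeff g (k - i) \<noteq> 0"
    unfolding coeff_mult by (metis (no_types, lifting) atMost_iff sum.neutral)
  then have "int i \<le> m" "int (k - i) \<le> n"
    using upolysD[OF assms(1)] upolysD[OF assms(2)] mult_not_zero by blast+
  then show "int k \<le> m + n" using i by linarith
qed

lemma upolys_iff: "f \<in> upolys d \<longleftrightarrow> f = 0 \<or> int (degree f) \<le> d"
proof
  assume "f \<in> upolys d"
  then show "f = 0 \<or> int (degree f) \<le> d"
    using upolysD[of f d "degree f"] leading_coeff_0_iff[of f] by blast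
next
  assume a: "f = 0 \<or> int (degree f) \<le> d"
  have "int i \<le> d" if "coeff f i \<noteq> 0" for i
  proof -
    have "i \<le> degree f" "f \<noteq> 0" using that le_degree by auto
    then show ?thesis using a by linarith
  qed
  then show "f \<in> upolys d" unfolding upolys_def by blast
qed

lemma tpolys_const: "[:f:] \<in> tpolys d \<longleftrightarrow> f \<in> upolys d"
proof -
  have "coeff (coeff [:f:] i) j = (if i = 0 then coeff f j else 0)" for i j
    by (cases i) simp_all
  then show ?thesis unfolding tpolys_def upolys_def by simp
qed

lemma one_in_tpolys: "0 \<le> d \<Longrightarrow> 1 \<in> tpolys d"
  using tpolys_const[of 1 d] by (simp add: upolys_iff flip: one_pCons)

section \<open>Additivity of the total degree\<close>

definition exact_tdeg :: "int \<Rightarrow> 'k::field poly poly \<Rightarrow> bool" where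
  "exact_tdeg n F \<longleftrightarrow> F \<in> tpolys n \<and> F \<notin> tpolys (n - 1)"

lemma exact_tdeg_coeff:
  assumes "exact_tdeg n F" obtains i j where "coeff (coeff F i) j \<noteq> 0" "int (i + j) = n"
proof -
  obtain i j where "coeff (coeff F i) j \<noteq> 0" "\<not> int (i + j) \<le> n - 1"
    using assms unfolding exact_tdeg_def tpolys_def by blast
  moreover from this have "int (i + j) \<le> n"
    using assms unfolding exact_tdeg_def tpolys_def by blast
  ultimately show ?thesis using that by force
qed

lemma exact_tdeg_nonneg: "exact_tdeg n F \<Longrightarrow> 0 \<le> n"
  by (erule exact_tdeg_coeff) simp

lemma exact_tdeg_ex:
  assumes "F \<noteq> 0" "F \<in> tpolys d" obtains n where "exact_tdeg n F" "0 \<le> n" "n \<le> d"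
proof -
  have neg: "F \<notin> tpolys c" if "c < 0" for c
    using assms(1) tpolys_neg[OF that] by blast
  have "\<exists>n. exact_tdeg n F \<and> n \<le> int m" if "F \<in> tpolys (int m)" for m
    using that
  proof (induction m)
    case 0
    then show ?case using neg[of "-1"] unfolding exact_tdeg_def by (intro exI[of _ 0]) simp
  next
    case (Suc m)
    show ?case
    proof (cases "F \<in> tpolys (int m)")
      case True
      then obtain n where "exact_tdeg n F" "n \<le> int m" using Suc.IH by blast
      then show ?thesis by (intro exI[of _ n]) simp
    next
      case False then show ?thesis
        using Suc.prems unfolding exact_tdeg_def by (intro exI[of _ "int (Suc m)"]) simp
    qed
  qed
  moreover have "d \<ge> 0" using neg[of d] assms(2) by (meson not_le)
  ultimately obtain n where "exact_tdeg n F" "n \<le> d" using assms(2) by (metis nonneg_int_cases)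
  then show ?thesis using that exact_tdeg_nonneg by blast
qed

lemma tpolys_ex: obtains d where "F \<in> tpolys d" "0 \<le> d"
proof -
  define S where "S = (\<Union>i\<le>degree F. (\<lambda>j. i + j) ` {..degree (coeff F i)})"
  have fin: "finite S" unfolding S_def by auto
  have "F \<in> tpolys (int (Max (insert 0 S)))"
    unfolding tpolys_def
  proof clarify
    fix i j assume c: "coeff (coeff F i) j \<noteq> 0"
    then have "coeff F i \<noteq> 0" by auto
    then have "i \<le> degree F" "j \<le> degree (coeff F i)" using c le_degree by auto
    then have "i + j \<in> S" unfolding S_def by blast
    then have "i + j \<le> Max (insert 0 S)" using fin by (intro Max_ge) auto
    then show "int (i + j) \<le> int (Max (insert 0 S))" by (rule of_nat_mono)
  qed
  then show ?thesis by (rule that) simp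
qed

lemma exact_tdeg_mult:
  assumes F: "exact_tdeg n F" and G: "exact_tdeg m G" shows "exact_tdeg (n + m) (F * G)"
proof -
  \<comment> \<open>\<open>top H d i\<close> says that a monomial of H of total degree d has outer
    exponent i. The largest such exponents in F and in G single out one product of monomials that no
    other pair reaches.\<close>
  define top where "top = (\<lambda>(H::'a poly poly) d i. \<exists>j. coeff (coeff H i) j \<noteq> 0 \<and> int (i + j) = d)"
  have bd: "i \<le> nat d" if "top H d i" for H d i using that unfolding top_def by auto
  have max: "\<exists>i. top H d i \<and> (\<forall>k>i. \<not> top H d k)" if "exact_tdeg d H" for H d
  proof -
    have ex: "\<exists>i. top H d i" using that unfolding top_def by (elim exact_tdeg_coeff) blast
    have "top H d (Greatest (top H d))" by (rule GreatestI_ex_nat[OF ex bd])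
    moreover have "\<not> top H d k" if "k > Greatest (top H d)" for k
      using Greatest_le_nat[of "top H d" k "nat d"] bd[of H d] that by (meson not_le)
    ultimately show ?thesis by blast
  qed
  obtain i1 where i1: "top F n i1" "\<forall>k>i1. \<not> top F n k" using max[OF F] by blast
  obtain i2 where i2: "top G m i2" "\<forall>k>i2. \<not> top G m k" using max[OF G] by blast
  obtain j1 where j1: "coeff (coeff F i1) j1 \<noteq> 0" "int (i1 + j1) = n" using i1(1) unfolding top_def by blast
  obtain j2 where j2: "coeff (coeff G i2) j2 \<noteq> 0" "int (i2 + j2) = m" using i2(1) unfolding top_def by blast
  define T where "T = (\<lambda>i j. coeff (coeff F i) j * coeff (coeff G (i1 + i2 - i)) (j1 + j2 - j))"
  have z: "T i j = 0" if "i \<le> i1 + i2" "j \<le> j1 + j2" "i = i1 \<longrightarrow> j \<noteq> j1" for i j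
  proof (rule ccontr)
    assume nz: "T i j \<noteq> 0"
    then have nz: "coeff (coeff F i) j \<noteq> 0" "coeff (coeff G (i1 + i2 - i)) (j1 + j2 - j) \<noteq> 0"
      unfolding T_def by auto
    then have le: "int (i + j) \<le> n" "int ((i1 + i2 - i) + (j1 + j2 - j)) \<le> m"
      using F G tpolysD unfolding exact_tdeg_def of_nat_add by blast+
    then have "int (i + j) = n" "int ((i1 + i2 - i) + (j1 + j2 - j)) = m" using that j1 j2 by linarith+
    then have "top F n i" "top G m (i1 + i2 - i)" using nz unfolding top_def by auto
    then have "i \<le> i1" "i1 + i2 - i \<le> i2" using i1 i2 by (meson not_le)+
    then have "i = i1" using that by linarith
    then show False using that \<open>int (i + j) = n\<close> j1 by auto
  qed
  have T1: "T i1 j1 \<noteq> 0" using j1 j2 unfolding T_def by simp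
  have inner: "(\<Sum>j\<le>j1 + j2. T i j) = (if i = i1 then T i1 j1 else 0)" if "i \<le> i1 + i2" for i
  proof -
    have "(\<Sum>j\<le>j1 + j2. T i j) = (\<Sum>j\<le>j1 + j2. if j = j1 then (if i = i1 then T i1 j1 else 0) else 0)"
      using z[OF that] by (intro sum.cong) auto
    then show ?thesis by (simp add: sum.delta)
  qed
  have "coeff (coeff (F * G) (i1 + i2)) (j1 + j2) = (\<Sum>i\<le>i1 + i2. \<Sum>j\<le>j1 + j2. T i j)"
    unfolding coeff2_mult T_def ..
  also have "\<dots> = (\<Sum>i\<le>i1 + i2. if i = i1 then T i1 j1 else 0)"
    using inner by (intro sum.cong) auto
  also have "\<dots> = T i1 j1" by (simp add: sum.delta)
  finally have nz: "coeff (coeff (F * G) (i1 + i2)) (j1 + j2) \<noteq> 0" using T1 by simp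
  have "F * G \<notin> tpolys (n + m - 1)"
  proof
    assume "F * G \<in> tpolys (n + m - 1)"
    from tpolysD[OF this nz] show False using j1(2) j2(2) by simp
  qed
  then show ?thesis using tpolys_mult F G unfolding exact_tdeg_def by blast
qed

lemma tpolys_cancel:
  assumes "exact_tdeg n F" "F * G \<in> tpolys d" shows "G \<in> tpolys (d - n)"
proof (cases "G = 0")
  case False
  obtain e where "G \<in> tpolys e" by (rule tpolys_ex)
  then obtain m where m: "exact_tdeg m G" using exact_tdeg_ex[OF False] by auto
  then have "F * G \<notin> tpolys (n + m - 1)" using exact_tdeg_mult assms(1) exact_tdeg_def by blast
  then have "n + m \<le> d" using assms(2) tpolys_mono[of d "n + m - 1"] by force
  then show ?thesis using m tpolys_mono[of m "d - n"] unfolding exact_tdeg_def by force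
qed (simp add: tpolys_0)

lemma exact_tdeg_nonzero: "exact_tdeg n F \<Longrightarrow> F \<noteq> 0"
  unfolding exact_tdeg_def using tpolys_0 by blast

lemma fin_dim_tpolys: "fin_dim scaleP (tpolys d :: 'k::field poly poly set)"
proof (rule VR.fdimI)
  let ?B = "(\<lambda>(i, j). monom (monom (1::'k) j) i) ` ({..nat d} \<times> {..nat d})"
  show "finite ?B" by simp
  show "tpolys d \<subseteq> VR.span ?B"
  proof
    fix F :: "'k poly poly" assume F: "F \<in> tpolys d"
    have F_eq: "F = (\<Sum>i\<le>nat d. \<Sum>j\<le>nat d. scaleP (coeff (coeff F i) j) (monom (monom 1 j) i))"
    proof (intro poly_eqI)
      fix k l
      have out: "coeff (coeff F k) l = 0" if "\<not> (k \<le> nat d \<and> l \<le> nat d)"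
      proof (rule ccontr)
        assume "coeff (coeff F k) l \<noteq> 0"
        from tpolysD[OF F this] that show False by arith
      qed
      have "coeff (coeff (\<Sum>i\<le>nat d. \<Sum>j\<le>nat d. scaleP (coeff (coeff F i) j) (monom (monom 1 j) i)) k) l
        = (\<Sum>i\<le>nat d. \<Sum>j\<le>nat d. if i = k then (if j = l then coeff (coeff F k) l else 0) else 0)"
        unfolding coeff_sum coeff_scaleP by (intro sum.cong refl) auto
      also have "\<dots> = (\<Sum>i\<le>nat d. if i = k then (\<Sum>j\<le>nat d. (if j = l then coeff (coeff F k) l else 0)) else 0)"
        by (intro sum.cong refl) simp
      also have "\<dots> = (if k \<le> nat d then if l \<le> nat d then coeff (coeff F k) l else 0 else 0)"
        by (simp add: sum.delta)
      also have "\<dots> = coeff (coeff F k) l"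
        using out by auto
      finally show "coeff (coeff F k) l
         = coeff (coeff (\<Sum>i\<le>nat d. \<Sum>j\<le>nat d. scaleP (coeff (coeff F i) j) (monom (monom 1 j) i)) k) l"
        by (rule sym)
    qed
    have "(\<Sum>i\<le>nat d. \<Sum>j\<le>nat d. scaleP (coeff (coeff F i) j) (monom (monom 1 j) i)) \<in> VR.span ?B"
      by (intro VR.span_sum VR.span_scale VR.span_base) auto
    then show "F \<in> VR.span ?B" using F_eq by simp
  qed
qed

lemma upolys_basis:
  fixes d :: int
  defines "A \<equiv> {i::nat. int i \<le> d}"
  shows "VX.independent (monom (1::'k::field) ` A)" "upolys d \<subseteq> VX.span (monom (1::'k) ` A)"
    "monom (1::'k) ` A \<subseteq> upolys d" "finite A"
proof -
  have inj: "inj_on (monom (1::'k)) A" by (auto simp: inj_on_def monom_eq_iff')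
  have "A \<subseteq> {..nat d}" unfolding A_def by auto
  then show fin: "finite A" by (rule finite_subset) simp
  have coeff_lin: "coeff (\<Sum>i\<in>A. smult (g i) (monom (1::'k) i)) k = (if k \<in> A then g k else 0)" for g k
  proof -
    have "coeff (\<Sum>i\<in>A. smult (g i) (monom (1::'k) i)) k = (\<Sum>i\<in>A. if i = k then g i else 0)"
      unfolding coeff_sum by (intro sum.cong) auto
    then show ?thesis using fin by (simp add: sum.delta)
  qed
  show "VX.independent (monom (1::'k) ` A)"
  proof (rule VX.independent_if_scalars_zero)
    show "finite (monom (1::'k) ` A)" using fin by simp
    fix f x assume s: "(\<Sum>x\<in>monom (1::'k) ` A. smult (f x) x) = 0" and x: "x \<in> monom (1::'k) ` A"
    obtain k where k: "x = monom 1 k" "k \<in> A" using x by blast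
    have "(\<Sum>i\<in>A. smult (f (monom 1 i)) (monom (1::'k) i)) = 0" using s by (simp add: sum.reindex[OF inj])
    then show "f x = 0" using coeff_lin[of "\<lambda>i. f (monom 1 i)" k] k by simp
  qed
  show "monom (1::'k) ` A \<subseteq> upolys d"
    unfolding upolys_def A_def by (auto split: if_splits)
  show "upolys d \<subseteq> VX.span (monom (1::'k) ` A)"
  proof
    fix f :: "'k poly" assume f: "f \<in> upolys d"
    have "(\<Sum>i\<in>A. smult (coeff f i) (monom 1 i)) = f"
    proof (intro poly_eqI)
      fix k
      show "coeff (\<Sum>i\<in>A. smult (coeff f i) (monom 1 i)) k = coeff f k"
        unfolding coeff_lin using upolysD[OF f, of k] unfolding A_def by auto
    qed
    moreover have "(\<Sum>i\<in>A. smult (coeff f i) (monom 1 i)) \<in> VX.span (monom (1::'k) ` A)"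
      by (intro VX.span_sum VX.span_scale VX.span_base) auto
    ultimately show "f \<in> VX.span (monom (1::'k) ` A)" by simp
  qed
qed

lemma fin_dim_upolys: "fin_dim smult (upolys d)"
  by (rule VX.fdimI[OF _ upolys_basis(2)]) (simp add: upolys_basis(4))

lemma dim_upolys: assumes "- 1 \<le> d" shows "int (VX.dim (upolys d :: 'k::field poly set)) = d + 1"
proof -
  have inj: "inj (monom (1::'k))" by (auto simp: inj_on_def monom_eq_iff')
  have "i \<in> {i::nat. int i \<le> d} \<longleftrightarrow> i \<in> {..<nat (d + 1)}" for i
    unfolding mem_Collect_eq lessThan_iff by linarith
  then have A: "{i::nat. int i \<le> d} = {..<nat (d + 1)}" by blast
  have "card (monom (1::'k) ` {i::nat. int i \<le> d}) = VX.dim (upolys d :: 'k poly set)"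
    by (rule VX.basis_card_eq_dim[OF upolys_basis(3,2,1)])
  moreover have "card (monom (1::'k) ` {i::nat. int i \<le> d}) = nat (d + 1)"
    using card_image[OF inj_on_subset[OF inj subset_UNIV], of "{i::nat. int i \<le> d}"] A by simp
  ultimately show ?thesis using assms by linarith
qed

subsection \<open>Lines\<close>

text \<open>With inner variable x and outer variable y this is y - (a x + b). The lines without y
  are left out; the others form a dense chart of the dual plane, which is enough for statements
  about general lines.\<close>

definition line :: "'k::field \<Rightarrow> 'k \<Rightarrow> 'k poly poly" where
  "line a b = [:- [:b, a:], 1:]"

definition restr :: "'k::field \<Rightarrow> 'k \<Rightarrow> 'k poly poly \<Rightarrow> 'k poly" where
  "restr a b F = poly F [:b, a:]"

lemma restr_add: "restr a b (F + G) = restr a b F + restr a b G"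
  and restr_diff: "restr a b (F - G) = restr a b F - restr a b G"
  and restr_mult: "restr a b (F * G) = restr a b F * restr a b G"
  and restr_const [simp]: "restr a b [:f:] = f"
  and restr_0 [simp]: "restr a b 0 = 0"
  by (simp_all add: restr_def)

lemma restr_scale: "restr a b (scaleP c F) = smult c (restr a b F)"
  unfolding restr_def scaleP_def poly_smult by simp

lemma restr_line [simp]: "restr a b (line a b) = 0"
  unfolding restr_def line_def poly_pCons poly_0 by (simp only: mult_zero_right add_0_right mult_1_right left_minus)

lemma restr_linear: "Vector_Spaces.linear scaleP smult (restr a b)"
  unfolding Vector_Spaces.linear_iff
  by (intro conjI allI VR.vector_space_axioms VX.vector_space_axioms restr_add restr_scale)

lemma restr_line_other: "restr a b (line a' b') = [:b - b', a - a':]"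
proof -
  have "restr a b (line a' b') = - [:b', a':] + [:b, a:]"
    unfolding restr_def line_def poly_pCons poly_0 by (simp only: mult_zero_right add_0_right mult_1_right)
  then show ?thesis by (simp only: minus_pCons add_pCons) simp
qed

lemma outer_var_in: "[:0, 1:] \<in> tpolys 1"
proof -
  have "coeff [:0, 1::'a poly:] i = (if i = 1 then 1 else 0)" for i
    by (cases i) (simp_all add: coeff_pCons split: nat.splits)
  then show ?thesis unfolding tpolys_def by (simp add: coeff_1)
qed

lemma line_eq: "line a b = [:0, 1:] - [:[:b, a:]:]"
  by (simp add: line_def)

lemma line_in: "line a b \<in> tpolys 1"
  unfolding line_eq by (intro tpolys_diff outer_var_in tpolys_const[THEN iffD2]) (simp add: upolys_iff)

lemma exact_line: "exact_tdeg 1 (line a b)"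
proof -
  have "coeff (coeff (line a b) 1) 0 = 1" by (simp add: line_def)
  then have "line a b \<notin> tpolys 0" using tpolysD[of "line a b" 0 1 0] by auto
  then show ?thesis using line_in unfolding exact_tdeg_def by simp
qed

lemma line_nonzero: "line a b \<noteq> 0" by (simp add: line_def)

lemma restr_eq_0: "restr a b F = 0 \<longleftrightarrow> line a b dvd F"
  by (simp add: restr_def line_def poly_eq_0_iff_dvd)

lemma restr_eq_0_tpolys:
  assumes "F \<in> tpolys d" "restr a b F = 0"
  obtains G where "G \<in> tpolys (d - 1)" "F = line a b * G"
proof -
  have "line a b dvd F" using assms(2) restr_eq_0 by blast
  then obtain G where G: "F = line a b * G" ..
  then have "G \<in> tpolys (d - 1)" using tpolys_cancel[OF exact_line] assms(1) by simp
  then show ?thesis using that G by blast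
qed

lemma restr_tpolys: assumes "F \<in> tpolys d" shows "restr a b F \<in> upolys d"
proof -
  have lin: "[:b, a:] \<in> upolys 1" by (simp add: upolys_iff)
  have pow: "[:b, a:] ^ i \<in> upolys (int i)" for i
  proof (induction i)
    case (Suc i) then show ?case using upolys_mult[OF lin Suc] by simp
  qed (simp add: upolys_iff)
  have "coeff F i * [:b, a:] ^ i \<in> upolys d" for i
  proof -
    have "coeff F i \<in> upolys (d - int i)"
      using assms unfolding tpolys_def upolys_def by force
    from upolys_mult[OF this pow[of i]] show ?thesis by simp
  qed
  then show ?thesis unfolding restr_def poly_altdef
    by (intro VX.subspace_sum[OF subspace_upolys])
qed

lemma linear_mult: "Vector_Spaces.linear scaleP scaleP ((*) (G :: 'k::field poly poly))"
  unfolding Vector_Spaces.linear_iff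
  by (intro conjI allI VR.vector_space_axioms distrib_left scaleP_mult)

lemma subspace_mult: "VR.subspace S \<Longrightarrow> VR.subspace ((*) G ` S)"
  by (rule VRR.linear_subspace_image[OF linear_mult])

lemma fin_dim_mult: "fin_dim scaleP S \<Longrightarrow> fin_dim scaleP ((*) G ` S)"
  by (rule VRR.fdim_image[OF linear_mult])

lemma dim_mult:
  assumes "VR.subspace S" "fin_dim scaleP S" "G \<noteq> 0" shows "VR.dim ((*) G ` S) = VR.dim S"
  by (rule VRR.dim_image_inj_fdim[OF linear_mult assms(1,2)]) (use assms(3) in simp)

lemma mult_tpolys_subset: "G \<in> tpolys n \<Longrightarrow> (*) G ` tpolys d \<subseteq> tpolys (d + n)"
  using tpolys_mult[of G n] by (auto simp: add.commute)

lemma restr_image_tpolys: "restr (a::'k::field) b ` tpolys d = upolys d"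
proof (intro subset_antisym subsetI)
  fix f :: "'k poly" assume "f \<in> upolys d"
  then have "restr a b [:f:] \<in> restr a b ` tpolys d" using tpolys_const by blast
  then show "f \<in> restr a b ` tpolys d" by simp
qed (use restr_tpolys in blast)

lemma restr_kernel: "{F \<in> tpolys d. restr a b F = 0} = (*) (line a b) ` tpolys (d - 1)"
proof -
  have "(*) (line a b) ` tpolys (d - 1) \<subseteq> tpolys d"
    using mult_tpolys_subset[OF line_in, of a b "d - 1"] by simp
  then show ?thesis by (auto simp: restr_mult elim: restr_eq_0_tpolys)
qed

text \<open>Restriction to a line has image \<open>upolys d\<close> and kernel the multiples of the
  line, so each degree adds d + 1. The formula starts at -2 because (d + 1) (d + 2) vanishes at -2
  and at -1.\<close>

lemma dim_tpolys:
  assumes "- 2 \<le> d" shows "2 * int (VR.dim (tpolys d :: 'k::field poly poly set)) = (d + 1) * (d + 2)"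
proof -
  have "2 * int (VR.dim (tpolys (int m - 2) :: 'k poly poly set)) = (int m - 1) * int m" for m
  proof (induction m)
    case 0
    have "VR.dim {0 :: 'k poly poly} = 0"
      using VR.dim_span_eq_card_independent[OF VR.independent_empty] by simp
    then show ?case by (simp add: tpolys_neg)
  next
    case (Suc m)
    define d where "d = int m - 1"
    have "VX.dim (restr 0 0 ` (tpolys d :: 'k poly poly set)) + VR.dim {F \<in> tpolys d. restr 0 0 F = (0 :: 'k poly)}
        = VR.dim (tpolys d :: 'k poly poly set)"
      by (rule VRX.rank_nullity_fdim[OF restr_linear subspace_tpolys fin_dim_tpolys])
    then have "VX.dim (upolys d :: 'k poly set) + VR.dim (tpolys (d - 1) :: 'k poly poly set)
        = VR.dim (tpolys d :: 'k poly poly set)"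
      unfolding restr_kernel restr_image_tpolys dim_mult[OF subspace_tpolys fin_dim_tpolys line_nonzero] .
    moreover have "int (VX.dim (upolys d :: 'k poly set)) = d + 1" by (rule dim_upolys) (simp add: d_def)
    moreover have "2 * int (VR.dim (tpolys (d - 1) :: 'k poly poly set)) = (int m - 1) * int m"
      using Suc.IH by (simp add: d_def)
    ultimately have "2 * int (VR.dim (tpolys d :: 'k poly poly set)) = 2 * (d + 1) + (int m - 1) * int m"
      by (metis (no_types, opaque_lifting) distrib_left of_nat_add)
    then show ?case by (simp add: d_def algebra_simps)
  qed
  from this[of "nat (d + 2)"] show ?thesis using assms by (simp add: algebra_simps)
qed

text \<open>Adding all multiples of the line does not change the restriction of W and supplies the
  whole kernel. The rank on the line thus becomes the dimension of a sum in a fixed space, whose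
  dependence on the line can be followed.\<close>

lemma dim_restr:
  fixes W :: "'k::field poly poly set"
  assumes "VR.subspace W" "W \<subseteq> tpolys d"
  shows "VX.dim (restr a b ` W) + VR.dim (tpolys (d - 1) :: 'k poly poly set)
    = VR.dim (sumset W ((*) (line a b) ` tpolys (d - 1)))"
proof -
  let ?T = "sumset W ((*) (line a b) ` tpolys (d - 1))"
  let ?LP = "(*) (line a b) ` tpolys (d - 1)"
  have LP: "?LP \<subseteq> tpolys d"
    using mult_tpolys_subset[OF line_in, of a b "d - 1"] by simp
  have sub: "VR.subspace ?T" by (intro VR.subspace_sumset subspace_mult subspace_tpolys assms)
  have le: "?T \<subseteq> tpolys d" by (intro VR.sumset_least subspace_tpolys assms LP)
  have img: "restr a b ` ?T = restr a b ` W"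
  proof
    show "restr a b ` ?T \<subseteq> restr a b ` W"
      by (auto simp: restr_add restr_mult elim!: sumsetE)
    show "restr a b ` W \<subseteq> restr a b ` ?T"
      using VR.sumset_upper1[OF subspace_mult[OF subspace_tpolys]] by blast
  qed
  have "?LP \<subseteq> ?T" by (rule VR.sumset_upper2[OF assms(1)])
  then have ker: "{F \<in> ?T. restr a b F = 0} = ?LP"
    using le restr_kernel[of d a b] by blast
  show ?thesis
    using VRX.rank_nullity_fdim[OF restr_linear[of a b] sub VR.fdim_subset[OF fin_dim_tpolys le]]
    unfolding img ker dim_mult[OF subspace_tpolys fin_dim_tpolys line_nonzero] by simp
qed

section \<open>Openness of linear independence\<close>

text \<open>Regular functions on a parameter space. The instances are polynomials in a deformation
  parameter, polynomials in the coefficients a, b of a line, and finally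
  \<open>polynomial_functions I\<close>.\<close>

locale fun_algebra =
  fixes PP :: "('x \<Rightarrow> 'k::field) set"
  assumes PP_const: "(\<lambda>_. c) \<in> PP"
    and PP_add: "f \<in> PP \<Longrightarrow> g \<in> PP \<Longrightarrow> (\<lambda>x. f x + g x) \<in> PP"
    and PP_mult: "f \<in> PP \<Longrightarrow> g \<in> PP \<Longrightarrow> (\<lambda>x. f x * g x) \<in> PP"
begin

lemma PP_diff: assumes "f \<in> PP" "g \<in> PP" shows "(\<lambda>x. f x - g x) \<in> PP"
  using PP_add[OF assms(1) PP_mult[OF PP_const[of "- 1"] assms(2)]] by simp

lemma PP_sum: "(\<And>i. i \<in> A \<Longrightarrow> f i \<in> PP) \<Longrightarrow> (\<lambda>x. \<Sum>i\<in>A. f i x) \<in> PP"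
  by (induction A rule: infinite_finite_induct) (simp_all add: PP_const PP_add)

text \<open>Gaussian elimination without division: the pivot \<open>v s x c0\<close> may vanish for other values of
  the parameter, and it becomes a factor of the resulting function.\<close>

lemma independence_open:
  assumes "finite S" and "\<And>i c. i \<in> S \<Longrightarrow> (\<lambda>x. v i x c) \<in> PP"
    and "\<And>\<alpha>. (\<And>c. (\<Sum>i\<in>S. \<alpha> i * v i x0 c) = 0) \<Longrightarrow> \<forall>i\<in>S. \<alpha> i = 0"
  obtains p where "p \<in> PP" "p x0 \<noteq> 0"
    "\<forall>x \<alpha>. p x \<noteq> 0 \<longrightarrow> (\<forall>c. (\<Sum>i\<in>S. \<alpha> i * v i x c) = 0) \<longrightarrow> (\<forall>i\<in>S. \<alpha> i = 0)"
proof -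
  have "\<exists>p\<in>PP. p x0 \<noteq> 0 \<and> (\<forall>x \<alpha>. p x \<noteq> 0 \<longrightarrow> (\<forall>c. (\<Sum>i\<in>S. \<alpha> i * v i x c) = 0) \<longrightarrow> (\<forall>i\<in>S. \<alpha> i = 0))"
    using assms
  proof (induction S arbitrary: v)
    case empty
    show ?case by (intro bexI[of _ "\<lambda>_. 1"]) (simp_all add: PP_const)
  next
    case (insert s S)
    have "\<exists>c0. v s x0 c0 \<noteq> 0"
    proof (rule ccontr)
      assume a: "\<not> ?thesis"
      have "(\<Sum>i\<in>insert s S. (if i = s then 1 else 0) * v i x0 c) = 0" for c
        using a by (intro sum.neutral) auto
      from insert.prems(2)[OF this] show False by auto
    qed
    then obtain c0 where c0: "v s x0 c0 \<noteq> 0" ..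
    define w where "w = (\<lambda>i x c. v s x c0 * v i x c - v i x c0 * v s x c)"
    have w_PP: "(\<lambda>x. w i x c) \<in> PP" if "i \<in> S" for i c
      unfolding w_def using insert.prems(1) that by (intro PP_diff PP_mult) auto
    have w_ind: "\<forall>i\<in>S. \<alpha> i = 0" if z: "\<And>c. (\<Sum>i\<in>S. \<alpha> i * w i x0 c) = 0" for \<alpha>
    proof -
      define \<beta> where "\<beta> = (\<lambda>i. if i = s then - (\<Sum>i\<in>S. \<alpha> i * v i x0 c0) else \<alpha> i * v s x0 c0)"
      have \<beta>S: "(\<Sum>i\<in>S. \<beta> i * v i x0 c) = (\<Sum>i\<in>S. \<alpha> i * v s x0 c0 * v i x0 c)" for c
        using insert.hyps(2) unfolding \<beta>_def by (intro sum.cong) auto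
      have "(\<Sum>i\<in>insert s S. \<beta> i * v i x0 c) = 0" for c
      proof -
        have "(\<Sum>i\<in>insert s S. \<beta> i * v i x0 c) = \<beta> s * v s x0 c + (\<Sum>i\<in>S. \<alpha> i * v s x0 c0 * v i x0 c)"
          using insert.hyps \<beta>S by simp
        also have "\<beta> s * v s x0 c = - (\<Sum>i\<in>S. \<alpha> i * v i x0 c0 * v s x0 c)"
          unfolding \<beta>_def by (simp add: sum_distrib_right)
        also have "- (\<Sum>i\<in>S. \<alpha> i * v i x0 c0 * v s x0 c) + (\<Sum>i\<in>S. \<alpha> i * v s x0 c0 * v i x0 c)
            = (\<Sum>i\<in>S. \<alpha> i * w i x0 c)"
          unfolding w_def by (simp add: sum_subtractf algebra_simps)
        finally show ?thesis using z by simp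
      qed
      from insert.prems(2)[OF this] have b0: "\<beta> i = 0" if "i \<in> S" for i using that by blast
      show ?thesis
      proof
        fix i assume i: "i \<in> S"
        then have "i \<noteq> s" using insert.hyps(2) by blast
        then have "\<alpha> i * v s x0 c0 = 0" using b0[OF i] unfolding \<beta>_def by simp
        then show "\<alpha> i = 0" using c0 by simp
      qed
    qed
    have "\<exists>p\<in>PP. p x0 \<noteq> 0 \<and> (\<forall>x \<alpha>. p x \<noteq> 0 \<longrightarrow> (\<forall>c. (\<Sum>i\<in>S. \<alpha> i * w i x c) = 0) \<longrightarrow> (\<forall>i\<in>S. \<alpha> i = 0))"
    proof (rule insert.IH)
      show "(\<lambda>x. w i x c) \<in> PP" if "i \<in> S" for i c using that by (rule w_PP)
      show "\<forall>i\<in>S. \<alpha> i = 0" if "\<And>c. (\<Sum>i\<in>S. \<alpha> i * w i x0 c) = 0" for \<alpha>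
        using that by (rule w_ind)
    qed
    then obtain p where p: "p \<in> PP" "p x0 \<noteq> 0"
      "\<forall>x \<alpha>. p x \<noteq> 0 \<longrightarrow> (\<forall>c. (\<Sum>i\<in>S. \<alpha> i * w i x c) = 0) \<longrightarrow> (\<forall>i\<in>S. \<alpha> i = 0)" by (elim bexE conjE)
    show ?case
    proof (intro bexI conjI allI impI)
      show "(\<lambda>x. p x * v s x c0) \<in> PP" using p(1) insert.prems(1)[of s c0] by (intro PP_mult) auto
      show "p x0 * v s x0 c0 \<noteq> 0" using p(2) c0 by simp
      fix x \<alpha> assume nz: "p x * v s x c0 \<noteq> 0" and z: "\<forall>c. (\<Sum>i\<in>insert s S. \<alpha> i * v i x c) = 0"
      have z': "(\<Sum>i\<in>S. \<alpha> i * v i x c) = - (\<alpha> s * v s x c)" for c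
        using z insert.hyps by (simp add: eq_neg_iff_add_eq_0 add.commute)
      have "(\<Sum>i\<in>S. \<alpha> i * w i x c) = 0" for c
      proof -
        have "(\<Sum>i\<in>S. \<alpha> i * w i x c)
          = v s x c0 * (\<Sum>i\<in>S. \<alpha> i * v i x c) - v s x c * (\<Sum>i\<in>S. \<alpha> i * v i x c0)"
          unfolding w_def by (simp add: sum_subtractf sum_distrib_left algebra_simps)
        then show ?thesis unfolding z' by (simp add: algebra_simps)
      qed
      then have S0: "\<forall>i\<in>S. \<alpha> i = 0" using p(3)[rule_format, of x \<alpha>] nz by simp
      then have "\<alpha> s * v s x c0 = 0" using z'[of c0] by simp
      then show "\<forall>i\<in>insert s S. \<alpha> i = 0" using S0 nz by simp
    qed
  qed
  then obtain p where "p \<in> PP" "p x0 \<noteq> 0"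
    "\<forall>x \<alpha>. p x \<noteq> 0 \<longrightarrow> (\<forall>c. (\<Sum>i\<in>S. \<alpha> i * v i x c) = 0) \<longrightarrow> (\<forall>i\<in>S. \<alpha> i = 0)" by (elim bexE conjE)
  then show ?thesis by (rule that)
qed

definition regular :: "('x \<Rightarrow> 'k poly poly) \<Rightarrow> bool" where
  "regular v \<longleftrightarrow> (\<forall>i j. (\<lambda>x. coeff (coeff (v x) i) j) \<in> PP)"

lemma regular_const: "regular (\<lambda>_. F)"
  unfolding regular_def by (simp add: PP_const)

lemma regular_add: "regular v \<Longrightarrow> regular w \<Longrightarrow> regular (\<lambda>x. v x + w x)"
  unfolding regular_def by (simp add: PP_add)

lemma regular_diff: "regular v \<Longrightarrow> regular w \<Longrightarrow> regular (\<lambda>x. v x - w x)"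
  unfolding regular_def by (simp add: PP_diff)

lemma regular_mult: "regular v \<Longrightarrow> regular w \<Longrightarrow> regular (\<lambda>x. v x * w x)"
  unfolding regular_def coeff2_mult by (intro allI PP_sum PP_mult) blast+

lemma regular_power: "regular v \<Longrightarrow> regular (\<lambda>x. v x ^ n)"
  by (induction n) (simp_all add: regular_const regular_mult)

lemma regular_sum: "(\<And>i. i \<in> A \<Longrightarrow> regular (v i)) \<Longrightarrow> regular (\<lambda>x. \<Sum>i\<in>A. v i x)"
  by (induction A rule: infinite_finite_induct) (simp_all add: regular_const regular_add)

text \<open>Lower semicontinuity of dimension in the form in which it is applied: a basis is moved
  along the parameter, stays independent where p does not vanish, and bounds from below the
  dimension of any space that contains it there.\<close>

lemma regular_independence_open:
  assumes B: "finite B" "VR.independent B"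
    and v: "\<And>b. b \<in> B \<Longrightarrow> regular (v b)" "\<And>b. b \<in> B \<Longrightarrow> v b x0 = b"
  obtains p where "p \<in> PP" "p x0 \<noteq> 0"
    "\<forall>x T. p x \<noteq> 0 \<longrightarrow> fin_dim scaleP T \<longrightarrow> (\<forall>b\<in>B. v b x \<in> T) \<longrightarrow> card B \<le> VR.dim T"
proof -
  have coord: "(\<Sum>b\<in>B. scaleP (\<alpha> b) (v b x)) = 0 \<longleftrightarrow> (\<forall>c. (\<Sum>b\<in>B. \<alpha> b * coeff (coeff (v b x) (fst c)) (snd c)) = 0)"
    for \<alpha> x
    by (simp add: poly_eq_iff coeff_sum coeff_scaleP)
  have ind: "\<forall>b\<in>B. \<alpha> b = 0" if "\<And>c. (\<Sum>b\<in>B. \<alpha> b * coeff (coeff (v b x0) (fst c)) (snd c)) = 0" for \<alpha>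
  proof -
    have "(\<Sum>b\<in>B. scaleP (\<alpha> b) b) = (\<Sum>b\<in>B. scaleP (\<alpha> b) (v b x0))"
      using v(2) by (intro sum.cong) auto
    also have "\<dots> = 0" using that coord by blast
    finally show ?thesis using VR.independentD[OF B(2,1) subset_refl, of \<alpha>] by blast
  qed
  have reg: "(\<lambda>x. coeff (coeff (v b x) (fst c)) (snd c)) \<in> PP" if "b \<in> B" for b c
    using v(1)[OF that] unfolding regular_def by blast
  obtain p where p: "p \<in> PP" "p x0 \<noteq> 0"
    "\<forall>x \<alpha>. p x \<noteq> 0 \<longrightarrow> (\<forall>c. (\<Sum>b\<in>B. \<alpha> b * coeff (coeff (v b x) (fst c)) (snd c)) = 0) \<longrightarrow> (\<forall>b\<in>B. \<alpha> b = 0)"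
  proof (rule independence_open[of B "\<lambda>b x c. coeff (coeff (v b x) (fst c)) (snd c)" x0, OF B(1)])
    show "(\<lambda>x. coeff (coeff (v b x) (fst c)) (snd c)) \<in> PP" if "b \<in> B" for b and c :: "nat \<times> nat"
      using that by (rule reg)
    show "\<forall>b\<in>B. \<alpha> b = 0" if "\<And>c. (\<Sum>b\<in>B. \<alpha> b * coeff (coeff (v b x0) (fst c)) (snd c)) = 0" for \<alpha>
      using that by (rule ind)
  qed
  show ?thesis
  proof (rule that[OF p(1,2)], intro allI impI)
    fix x T assume nz: "p x \<noteq> 0" and T: "fin_dim scaleP T" and vT: "\<forall>b\<in>B. v b x \<in> T"
    have indx: "\<forall>b\<in>B. \<alpha> b = 0" if "(\<Sum>b\<in>B. scaleP (\<alpha> b) (v b x)) = 0" for \<alpha>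
      using p(3) nz that unfolding coord by blast
    \<comment> \<open>\<open>independent\<close> speaks of a set, so two indices must not give the
      same vector. Such a coincidence would be the relation with coefficients 1 and -1.\<close>
    have inj: "inj_on (\<lambda>b. v b x) B"
    proof (rule inj_onI, rule ccontr)
      fix b b' assume b: "b \<in> B" "b' \<in> B" "v b x = v b' x" "b \<noteq> b'"
      define \<alpha> where "\<alpha> = (\<lambda>u. (if u = b then 1 else 0) - (if u = b' then 1 else (0::'k)))"
      have "scaleP (\<alpha> u) (v u x) = (if u = b then v b x else 0) - (if u = b' then v b' x else 0)" for u
        unfolding \<alpha>_def by (simp add: VR.scale_left_diff_distrib scaleP_minus1)
      then have "(\<Sum>u\<in>B. scaleP (\<alpha> u) (v u x)) = v b x - v b' x"
        using b B(1) by (simp add: sum_subtractf sum.delta)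
      then have "\<alpha> b = 0" using indx[of \<alpha>] b by simp
      then show False unfolding \<alpha>_def using b(4) by simp
    qed
    have "VR.independent ((\<lambda>b. v b x) ` B)"
    proof (rule VR.independent_if_scalars_zero)
      show "finite ((\<lambda>b. v b x) ` B)" using B(1) by simp
      fix f u assume s: "(\<Sum>u\<in>(\<lambda>b. v b x) ` B. scaleP (f u) u) = 0" and u: "u \<in> (\<lambda>b. v b x) ` B"
      have "(\<Sum>b\<in>B. scaleP (f (v b x)) (v b x)) = 0" using s by (simp add: sum.reindex[OF inj])
      then have "\<forall>b\<in>B. f (v b x) = 0" by (rule indx)
      then show "f u = 0" using u by blast
    qed
    moreover have "(\<lambda>b. v b x) ` B \<subseteq> T" using vT by blast
    ultimately have "card ((\<lambda>b. v b x) ` B) \<le> VR.dim T" using VR.fdim_independent(2)[OF T] by blast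
    then show "card B \<le> VR.dim T" by (simp add: card_image[OF inj])
  qed
qed

end

section \<open>Polynomial conditions on the coefficients of a line\<close>

interpretation P1: fun_algebra "range (poly :: 'k::field poly \<Rightarrow> _)"
proof
  fix c :: 'k
  show "(\<lambda>_. c) \<in> range poly" by (rule range_eqI[of _ _ "[:c:]"]) (rule ext, simp)
next
  fix f g :: "'k \<Rightarrow> 'k" assume "f \<in> range poly" "g \<in> range poly"
  then obtain p q where pq: "f = poly p" "g = poly q" by blast
  show "(\<lambda>x. f x + g x) \<in> range poly" by (rule range_eqI[of _ _ "p + q"]) (rule ext, simp add: pq)
  show "(\<lambda>x. f x * g x) \<in> range poly" by (rule range_eqI[of _ _ "p * q"]) (rule ext, simp add: pq)
qed

definition poly2 :: "'k::field poly poly \<Rightarrow> 'k \<times> 'k \<Rightarrow> 'k" where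
  "poly2 p x = poly (poly p [:snd x:]) (fst x)"

interpretation P2: fun_algebra "range (poly2 :: 'k::field poly poly \<Rightarrow> _)"
proof
  fix c :: 'k
  show "(\<lambda>_. c) \<in> range poly2" by (rule range_eqI[of _ _ "[:[:c:]:]"]) (rule ext, simp add: poly2_def)
next
  fix f g :: "'k \<times> 'k \<Rightarrow> 'k" assume "f \<in> range poly2" "g \<in> range poly2"
  then obtain p q where pq: "f = poly2 p" "g = poly2 q" by blast
  show "(\<lambda>x. f x + g x) \<in> range poly2"
    by (rule range_eqI[of _ _ "p + q"]) (rule ext, simp add: pq poly2_def)
  show "(\<lambda>x. f x * g x) \<in> range poly2"
    by (rule range_eqI[of _ _ "p * q"]) (rule ext, simp add: pq poly2_def)
qed

lemma poly2_nonzero: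
  fixes p :: "'k::field_char_0 poly poly"
  assumes "p \<noteq> 0" obtains a b where "poly2 p (a, b) \<noteq> 0"
proof -
  have "finite {q. poly p q = 0}" using poly_roots_finite[OF assms] .
  moreover have "infinite (range (\<lambda>b::'k. [:b:]))"
    by (simp add: finite_image_iff inj_on_def infinite_UNIV_char_0)
  ultimately have "\<not> range (\<lambda>b::'k. [:b:]) \<subseteq> {q. poly p q = 0}" using finite_subset by blast
  then obtain b where b: "poly p [:b:] \<noteq> 0" by blast
  have "finite {a. poly (poly p [:b:]) a = 0}" using poly_roots_finite[OF b] .
  then have "{a. poly (poly p [:b:]) a = 0} \<noteq> UNIV" using infinite_UNIV_char_0 by metis
  then obtain a where "poly (poly p [:b:]) a \<noteq> 0" by blast
  then show ?thesis by (intro that[of a b]) (simp add: poly2_def)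
qed

text \<open>A property that holds on a nonempty principal open subset of the (a, b)-plane. A single
  polynomial suffices, since finite intersections correspond to products.\<close>

definition generic :: "('k::field \<Rightarrow> 'k \<Rightarrow> bool) \<Rightarrow> bool" where
  "generic P \<longleftrightarrow> (\<exists>p. p \<noteq> 0 \<and> (\<forall>a b. poly2 p (a, b) \<noteq> 0 \<longrightarrow> P a b))"

lemma generic_mono:
  assumes "generic P" "\<And>a b. P a b \<Longrightarrow> Q a b" shows "generic Q"
proof -
  obtain p where "p \<noteq> 0" "\<forall>a b. poly2 p (a, b) \<noteq> 0 \<longrightarrow> P a b"
    using assms(1) unfolding generic_def by (elim exE conjE)
  then show ?thesis unfolding generic_def using assms(2) by (intro exI[of _ p]) simp
qed

lemma generic_always: "(\<And>a b. P a b) \<Longrightarrow> generic P"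
  unfolding generic_def by (intro exI[of _ 1]) simp

lemma generic_conj:
  fixes P Q :: "'k::field \<Rightarrow> 'k \<Rightarrow> bool"
  assumes "generic P" "generic Q" shows "generic (\<lambda>a b. P a b \<and> Q a b)"
proof -
  obtain p where p: "p \<noteq> 0" "\<forall>a b. poly2 p (a, b) \<noteq> 0 \<longrightarrow> P a b"
    using assms(1) unfolding generic_def by (elim exE conjE)
  obtain q where q: "q \<noteq> 0" "\<forall>a b. poly2 q (a, b) \<noteq> 0 \<longrightarrow> Q a b"
    using assms(2) unfolding generic_def by (elim exE conjE)
  have m: "poly2 (p * q) x = poly2 p x * poly2 q x" for x by (simp add: poly2_def)
  show ?thesis unfolding generic_def
  proof (intro exI[of _ "p * q"] conjI allI impI)
    show "p * q \<noteq> 0" using p q by simp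
    fix a b assume "poly2 (p * q) (a, b) \<noteq> 0"
    then have "poly2 p (a, b) \<noteq> 0" "poly2 q (a, b) \<noteq> 0" unfolding m by auto
    then show "P a b" "Q a b" using p(2) q(2) by simp_all
  qed
qed

lemma generic_ball:
  assumes "finite A" "\<And>i. i \<in> A \<Longrightarrow> generic (P i)" shows "generic (\<lambda>a b. \<forall>i\<in>A. P i a b)"
  using assms
proof (induction A)
  case empty show ?case by (rule generic_always) simp
next
  case (insert i A)
  then have "generic (\<lambda>a b. P i a b \<and> (\<forall>i\<in>A. P i a b))" by (intro generic_conj) auto
  then show ?case by (rule generic_mono) auto
qed

lemma generic_ex:
  fixes P :: "'k::field_char_0 \<Rightarrow> 'k \<Rightarrow> bool"
  assumes "generic P" obtains a b where "P a b"
proof -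
  obtain p where p: "p \<noteq> 0" "\<forall>a b. poly2 p (a, b) \<noteq> 0 \<longrightarrow> P a b"
    using assms unfolding generic_def by (elim exE conjE)
  obtain a b where "poly2 p (a, b) \<noteq> 0" using poly2_nonzero[OF p(1)] .
  then have "P a b" using p(2) by simp
  then show ?thesis by (rule that)
qed

lemma P2_regular_line: "P2.regular (\<lambda>x. line (fst x :: 'k::field) (snd x))"
proof -
  have fst: "(\<lambda>x. fst x :: 'k) \<in> range poly2"
    by (rule range_eqI[of _ _ "[:[:0, 1:]:]"]) (rule ext, simp add: poly2_def)
  have snd: "(\<lambda>x. snd x :: 'k) \<in> range poly2"
    by (rule range_eqI[of _ _ "[:0, 1:]"]) (rule ext, simp add: poly2_def)
  have lin: "P2.regular (\<lambda>x. [:[:snd x, fst x :: 'k:]:])"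
  proof -
    have c: "coeff (coeff [:[:snd x, fst x :: 'k:]:] i) j
      = (if i = 0 then if j = 0 then snd x else if j = 1 then fst x else 0 else 0)" for x i j
      by (simp add: coeff_pCons split: nat.split)
    show ?thesis unfolding P2.regular_def c
    proof (intro allI)
      fix i j :: nat
      show "(\<lambda>x. if i = 0 then if j = 0 then snd x else if j = 1 then fst x else 0 else (0::'k)) \<in> range poly2"
        using fst snd P2.PP_const[of 0] by (cases "i = 0"; cases "j = 0"; cases "j = 1") simp_all
    qed
  qed
  show ?thesis unfolding line_eq by (rule P2.regular_diff[OF P2.regular_const lin])
qed

text \<open>For n = 1 its dimension measures the rank of restriction of U to the line l. Higher
  powers serve the iterated deformation of l in the exceptional case.\<close>

definition colsum :: "'k::field poly poly set \<Rightarrow> nat \<Rightarrow> 'k poly poly \<Rightarrow> int \<Rightarrow> 'k poly poly set" where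
  "colsum U n l d = sumset U ((*) (l ^ n) ` tpolys d)"

lemma subspace_colsum: "VR.subspace U \<Longrightarrow> VR.subspace (colsum U n l d)"
  unfolding colsum_def by (intro VR.subspace_sumset subspace_mult subspace_tpolys)

lemma fin_dim_colsum: "fin_dim scaleP U \<Longrightarrow> fin_dim scaleP (colsum U n l d)"
  unfolding colsum_def by (intro VR.fdim_sumset fin_dim_mult fin_dim_tpolys)

lemma colsum_I1: "F \<in> U \<Longrightarrow> F \<in> colsum U n l d"
  unfolding colsum_def using VR.sumset_upper1[OF subspace_mult[OF subspace_tpolys]] by blast

lemma colsum_I2: "VR.subspace U \<Longrightarrow> G \<in> tpolys d \<Longrightarrow> l ^ n * G \<in> colsum U n l d"
  unfolding colsum_def using VR.sumset_upper2[of U] by blast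

text \<open>The basis is taken from the generators and not merely from the sum: when l moves, each
  basis vector either stays fixed in U or moves as a product with the n-th power of the
  line.\<close>

lemma colsum_basis:
  assumes U: "VR.subspace U" "fin_dim scaleP U"
  obtains B where "B \<subseteq> U \<union> (*) (l ^ n) ` tpolys d" "VR.independent B" "finite B"
    "card B = VR.dim (colsum U n l d)" "colsum U n l d \<subseteq> VR.span B"
proof -
  let ?T = "colsum U n l d" and ?G = "U \<union> (*) (l ^ n) ` tpolys d"
  obtain B where B: "B \<subseteq> ?G" "VR.independent B" "?G \<subseteq> VR.span B"
    using VR.maximal_independent_subset[of ?G] by blast
  have GT: "?G \<subseteq> ?T" using colsum_I1 colsum_I2[OF U(1)] by blast
  have "?T \<subseteq> VR.span B"
    unfolding colsum_def using B(3) by (intro VR.sumset_least VR.subspace_span) auto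
  moreover have "B \<subseteq> ?T" using B GT by blast
  ultimately show ?thesis
    using that[OF B(1,2)] VR.fdim_independent(1)[OF fin_dim_colsum[OF U(2)] _ B(2)] VR.basis_card_eq_dim[OF _ _ B(2)]
    by blast
qed

lemma colsum_dim_semicontinuous:
  fixes U :: "'k::field poly poly set"
  assumes U: "VR.subspace U" "fin_dim scaleP U" and r: "r \<le> VR.dim (colsum U n (line a0 b0) d)"
  shows "generic (\<lambda>a b. r \<le> VR.dim (colsum U n (line a b) d))"
proof -
  obtain B where B: "B \<subseteq> U \<union> (*) (line a0 b0 ^ n) ` tpolys d" "VR.independent B" "finite B"
    "card B = VR.dim (colsum U n (line a0 b0) d)"
    using colsum_basis[OF U, of "line a0 b0" n d] .
  have "\<exists>w. P2.regular w \<and> w (a0, b0) = F \<and> (\<forall>a b. w (a, b) \<in> colsum U n (line a b) d)" if F: "F \<in> B" for F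
  proof (cases "F \<in> U")
    case True
    then show ?thesis by (intro exI[of _ "\<lambda>_. F"]) (simp add: P2.regular_const colsum_I1)
  next
    case False
    then obtain G where G: "G \<in> tpolys d" "F = line a0 b0 ^ n * G" using F B(1) by blast
    show ?thesis
    proof (intro exI[of _ "\<lambda>x. line (fst x) (snd x) ^ n * G"] conjI allI)
      show "P2.regular (\<lambda>x. line (fst x) (snd x) ^ n * G)"
        by (intro P2.regular_mult P2.regular_power P2.regular_const P2_regular_line)
    qed (use G colsum_I2[OF U(1)] in simp_all)
  qed
  then obtain v where v: "\<And>F. F \<in> B \<Longrightarrow> P2.regular (v F)" "\<And>F. F \<in> B \<Longrightarrow> v F (a0, b0) = F"
    "\<And>F a b. F \<in> B \<Longrightarrow> v F (a, b) \<in> colsum U n (line a b) d" by metis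
  obtain p where p: "p \<in> range poly2" "p (a0, b0) \<noteq> 0"
    "\<forall>x T. p x \<noteq> 0 \<longrightarrow> fin_dim scaleP T \<longrightarrow> (\<forall>b\<in>B. v b x \<in> T) \<longrightarrow> card B \<le> VR.dim T"
    by (rule P2.regular_independence_open[OF B(3,2) v(1,2)])
  obtain q where q: "p = poly2 q" using p(1) by blast
  have "q \<noteq> 0" using p(2) unfolding q by (auto simp: poly2_def)
  moreover have "r \<le> VR.dim (colsum U n (line a b) d)" if "poly2 q (a, b) \<noteq> 0" for a b
  proof -
    have "card B \<le> VR.dim (colsum U n (line a b) d)"
      using p(3)[rule_format, of "(a, b)" "colsum U n (line a b) d", OF _ fin_dim_colsum[OF U(2)]] that v(3)
      unfolding q by blast
    then show ?thesis using r B(4) by simp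
  qed
  ultimately show ?thesis unfolding generic_def by blast
qed

lemma scaleP_of_nat: "scaleP (of_nat n) H = of_nat n * H"
  by (induction n) (simp_all add: VR.scale_left_distrib distrib_right)

text \<open>If \<open>l\<^sup>n g\<close> lies in \<open>U\<close> then the first-order variation of \<open>l\<^sup>n g\<close> in the direction \<open>m\<close> must
  lie in \<open>U + l\<^sup>n tpolys d\<close>, for otherwise a nearby line would span a larger space.\<close>

lemma colsum_dim_jump:
  fixes U :: "'k::field_char_0 poly poly set"
  assumes U: "VR.subspace U" "fin_dim scaleP U"
    and g: "g \<in> tpolys d" "l ^ n * g \<in> U" and n: "0 < n"
    and out: "l ^ (n - 1) * m * g \<notin> colsum U n l d"
  obtains \<epsilon> where "VR.dim (colsum U n l d) < VR.dim (colsum U n (l - [:[:\<epsilon>:]:] * m) d)"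
proof -
  obtain B where B: "B \<subseteq> U \<union> (*) (l ^ n) ` tpolys d" "VR.independent B" "finite B"
    "card B = VR.dim (colsum U n l d)" "colsum U n l d \<subseteq> VR.span B"
    using colsum_basis[OF U, of l n d] .
  define L where "L = (\<lambda>\<epsilon>. l - [:[:\<epsilon>:]:] * m)"
  \<comment> \<open>This is the difference quotient of \<open>L \<epsilon> ^ n * g\<close> at 0,
    written without division so that it is regular there. Its value at 0 is - n times the vector in
    \<open>out\<close>, and n is invertible in characteristic zero.\<close>
  define w where "w = (\<lambda>\<epsilon>. - m * (\<Sum>i<n. l ^ (n - Suc i) * L \<epsilon> ^ i) * g)"
  have Lreg: "P1.regular L" unfolding L_def
  proof (intro P1.regular_diff P1.regular_const P1.regular_mult)
    have c: "coeff (coeff [:[:x:]:] i) j = (if i = 0 \<and> j = 0 then x else 0)" for x :: 'k and i j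
      by (cases i; cases j) simp_all
    have id: "(\<lambda>x::'k. x) \<in> range poly" by (rule range_eqI[of _ _ "[:0, 1:]"]) (rule ext, simp)
    have zero: "(\<lambda>x::'k. 0) \<in> range poly" by (rule P1.PP_const)
    show "P1.regular (\<lambda>x::'k. [:[:x:]:])" unfolding P1.regular_def
    proof (intro allI)
      fix i j :: nat
      show "(\<lambda>x::'k. coeff (coeff [:[:x:]:] i) j) \<in> range poly"
        unfolding c using id zero by (cases "i = 0"; cases "j = 0") simp_all
    qed
  qed
  have L0: "L 0 = l" unfolding L_def by simp
  have wreg: "P1.regular w" unfolding w_def
    by (intro P1.regular_mult P1.regular_const P1.regular_sum P1.regular_power Lreg)
  have w0: "w 0 = scaleP (- of_nat n) (l ^ (n - 1) * m * g)"
  proof -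
    have "(\<Sum>i<n. l ^ (n - Suc i) * l ^ i) = (\<Sum>i<n. l ^ (n - 1))"
      by (intro sum.cong refl) (simp flip: power_add)
    then have "w 0 = - m * (of_nat n * l ^ (n - 1)) * g" unfolding w_def L0 by simp
    moreover have "scaleP (- of_nat n) H = - (of_nat n * H)" for H :: "'k poly poly"
      using scaleP_of_nat[of n H] by simp
    moreover have "- m * (of_nat n * l ^ (n - 1)) * g = - (of_nat n * (l ^ (n - 1) * m * g))"
      by (simp add: mult_ac)
    ultimately show ?thesis by (simp only:)
  qed
  have w0out: "w 0 \<notin> colsum U n l d"
  proof
    assume "w 0 \<in> colsum U n l d"
    then have "scaleP (inverse (- of_nat n)) (w 0) \<in> colsum U n l d"
      by (rule VR.subspace_scale[OF subspace_colsum[OF U(1)]])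
    then show False using out n unfolding w0 by simp
  qed
  have "VR.span B \<subseteq> colsum U n l d"
    using B(1) colsum_I1 colsum_I2[OF U(1)] by (intro VR.span_minimal subspace_colsum[OF U(1)]) blast
  then have ind: "VR.independent (insert (w 0) B)" and wB: "w 0 \<notin> B"
    using w0out B(2) VR.independent_insertI VR.span_base by blast+
  have "\<exists>u. P1.regular u \<and> u 0 = F \<and> (\<forall>\<epsilon>. \<epsilon> \<noteq> 0 \<longrightarrow> u \<epsilon> \<in> colsum U n (L \<epsilon>) d)" if F: "F \<in> insert (w 0) B" for F
  proof (cases "F = w 0")
    case True
    have "w \<epsilon> \<in> colsum U n (L \<epsilon>) d" if "\<epsilon> \<noteq> 0" for \<epsilon>
    proof -
      have "L \<epsilon> ^ n - l ^ n = (L \<epsilon> - l) * (\<Sum>i<n. l ^ (n - Suc i) * L \<epsilon> ^ i)"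
        by (rule power_diff_sumr2)
      also have "L \<epsilon> - l = - ([:[:\<epsilon>:]:] * m)" unfolding L_def by simp
      finally have eq: "L \<epsilon> ^ n - l ^ n = - ([:[:\<epsilon>:]:] * m) * (\<Sum>i<n. l ^ (n - Suc i) * L \<epsilon> ^ i)" .
      have "L \<epsilon> ^ n * g - l ^ n * g = (L \<epsilon> ^ n - l ^ n) * g" by (simp only: left_diff_distrib)
      also have "\<dots> = [:[:\<epsilon>:]:] * w \<epsilon>"
        unfolding eq w_def by (simp only: mult_minus_left mult_minus_right mult.assoc)
      finally have "L \<epsilon> ^ n * g - l ^ n * g = [:[:\<epsilon>:]:] * w \<epsilon>" .
      then have "scaleP \<epsilon> (w \<epsilon>) = L \<epsilon> ^ n * g - l ^ n * g" by (simp add: scaleP_def)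
      moreover have "L \<epsilon> ^ n * g - l ^ n * g \<in> colsum U n (L \<epsilon>) d"
        by (intro VR.subspace_diff[OF subspace_colsum[OF U(1)]] colsum_I1 g colsum_I2[OF U(1)])
      ultimately have "scaleP (inverse \<epsilon>) (scaleP \<epsilon> (w \<epsilon>)) \<in> colsum U n (L \<epsilon>) d"
        using VR.subspace_scale[OF subspace_colsum[OF U(1)]] by simp
      then show ?thesis using that by simp
    qed
    then show ?thesis using wreg True by blast
  next
    case False
    then have F: "F \<in> B" using F by blast
    show ?thesis
    proof (cases "F \<in> U")
      case True
      then show ?thesis by (intro exI[of _ "\<lambda>_. F"]) (simp add: P1.regular_const colsum_I1)
    next
      case False
      then obtain G where G: "G \<in> tpolys d" "F = l ^ n * G" using F B(1) by blast
      show ?thesis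
      proof (intro exI[of _ "\<lambda>x. L x ^ n * G"] conjI allI impI)
        show "P1.regular (\<lambda>x. L x ^ n * G)"
          by (intro P1.regular_mult P1.regular_power P1.regular_const Lreg)
      qed (use G colsum_I2[OF U(1)] L0 in simp_all)
    qed
  qed
  then obtain v where v: "\<And>F. F \<in> insert (w 0) B \<Longrightarrow> P1.regular (v F)" "\<And>F. F \<in> insert (w 0) B \<Longrightarrow> v F 0 = F"
    "\<And>F \<epsilon>. F \<in> insert (w 0) B \<Longrightarrow> \<epsilon> \<noteq> 0 \<Longrightarrow> v F \<epsilon> \<in> colsum U n (L \<epsilon>) d" by metis
  have fin: "finite (insert (w 0) B)" using B(3) by simp
  obtain p where p: "p \<in> range poly" "p 0 \<noteq> 0"
    "\<forall>x T. p x \<noteq> 0 \<longrightarrow> fin_dim scaleP T \<longrightarrow> (\<forall>b\<in>insert (w 0) B. v b x \<in> T) \<longrightarrow> card (insert (w 0) B) \<le> VR.dim T"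
    by (rule P1.regular_independence_open[OF fin ind v(1,2)])
  obtain q where q: "p = poly q" using p(1) by blast
  have "q \<noteq> 0" using p(2) q by auto
  \<comment> \<open>The parameter 0 has to be avoided together with the roots of q:
    \<open>w \<epsilon>\<close> lies in the sum for the moved line only if \<epsilon> is
    nonzero.\<close>
  then have "finite {x. poly (q * [:0, 1:]) x = 0}" by (intro poly_roots_finite) simp
  then have "{x. poly (q * [:0, 1:]) x = 0} \<noteq> UNIV" using infinite_UNIV_char_0 by metis
  then obtain \<epsilon> where e: "p \<epsilon> \<noteq> 0" "\<epsilon> \<noteq> 0" unfolding q by auto
  have "card (insert (w 0) B) \<le> VR.dim (colsum U n (L \<epsilon>) d)"
    using p(3)[rule_format, OF e(1) fin_dim_colsum[OF U(2)]] v(3)[OF _ e(2)] by blast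
  then show ?thesis using that[of \<epsilon>] wB B(3,4) unfolding L_def by simp
qed

section \<open>Restriction of linear systems to general lines\<close>

abbreviation pdim :: "'k::field poly poly set \<Rightarrow> int" where
  "pdim S \<equiv> int (VR.dim S)"

abbreviation rdim :: "'k::field \<Rightarrow> 'k \<Rightarrow> 'k poly poly set \<Rightarrow> int" where
  "rdim a b W \<equiv> int (VX.dim (restr a b ` W))"

lemma VX_dim_zero [simp]: "VX.dim {0 :: 'k::field poly} = 0"
  using VX.dim_span_eq_card_independent[OF VX.independent_empty] by simp

lemma VR_dim_zero [simp]: "VR.dim {0 :: 'k::field poly poly} = 0"
  using VR.dim_span_eq_card_independent[OF VR.independent_empty] by simp

definition colon :: "'k::field poly poly set \<Rightarrow> 'k poly poly \<Rightarrow> int \<Rightarrow> 'k poly poly set" where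
  "colon W l d = {G \<in> tpolys d. l * G \<in> W}"

lemma fin_dim_in_tpolys: "W \<subseteq> tpolys d \<Longrightarrow> fin_dim scaleP W"
  by (rule VR.fdim_subset[OF fin_dim_tpolys])

lemma fin_dim_in_upolys: "V \<subseteq> upolys d \<Longrightarrow> fin_dim smult V"
  by (rule VX.fdim_subset[OF fin_dim_upolys])

lemma pdim_mono: "S \<subseteq> T \<Longrightarrow> T \<subseteq> tpolys d \<Longrightarrow> pdim S \<le> pdim T"
  using VR.dim_mono_fdim[OF fin_dim_in_tpolys[of T d]] by simp

lemma subspace_colon: assumes "VR.subspace W" shows "VR.subspace (colon W l d)"
proof (rule VR.subspaceI)
  show "0 \<in> colon W l d" unfolding colon_def using VR.subspace_0[OF assms] tpolys_0 by simp
next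
  fix x y assume "x \<in> colon W l d" "y \<in> colon W l d"
  then show "x + y \<in> colon W l d" unfolding colon_def
    using VR.subspace_add[OF assms, of "l * x" "l * y"] tpolys_add[of x d y] by (simp add: distrib_left)
next
  fix c x assume "x \<in> colon W l d"
  then show "scaleP c x \<in> colon W l d" unfolding colon_def
    using VR.subspace_scale[OF assms, of "l * x" c] tpolys_scale[of x d c] by (simp add: scaleP_mult)
qed

lemma colon_in_tpolys: "colon W l d \<subseteq> tpolys d"
  unfolding colon_def by blast

lemma subspace_restr: "VR.subspace W \<Longrightarrow> VX.subspace (restr a b ` W)"
  by (rule VRX.linear_subspace_image[OF restr_linear])

lemma restr_in_upolys: "W \<subseteq> tpolys d \<Longrightarrow> restr a b ` W \<subseteq> upolys d"
  using restr_tpolys by blast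

lemma rdim_le: assumes "W \<subseteq> tpolys d" "- 1 \<le> d" shows "rdim a b W \<le> d + 1"
  using VX.dim_mono_fdim[OF fin_dim_upolys restr_in_upolys[OF assms(1)], of a b] dim_upolys[OF assms(2), where 'k='a]
  by linarith

text \<open>Rank and nullity: the kernel of restriction on W is the line times the residual
  system.\<close>

lemma colon_rank:
  assumes "VR.subspace W" "W \<subseteq> tpolys (d + 1)"
  shows "pdim (colon W (line a b) d) + rdim a b W = pdim W"
proof -
  have "{F \<in> W. restr a b F = 0} = (*) (line a b) ` colon W (line a b) d"
  proof (intro subset_antisym subsetI)
    fix F assume F: "F \<in> {F \<in> W. restr a b F = 0}"
    then have "F \<in> tpolys (d + 1)" "restr a b F = 0" using assms(2) by auto
    then obtain G where "G \<in> tpolys (d + 1 - 1)" "F = line a b * G" by (rule restr_eq_0_tpolys)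
    then show "F \<in> (*) (line a b) ` colon W (line a b) d" using F unfolding colon_def by auto
  next
    fix F assume "F \<in> (*) (line a b) ` colon W (line a b) d"
    then show "F \<in> {F \<in> W. restr a b F = 0}" unfolding colon_def by (auto simp: restr_mult)
  qed
  then have "VR.dim {F \<in> W. restr a b F = 0} = VR.dim (colon W (line a b) d)"
    using dim_mult[OF subspace_colon[OF assms(1)] fin_dim_in_tpolys[OF colon_in_tpolys] line_nonzero] by simp
  then show ?thesis
    using VRX.rank_nullity_fdim[OF restr_linear assms(1) fin_dim_in_tpolys[OF assms(2)], of a b] by linarith
qed

lemma rdim_colsum:
  fixes W :: "'k::field poly poly set"
  assumes "VR.subspace W" "W \<subseteq> tpolys d"
  shows "pdim (colsum W 1 (line a b) (d - 1)) = rdim a b W + pdim (tpolys (d - 1) :: 'k poly poly set)"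
  using dim_restr[OF assms, of a b] unfolding colsum_def by simp

lemma rdim_semicontinuous:
  fixes W :: "'k::field poly poly set"
  assumes "VR.subspace W" "W \<subseteq> tpolys d" "r \<le> rdim a0 b0 W"
  shows "generic (\<lambda>a b. r \<le> rdim a b W)"
proof -
  let ?t = "pdim (tpolys (d - 1) :: 'k poly poly set)"
  have "nat (r + ?t) \<le> VR.dim (colsum W 1 (line a0 b0) (d - 1))"
    using rdim_colsum[OF assms(1,2), of a0 b0] assms(3) by linarith
  then have "generic (\<lambda>a b. nat (r + ?t) \<le> VR.dim (colsum W 1 (line a b) (d - 1)))"
    by (rule colsum_dim_semicontinuous[OF assms(1) fin_dim_in_tpolys[OF assms(2)]])
  then show ?thesis
  proof (rule generic_mono)
    fix a b assume "nat (r + ?t) \<le> VR.dim (colsum W 1 (line a b) (d - 1))"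
    then show "r \<le> rdim a b W" using rdim_colsum[OF assms(1,2), of a b] by linarith
  qed
qed

lemma generic_restr_nonzero:
  fixes F :: "'k::field_char_0 poly poly"
  assumes "F \<noteq> 0" shows "generic (\<lambda>a b. restr a b F \<noteq> 0)"
proof -
  obtain d where d: "F \<in> tpolys d" by (rule tpolys_ex)
  have sub: "VR.subspace (VR.span {F})" by (rule VR.subspace_span)
  have in_d: "VR.span {F} \<subseteq> tpolys d" by (rule VR.span_minimal[OF _ subspace_tpolys]) (use d in simp)
  have eq: "restr a b ` VR.span {F} = {0}" if "restr a b F = 0" for a b
  proof -
    have "restr a b ` VR.span {F} \<subseteq> {0}" unfolding VR.span_singleton by (auto simp: restr_scale that)
    moreover have "restr a b 0 \<in> restr a b ` VR.span {F}" by (rule imageI[OF VR.span_zero])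
    ultimately show ?thesis by auto
  qed
  have "finite {q. poly F q = 0}" using poly_roots_finite[OF assms] .
  moreover have "infinite (range (\<lambda>b::'k. [:b, 0:]))"
    by (simp add: finite_image_iff inj_on_def infinite_UNIV_char_0)
  ultimately have "\<not> range (\<lambda>b::'k. [:b, 0:]) \<subseteq> {q. poly F q = 0}" using finite_subset[of "range (\<lambda>b::'k. [:b, 0:])"] by blast
  then obtain b0 where b0: "restr 0 b0 F \<noteq> 0" unfolding restr_def by blast
  have "VX.independent {restr 0 b0 F}" using b0 VX.dependent_single by blast
  moreover have "{restr 0 b0 F} \<subseteq> restr 0 b0 ` VR.span {F}" using VR.span_base[of F "{F}"] by simp
  ultimately have "card {restr 0 b0 F} \<le> VX.dim (restr 0 b0 ` VR.span {F})"
    by (intro VX.fdim_independent(2)[OF fin_dim_in_upolys[OF restr_in_upolys[OF in_d]]])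
  then have "generic (\<lambda>a b. 1 \<le> rdim a b (VR.span {F}))"
    by (intro rdim_semicontinuous[OF sub in_d]) simp
  then show ?thesis
  proof (rule generic_mono)
    fix a b assume "1 \<le> rdim a b (VR.span {F})"
    then show "restr a b F \<noteq> 0" using eq by auto
  qed
qed

text \<open>A special case of Green's hyperplane restriction theorem.  The inductive step compares two
  general lines \<open>l\<close> and \<open>l'\<close>: the restriction of \<open>W\<close> to \<open>l'\<close> is controlled by that of the residual
  system \<open>W : l\<close>, because \<open>W\<close> does not vanish at the point \<open>l \<inter> l'\<close>.\<close>

lemma generic_restriction:
  fixes W :: "'k::field_char_0 poly poly set"
  assumes "VR.subspace W" "W \<subseteq> tpolys (int n)" "0 \<le> c"
    and "2 * (pdim (tpolys (int n) :: 'k poly poly set) - pdim W) \<le> 2 * (c + 1) * int n - c * (c - 1)"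
  shows "generic (\<lambda>a b. int n + 1 - c \<le> rdim a b W)"
  using assms
proof (induction n arbitrary: W)
  case 0
  have c: "0 \<le> c * (c - 1)"
    using 0(3) by (cases "c = 0") (simp_all add: mult_nonneg_nonneg)
  then have "pdim (tpolys (int 0) :: 'k poly poly set) \<le> pdim W" using 0(4) by simp
  then have "W = tpolys (int 0)"
    by (intro VR.subspace_eq_fdim[OF fin_dim_tpolys 0(1,2)]) simp
  then have "rdim a b W = 1" for a b using dim_upolys[of 0, where 'k='k] by (simp add: restr_image_tpolys)
  then show ?case using 0(3) by (intro generic_always) simp
next
  case (Suc m)
  define t where "t = (\<lambda>d. pdim (tpolys d :: 'k poly poly set))"
  have td: "2 * t d = (d + 1) * (d + 2)" if "- 2 \<le> d" for d unfolding t_def by (rule dim_tpolys[OF that])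
  have n1: "int (Suc m) - 1 = int m" "int (Suc m) = int m + 1" by simp_all
  note W = Suc.prems(1) Suc.prems(2)[unfolded n1(2)]
  \<comment> \<open>By semicontinuity one good line is enough. The contrary assumption bounds the
    rank on all lines at once, in particular on the line L chosen below.\<close>
  have "\<exists>a b. int (Suc m) + 1 - c \<le> rdim a b W"
  proof (rule ccontr)
    assume neg: "\<not> ?thesis"
    have "W \<noteq> {0}"
    proof
      assume "W = {0}"
      then have "pdim W = 0" by simp
      then have "(int m + 2) * (int m + 3) \<le> 2 * (c + 1) * (int m + 1) - c * (c - 1)"
        using Suc.prems(4) td[of "int m + 1"] unfolding t_def by (simp add: algebra_simps)
      then have "(int m + 1 - c) * (int m + 1 - c + 1) + 2 \<le> 0" by (simp add: algebra_simps)
      moreover have "0 \<le> x * (x + 1)" for x :: int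
        by (cases "0 \<le> x") (simp_all add: mult_nonneg_nonneg mult_nonpos_nonpos)
      ultimately show False by (smt (verit))
    qed
    then obtain F where F: "F \<in> W" "F \<noteq> 0" using VR.subspace_0[OF W(1)] by blast
    obtain a b where f0: "restr a b F \<noteq> 0" using generic_ex[OF generic_restr_nonzero[OF F(2)]] .
    define L where "L = line a b"
    define W' where "W' = colon W L (int m)"
    have W': "VR.subspace W'" "W' \<subseteq> tpolys (int m)"
      unfolding W'_def by (rule subspace_colon[OF W(1)], rule colon_in_tpolys)
    have "pdim W' + rdim a b W = pdim W"
      unfolding W'_def L_def by (rule colon_rank[OF W])
    \<comment> \<open>Failure on L lowers the codimension by at least c + 1 on passing to the
      residual system, which is exactly what the numerical bound loses from degree m + 1 to degree
      m.\<close>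
    moreover have "rdim a b W \<le> int m + 1 - c"
    proof -
      have "\<not> int (Suc m) + 1 - c \<le> rdim a b W" using neg by blast
      then show ?thesis by simp
    qed
    moreover have "t (int m + 1) = t (int m) + int m + 2"
      using td[of "int m"] td[of "int m + 1"] by (simp add: algebra_simps)
    moreover have "2 * (t (int m + 1) - pdim W) \<le> 2 * (c + 1) * (int m + 1) - c * (c - 1)"
      using Suc.prems(4) unfolding t_def n1(2) .
    moreover have "2 * (c + 1) * (int m + 1) = 2 * (c + 1) * int m + 2 * c + 2" by (simp add: algebra_simps)
    moreover define P where "P = 2 * (c + 1) * int m"
    moreover define N where "N = c * (c - 1)"
    ultimately have "2 * (t (int m) - pdim W') \<le> P - N" by simp
    then have "2 * (pdim (tpolys (int m) :: 'k poly poly set) - pdim W') \<le> 2 * (c + 1) * int m - c * (c - 1)"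
      unfolding P_def N_def t_def .
    then have G1: "generic (\<lambda>a' b'. int m + 1 - c \<le> rdim a' b' W')"
      by (rule Suc.IH[OF W' Suc.prems(3)])
    define f where "f = restr a b F"
    define U where "U = colsum (VR.span {F}) 1 L (int m)"
    have Fd: "F \<in> tpolys (int m + 1)" using F W by blast
    have sF: "VR.span {F} \<subseteq> tpolys (int m + 1)" by (rule VR.span_minimal[OF _ subspace_tpolys]) (use Fd in simp)
    have Ltp: "l \<in> tpolys 1 \<Longrightarrow> (*) l ` tpolys (int m) \<subseteq> tpolys (int m + 1)" for l :: "'k poly poly"
      by (rule mult_tpolys_subset)
    have U: "VR.subspace U" "U \<subseteq> tpolys (int m + 1)" "fin_dim scaleP U"
    proof -
      show "VR.subspace U" unfolding U_def by (rule subspace_colsum[OF VR.subspace_span])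
      show *: "U \<subseteq> tpolys (int m + 1)" unfolding U_def colsum_def power_one_right
        by (rule VR.sumset_least[OF subspace_tpolys sF]) (use Ltp[OF line_in] in \<open>simp add: L_def\<close>)
      show "fin_dim scaleP U" by (rule fin_dim_in_tpolys[OF *])
    qed
    have "finite {x. poly f x = 0}" using poly_roots_finite f0 unfolding f_def .
    then have "{x. poly f x = 0} \<noteq> UNIV" using infinite_UNIV_char_0 by metis
    then obtain x0 where x0: "poly f x0 \<noteq> 0" by blast
    \<comment> \<open>The line with slope a + 1 and intercept b - x0 meets L at x = x0, where F does
      not vanish. A multiple of F corrects G at this point; what remains vanishes there and is a
      combination of the two lines.\<close>
    have full: "colsum U 1 (line (a + 1) (b - x0)) (int m) = tpolys (int m + 1)"
    proof (intro subset_antisym subsetI)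
      fix G assume "G \<in> colsum U 1 (line (a + 1) (b - x0)) (int m)"
      then show "G \<in> tpolys (int m + 1)" unfolding colsum_def power_one_right
        using VR.sumset_least[OF subspace_tpolys U(2) Ltp[OF line_in]] by blast
    next
      fix G :: "'k poly poly" assume G: "G \<in> tpolys (int m + 1)"
      define h where "h = restr a b G - smult (poly (restr a b G) x0 / poly f x0) f"
      have "poly h x0 = 0" unfolding h_def using x0 by simp
      then have "[:- x0, 1:] dvd h" unfolding poly_eq_0_iff_dvd .
      then obtain u where u: "h = [:- x0, 1:] * u" ..
      have "h \<in> upolys (int m + 1)" unfolding h_def f_def
        by (intro upolys_diff upolys_smult restr_tpolys G Fd)
      have ud: "u \<in> upolys (int m)"
      proof (cases "u = 0")
        case False
        have nz: "[:- x0, 1:] \<noteq> 0" by simp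
        have "degree h = degree [:- x0, 1:] + degree u" unfolding u by (rule degree_mult_eq[OF nz False])
        then have "degree h = Suc (degree u)" by simp
        moreover have "h \<noteq> 0" unfolding u by (rule no_zero_divisors[OF nz False])
        moreover have "h = 0 \<or> int (degree h) \<le> int m + 1"
          using \<open>h \<in> upolys (int m + 1)\<close> unfolding upolys_iff .
        ultimately show ?thesis unfolding upolys_iff by linarith
      next
        case True then show ?thesis using upolys_0[of "int m"] by blast
      qed
      define l2 where "l2 = line (a + 1) (b - x0)"
      define S where "S = scaleP (poly (restr a b G) x0 / poly f x0) F"
      define C where "C = [:- u:]"
      define H where "H = G - S - l2 * C"
      have "restr a b l2 = - [:- x0, 1:]"
      proof -
        have "b - (b - x0) = - (- x0)" "a - (a + 1) = - 1" by simp_all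
        then show ?thesis unfolding l2_def restr_line_other by (simp only: minus_pCons minus_zero)
      qed
      then have r1: "restr a b l2 * restr a b C = [:- x0, 1:] * u" unfolding C_def restr_const by (simp only: minus_mult_minus)
      have "restr a b G - restr a b S = [:- x0, 1:] * u"
        using u unfolding S_def h_def f_def restr_scale .
      then have H0: "restr a b H = 0"
        unfolding H_def restr_diff restr_mult r1 by (simp only: diff_self)
      have C: "C \<in> tpolys (int m)"
        using ud upolys_smult[of u _ "- 1"] unfolding C_def by (simp add: tpolys_const)
      have "l2 * C \<in> tpolys (int m + 1)"
        using tpolys_mult[OF line_in C, of "a + 1" "b - x0"] unfolding l2_def by (simp only: add.commute)
      then have "H \<in> tpolys (int m + 1)" unfolding H_def S_def
        by (intro tpolys_diff tpolys_scale G Fd)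
      then obtain K where K: "K \<in> tpolys (int m + 1 - 1)" "H = L * K"
        using H0 unfolding L_def by (rule restr_eq_0_tpolys)
      have "S \<in> VR.span {F}" unfolding S_def by (intro VR.span_scale VR.span_base) simp
      moreover have "L * K \<in> (*) L ` tpolys (int m)" using K(1) by (intro imageI) simp
      ultimately have SL: "S + L * K \<in> U" unfolding U_def colsum_def power_one_right by (rule sumsetI)
      have "l2 * C \<in> (*) l2 ` tpolys (int m)" using C by blast
      with SL have "(S + L * K) + l2 * C \<in> colsum U 1 l2 (int m)"
        unfolding colsum_def power_one_right by (rule sumsetI)
      moreover have "(S + L * K) + l2 * C = G" using K(2)[symmetric] unfolding H_def by simp
      ultimately show "G \<in> colsum U 1 (line (a + 1) (b - x0)) (int m)" unfolding l2_def by simp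
    qed
    have G2: "generic (\<lambda>a' b'. VR.dim (tpolys (int m + 1) :: 'k poly poly set) \<le> VR.dim (colsum U 1 (line a' b') (int m)))"
      by (rule colsum_dim_semicontinuous[OF U(1,3), where ?a0.0 = "a + 1" and ?b0.0 = "b - x0"]) (simp only: full order_refl)
    obtain a' b' where r1: "int m + 1 - c \<le> rdim a' b' W'"
      and r2: "VR.dim (tpolys (int m + 1) :: 'k poly poly set) \<le> VR.dim (colsum U 1 (line a' b') (int m))"
      using generic_ex[OF generic_conj[OF G1 G2]] by blast
    define L' where "L' = line a' b'"
    define S1 where "S1 = colsum W 1 L' (int m)"
    define S2 where "S2 = (*) L ` tpolys (int m)"
    have S1: "VR.subspace S1" "S1 \<subseteq> tpolys (int m + 1)"
      unfolding S1_def colsum_def power_one_right L'_def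
      by (intro VR.subspace_sumset W subspace_mult subspace_tpolys)
        (rule VR.sumset_least[OF subspace_tpolys W(2) Ltp[OF line_in]])
    have S2: "VR.subspace S2" "S2 \<subseteq> tpolys (int m + 1)"
      unfolding S2_def L_def by (rule subspace_mult[OF subspace_tpolys], rule Ltp[OF line_in])
    have "colsum U 1 L' (int m) \<subseteq> sumset S1 S2"
    proof -
      have "F \<in> S1" unfolding S1_def by (rule colsum_I1[OF F(1)])
      then have "VR.span {F} \<subseteq> S1" by (intro VR.span_minimal S1) simp
      then have a1: "VR.span {F} \<subseteq> sumset S1 S2" using VR.sumset_upper1[OF S2(1)] by blast
      have a2: "S2 \<subseteq> sumset S1 S2" by (rule VR.sumset_upper2[OF S1(1)])
      have "(*) L' ` tpolys (int m) \<subseteq> S1" unfolding S1_def colsum_def power_one_right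
        by (rule VR.sumset_upper2[OF W(1)])
      then have a3: "(*) L' ` tpolys (int m) \<subseteq> sumset S1 S2" using VR.sumset_upper1[OF S2(1)] by blast
      show ?thesis unfolding U_def colsum_def power_one_right
        using a1 a2 a3 VR.subspace_sumset[OF S1(1) S2(1)] by (simp add: VR.sumset_least S2_def[symmetric])
    qed
    then have "pdim (colsum U 1 L' (int m)) \<le> pdim (sumset S1 S2)"
      by (rule pdim_mono[OF _ VR.sumset_least[OF subspace_tpolys S1(2) S2(2)]])
    then have d12: "t (int m + 1) \<le> pdim (sumset S1 S2)"
      using r2 unfolding t_def L'_def by linarith
    \<comment> \<open>S1 and S2 together fill degree m + 1, and their intersection contains L times
      the corresponding sum for W'. This bounds the dimension of S1, hence the rank of W on the
      second line, from below.\<close>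
    have sumInt: "pdim (sumset S1 S2) + pdim (S1 \<inter> S2) = pdim S1 + pdim S2"
      using VR.dim_sumset_Int[OF S1(1) fin_dim_in_tpolys[OF S1(2)] S2(1) fin_dim_in_tpolys[OF S2(2)]] by linarith
    have dS2: "pdim S2 = t (int m)"
      unfolding S2_def L_def t_def by (simp add: dim_mult[OF subspace_tpolys fin_dim_tpolys line_nonzero])
    define T where "T = colsum W' 1 L' (int m - 1)"
    have Tin: "VR.subspace T" "T \<subseteq> tpolys (int m)"
      unfolding T_def L'_def colsum_def power_one_right
      using mult_tpolys_subset[OF line_in, of a' b' "int m - 1"]
      by (intro VR.subspace_sumset W' subspace_mult subspace_tpolys, intro VR.sumset_least[OF subspace_tpolys W'(2)]) simp
    have "(*) L ` T \<subseteq> S1 \<inter> S2"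
    proof
      fix z assume "z \<in> (*) L ` T"
      then obtain x y where xy: "x \<in> W'" "y \<in> tpolys (int m - 1)" "z = L * (x + L' * y)"
        unfolding T_def colsum_def power_one_right by (auto elim!: sumsetE)
      have "L * x \<in> W" using xy(1) unfolding W'_def colon_def by blast
      moreover have "L * y \<in> tpolys (int m)"
        using mult_tpolys_subset[OF line_in, of a b "int m - 1"] xy(2) unfolding L_def by auto
      ultimately have "L * x + L' * (L * y) \<in> S1"
        unfolding S1_def colsum_def power_one_right by (intro sumsetI) auto
      moreover have "z = L * x + L' * (L * y)" using xy(3) by (simp add: algebra_simps)
      moreover have "z \<in> S2" unfolding S2_def using \<open>z \<in> (*) L ` T\<close> Tin(2) by blast
      ultimately show "z \<in> S1 \<inter> S2" by simp
    qed
    then have "pdim ((*) L ` T) \<le> pdim (S1 \<inter> S2)"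
      using pdim_mono[of "(*) L ` T" "S1 \<inter> S2" "int m + 1"] S1(2) by blast
    then have le: "pdim T \<le> pdim (S1 \<inter> S2)"
      using dim_mult[OF Tin(1) fin_dim_in_tpolys[OF Tin(2)], of L] line_nonzero[of a b] unfolding L_def by simp
    have dT: "pdim T = rdim a' b' W' + t (int m - 1)"
      unfolding T_def L'_def t_def by (rule rdim_colsum[OF W'])
    have "pdim S1 = rdim a' b' W + t (int m + 1 - 1)"
      using rdim_colsum[OF W, of a' b'] unfolding S1_def L'_def t_def by simp
    then have "pdim S1 = rdim a' b' W + t (int m)" by simp
    moreover have "t (int m) = t (int m - 1) + int m + 1"
      using td[of "int m - 1"] td[of "int m"] by (simp add: algebra_simps)
    moreover have "t (int m + 1) = t (int m) + int m + 2"
      using td[of "int m"] td[of "int m + 1"] by (simp add: algebra_simps)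
    ultimately have "int (Suc m) + 1 - c \<le> rdim a' b' W"
      using d12 sumInt dS2 le dT r1 by linarith
    then show False using neg by blast
  qed
  then obtain a b where "int (Suc m) + 1 - c \<le> rdim a b W" by blast
  then show ?case by (rule rdim_semicontinuous[OF Suc.prems(1,2)])
qed

subsection \<open>Subspaces of univariate polynomials\<close>

abbreviation ux :: "'k::field poly" where "ux \<equiv> [:0, 1:]"

text \<open>Polynomials of degree at most d stand for binary forms of degree d, so 1 and x span the
  linear forms and this is the product of V with all of them.\<close>

definition xhull :: "'k::field poly set \<Rightarrow> 'k poly set" where
  "xhull V = sumset V ((*) ux ` V)"

lemma linear_mult_u: "Vector_Spaces.linear smult smult ((*) (g :: 'k::field poly))"
  unfolding Vector_Spaces.linear_iff
  by (intro conjI allI VX.vector_space_axioms distrib_left mult_smult_right)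

lemma subspace_mult_u: "VX.subspace V \<Longrightarrow> VX.subspace ((*) g ` V)"
  by (rule VXX.linear_subspace_image[OF linear_mult_u])

lemma dim_mult_u:
  assumes "VX.subspace V" "fin_dim smult V" "g \<noteq> 0" shows "VX.dim ((*) g ` V) = VX.dim V"
  by (rule VXX.dim_image_inj_fdim[OF linear_mult_u assms(1,2)]) (use assms(3) in simp)

lemma subspace_xhull: "VX.subspace V \<Longrightarrow> VX.subspace (xhull V)"
  unfolding xhull_def by (intro VX.subspace_sumset subspace_mult_u)

lemma X_mult_upolys: "f \<in> upolys d \<Longrightarrow> ux * f \<in> upolys (d + 1)"
  using upolys_mult[of ux 1 f d] by (simp add: upolys_iff add.commute)

lemma xhull_in_upolys: assumes "V \<subseteq> upolys d" shows "xhull V \<subseteq> upolys (d + 1)"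
proof -
  have "V \<subseteq> upolys (d + 1)" using assms upolys_mono[of d "d + 1"] by auto
  moreover have "(*) ux ` V \<subseteq> upolys (d + 1)" using assms X_mult_upolys by blast
  ultimately show ?thesis unfolding xhull_def by (rule VX.sumset_least[OF subspace_upolys])
qed

lemma xhull_upper:
  assumes "VX.subspace V" shows "V \<subseteq> xhull V" "f \<in> V \<Longrightarrow> ux * f \<in> xhull V"
proof -
  show "V \<subseteq> xhull V" unfolding xhull_def by (rule VX.sumset_upper1[OF subspace_mult_u[OF assms]])
  show "ux * f \<in> xhull V" if "f \<in> V"
    unfolding xhull_def using VX.sumset_upper2[OF assms, of "(*) ux ` V"] that by blast
qed

lemma xhull_least: "VX.subspace T \<Longrightarrow> V \<subseteq> T \<Longrightarrow> (*) ux ` V \<subseteq> T \<Longrightarrow> xhull V \<subseteq> T"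
  unfolding xhull_def by (rule VX.sumset_least)

lemma top_element:
  assumes "V \<subseteq> upolys d" "f \<in> V" "f \<noteq> 0"
  obtains g where "g \<in> V" "g \<noteq> 0" "V \<subseteq> upolys (int (degree g))"
proof -
  have "\<exists>g. (g \<in> V \<and> g \<noteq> 0) \<and> (\<forall>h. h \<in> V \<and> h \<noteq> 0 \<longrightarrow> degree h \<le> degree g)"
  proof (rule ex_has_greatest_nat[where b = "Suc (nat d)"])
    show "f \<in> V \<and> f \<noteq> 0" using assms by blast
    show "\<forall>h. h \<in> V \<and> h \<noteq> 0 \<longrightarrow> degree h < Suc (nat d)"
    proof (intro allI impI, elim conjE)
      fix h assume "h \<in> V" "h \<noteq> 0"
      then have "int (degree h) \<le> d" using assms(1) upolys_iff by blast
      then show "degree h < Suc (nat d)" by linarith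
    qed
  qed
  then obtain g where g: "g \<in> V" "g \<noteq> 0" "\<forall>h. h \<in> V \<and> h \<noteq> 0 \<longrightarrow> degree h \<le> degree g" by blast
  show ?thesis
  proof (rule that[OF g(1,2)], rule subsetI)
    fix h assume "h \<in> V"
    then show "h \<in> upolys (int (degree g))" unfolding upolys_iff using g(3) by auto
  qed
qed

text \<open>The product of x with an element of largest degree in V lies outside V.\<close>

lemma xhull_grows:
  assumes "VX.subspace V" "V \<subseteq> upolys d" "V \<noteq> {0}"
  shows "VX.dim V + 1 \<le> VX.dim (xhull V)"
proof -
  obtain f where "f \<in> V" "f \<noteq> 0" using assms(3) VX.subspace_0[OF assms(1)] by blast
  then obtain g where g: "g \<in> V" "g \<noteq> 0" "V \<subseteq> upolys (int (degree g))" by (rule top_element[OF assms(2)])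
  have "ux * g \<notin> V"
  proof
    assume "ux * g \<in> V"
    then have "ux * g \<in> upolys (int (degree g))" using g(3) by blast
    then show False using g(2) by (simp add: upolys_iff degree_mult_eq)
  qed
  then have "V \<subset> xhull V" using xhull_upper[OF assms(1)] g(1) by blast
  then have "VX.dim V < VX.dim (xhull V)"
    by (rule VX.dim_strict_fdim[OF fin_dim_in_upolys[OF xhull_in_upolys[OF assms(2)]] assms(1)])
  then show ?thesis by simp
qed

lemma xhull_mult_upolys:
  assumes "0 \<le> k" shows "xhull ((*) Q ` upolys k) = (*) Q ` upolys (k + 1)"
proof (intro subset_antisym subsetI)
  fix f assume "f \<in> xhull ((*) Q ` upolys k)"
  then obtain u v where uv: "u \<in> upolys k" "v \<in> upolys k" "f = Q * u + ux * (Q * v)"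
    unfolding xhull_def by (auto elim!: sumsetE)
  then have "f = Q * (u + ux * v)" by (simp add: algebra_simps)
  moreover have "u + ux * v \<in> upolys (k + 1)"
    using uv upolys_mono[of k "k + 1"] by (intro upolys_add X_mult_upolys) auto
  ultimately show "f \<in> (*) Q ` upolys (k + 1)" by blast
next
  fix f assume "f \<in> (*) Q ` upolys (k + 1)"
  then obtain p where p: "p \<in> upolys (k + 1)" "f = Q * p" by blast
  obtain c q where cq: "p = pCons c q" by (rule pCons_cases)
  have "q \<in> upolys k" using p(1) unfolding cq upolys_iff by (cases "q = 0") auto
  moreover have "[:c:] \<in> upolys k" using assms by (simp add: upolys_iff)
  moreover have "f = Q * [:c:] + ux * (Q * q)" unfolding p(2) cq by (simp add: algebra_simps)
  ultimately show "f \<in> xhull ((*) Q ` upolys k)" unfolding xhull_def by (metis imageI sumsetI)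
qed

text \<open>The equality case of \<open>xhull_grows\<close>, by induction on the dimension. The
  elements of V without top coefficient form a subspace V' whose hull stays inside V, so V' again
  grows by one and its hull is V.\<close>

lemma xhull_minimal_growth:
  fixes V :: "'k::field poly set"
  assumes "VX.subspace V" "V \<subseteq> upolys d" "VX.dim (xhull V) = VX.dim V + 1"
  obtains Q where "Q \<noteq> 0" "V = (*) Q ` upolys (int (VX.dim V) - 1)" "0 < VX.dim V"
proof -
  have "\<exists>Q. Q \<noteq> 0 \<and> V = (*) Q ` upolys (int m)" if "VX.dim V = Suc m" for m
    using assms that
  proof (induction m arbitrary: V d)
    case 0
    obtain B where B: "B \<subseteq> V" "VX.independent B" "V \<subseteq> VX.span B" "finite B" "card B = VX.dim V"
      by (rule VX.fdim_basis[OF fin_dim_in_upolys[OF 0(2)]])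
    then obtain Q where Q: "B = {Q}" using 0(4) by (metis One_nat_def card_1_singletonE)
    have "Q \<noteq> 0" using B(2) Q by (metis VX.dependent_single)
    moreover have "V = VX.span {Q}" using B Q VX.span_minimal[OF B(1) 0(1)] by blast
    moreover have "VX.span {Q} = (*) Q ` upolys (int 0)"
    proof (intro subset_antisym subsetI)
      fix f assume "f \<in> VX.span {Q}"
      then obtain k where "f = smult k Q" unfolding VX.span_singleton by blast
      then have "f = Q * [:k:]" by simp
      moreover have "[:k:] \<in> upolys (int 0)" by (simp add: upolys_iff)
      ultimately show "f \<in> (*) Q ` upolys (int 0)" by (rule image_eqI)
    next
      fix f assume "f \<in> (*) Q ` upolys (int 0)"
      then obtain q where q: "f = Q * q" "q \<in> upolys 0" by auto
      then have "degree q = 0" unfolding upolys_iff by auto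
      then obtain k where "q = [:k:]" by (rule degree_eq_zeroE)
      then have "f = smult k Q" using q by simp
      then show "f \<in> VX.span {Q}" unfolding VX.span_singleton by (rule range_eqI)
    qed
    ultimately show ?case by blast
  next
    case (Suc m)
    have "V \<noteq> {0}"
    proof
      assume "V = {0}"
      then show False using Suc.prems(4) by simp
    qed
    then obtain f where "f \<in> V" "f \<noteq> 0" using VX.subspace_0[OF Suc.prems(1)] by blast
    then obtain g where g: "g \<in> V" "g \<noteq> 0" "V \<subseteq> upolys (int (degree g))"
      by (rule top_element[OF Suc.prems(2)])
    define D where "D = degree g"
    have le_iff: "h \<in> upolys (int k) \<longleftrightarrow> coeff h (Suc k) = 0" if "h \<in> upolys (int k + 1)" for h :: "'k poly" and k
    proof
      assume "h \<in> upolys (int k)"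
      then show "coeff h (Suc k) = 0" using upolysD[of h "int k" "Suc k"] by auto
    next
      assume z: "coeff h (Suc k) = 0"
      have "int i \<le> int k" if "coeff h i \<noteq> 0" for i
        using upolysD[OF \<open>h \<in> upolys (int k + 1)\<close> that] z that by (cases "i = Suc k") auto
      then show "h \<in> upolys (int k)" unfolding upolys_def by blast
    qed
    have fV: "fin_dim smult V" and fT: "fin_dim smult (xhull V)"
      using fin_dim_in_upolys[OF Suc.prems(2)] fin_dim_in_upolys[OF xhull_in_upolys[OF Suc.prems(2)]] .
    have hull_D: "xhull V \<subseteq> upolys (int D + 1)" using xhull_in_upolys[OF g(3)] unfolding D_def .
    \<comment> \<open>V has codimension one in its hull, so it is the kernel there of the
      coefficient of x^(D+1), which vanishes on V but not on the product of x and g.\<close>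
    have VT: "V = {h \<in> xhull V. coeff h (Suc D) = 0}"
    proof (rule VX.subspace_eq_fdim)
      show "fin_dim smult {h \<in> xhull V. coeff h (Suc D) = 0}" by (rule VX.fdim_subset[OF fT]) blast
      show "VX.subspace V" by fact
      show "V \<subseteq> {h \<in> xhull V. coeff h (Suc D) = 0}"
      proof
        fix h assume "h \<in> V"
        then have "h \<in> xhull V" "h \<in> upolys (int D)" using xhull_upper(1)[OF Suc.prems(1)] g(3) unfolding D_def by auto
        then show "h \<in> {h \<in> xhull V. coeff h (Suc D) = 0}" using le_iff[of h D] hull_D by blast
      qed
      have "coeff (ux * g) (Suc D) \<noteq> 0" using g(2) unfolding D_def by simp
      then have "{h \<in> xhull V. coeff h (Suc D) = 0} \<subset> xhull V"
        using xhull_upper(2)[OF Suc.prems(1) g(1)] by blast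
      moreover have "VX.subspace {h \<in> xhull V. coeff h (Suc D) = 0}"
        by (rule VX.subspace_functional_kernel[OF subspace_xhull[OF Suc.prems(1)]]) simp_all
      ultimately have "VX.dim {h \<in> xhull V. coeff h (Suc D) = 0} < VX.dim (xhull V)"
        by (intro VX.dim_strict_fdim[OF fT])
      then show "VX.dim {h \<in> xhull V. coeff h (Suc D) = 0} \<le> VX.dim V" using Suc.prems(3) by simp
    qed
    define V' where "V' = {h \<in> V. coeff h D = 0}"
    have V': "VX.subspace V'" "V' \<subseteq> V"
      unfolding V'_def by (rule VX.subspace_functional_kernel[OF Suc.prems(1)]) auto
    have lower: "Suc m \<le> VX.dim V'"
      using VX.hyperplane_dim[OF Suc.prems(1) fV, of "\<lambda>h. coeff h D"] Suc.prems(4) unfolding V'_def by simp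
    have "V' \<noteq> {0}"
    proof
      assume "V' = {0}"
      then show False using lower by simp
    qed
    have hull': "xhull V' \<subseteq> V"
    proof (rule xhull_least[OF Suc.prems(1) V'(2)], rule subsetI)
      fix h assume "h \<in> (*) ux ` V'"
      then obtain v where v: "v \<in> V" "coeff v D = 0" "h = ux * v" unfolding V'_def by blast
      then have "h \<in> xhull V" "coeff h (Suc D) = 0" using xhull_upper(2)[OF Suc.prems(1)] by auto
      then show "h \<in> V" using VT by blast
    qed
    have "VX.dim V' + 1 \<le> VX.dim (xhull V')"
      using xhull_grows[OF V'(1) _ \<open>V' \<noteq> {0}\<close>, of d] V'(2) Suc.prems(2) by blast
    moreover have "VX.dim (xhull V') \<le> VX.dim V" by (rule VX.dim_mono_fdim[OF fV hull'])
    ultimately have dims: "VX.dim V' = Suc m" "VX.dim (xhull V') = Suc (Suc m)" using lower Suc.prems(4) by auto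
    have eqV: "xhull V' = V"
      by (rule VX.subspace_eq_fdim[OF fV subspace_xhull[OF V'(1)] hull']) (simp add: dims Suc.prems(4))
    have "V' \<subseteq> upolys d" using V'(2) Suc.prems(2) by blast
    from Suc.IH[OF V'(1) this] dims obtain Q where Q: "Q \<noteq> 0" "V' = (*) Q ` upolys (int m)" by auto
    have "V = (*) Q ` upolys (int m + 1)" using eqV xhull_mult_upolys[of "int m" Q] unfolding Q(2) by simp
    then show ?case using Q(1) by (intro exI[of _ Q]) (simp add: add.commute)
  qed
  moreover have "0 < VX.dim V"
  proof (rule ccontr)
    assume a: "\<not> 0 < VX.dim V"
    have "V = {0}"
    proof (rule ccontr)
      assume "V \<noteq> {0}"
      then obtain f where f: "f \<in> V" "f \<noteq> 0" using VX.subspace_0[OF assms(1)] by blast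
      then have "VX.independent {f}" "{f} \<subseteq> V" using VX.dependent_single by blast+
      then have "card {f} \<le> VX.dim V"
        by (intro VX.fdim_independent(2)[OF fin_dim_in_upolys[OF assms(2)]])
      then show False using a by simp
    qed
    then have "xhull V = {0}" unfolding xhull_def sumset_def by auto
    then show False using assms(3) \<open>V = {0}\<close> by simp
  qed
  moreover from this obtain m where m: "VX.dim V = Suc m" using gr0_implies_Suc by blast
  ultimately obtain Q where "Q \<noteq> 0" "V = (*) Q ` upolys (int m)" by blast
  moreover have "int m = int (VX.dim V) - 1" using m by simp
  ultimately show ?thesis using that \<open>0 < VX.dim V\<close> by metis
qed

section \<open>Common factors of a linear system\<close>

lemma prime_factorization_ex:
  fixes F :: "'k::field poly poly"
  assumes "F \<noteq> 0"
  obtains A u where "\<forall>p\<in>#A. prime_elem p" "u dvd 1" "F = u * prod_mset A"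
proof (cases "F dvd 1")
  case True
  then show ?thesis by (intro that[of "{#}" F]) auto
next
  case False
  obtain A where A: "mset_factors A F" using mset_factors_exist[OF assms False] by blast
  have "prime_elem p" if "p \<in># A" for p
    using A that unfolding mset_factors_def by (simp add: prime_elem_iff_irreducible)
  moreover have "F = 1 * prod_mset A" using A unfolding mset_factors_def by simp
  ultimately show ?thesis by (intro that[of A 1]) auto
qed

lemma dvd_scaleP:
  assumes "c \<noteq> 0" "p dvd scaleP c H" shows "p dvd H"
proof -
  have "H = [:[:inverse c:]:] * scaleP c H" using assms(1) unfolding scaleP_def by simp
  then show ?thesis using dvd_mult[OF assms(2), of "[:[:inverse c:]:]"] by simp
qed

text \<open>In the pencil G + c H each prime divides at most one member unless it divides both G and
  H. An infinite field leaves a value of c that avoids the finitely many primes.\<close>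

lemma avoid_primes:
  fixes W :: "'k::field_char_0 poly poly set"
  assumes W: "VR.subspace W" and "\<And>p. p \<in> set ps \<Longrightarrow> \<exists>H\<in>W. \<not> p dvd H"
  shows "\<exists>G\<in>W. \<forall>p\<in>set ps. \<not> p dvd G"
  using assms(2)
proof (induction ps)
  case Nil
  then show ?case using VR.subspace_0[OF W] by auto
next
  case (Cons p ps)
  then obtain G where G: "G \<in> W" "\<forall>q\<in>set ps. \<not> q dvd G" by auto
  show ?case
  proof (cases "p dvd G")
    case False
    then show ?thesis using G by auto
  next
    case True
    obtain H where H: "H \<in> W" "\<not> p dvd H" using Cons.prems[of p] by auto
    define bad where "bad = (\<lambda>q. {c. q dvd G + scaleP c H})"
    have "finite (bad q)" if q: "q \<in> set ps" for q
    proof -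
      have "c = d" if "c \<in> bad q" "d \<in> bad q" for c d
      proof (rule ccontr)
        assume "c \<noteq> d"
        have 1: "q dvd G + scaleP c H" "q dvd G + scaleP d H" using that unfolding bad_def by auto
        have "(G + scaleP c H) - (G + scaleP d H) = scaleP (c - d) H"
          by (simp add: VR.scale_left_diff_distrib)
        then have "q dvd scaleP (c - d) H" using dvd_diff[OF 1] by simp
        then have "q dvd H" using dvd_scaleP \<open>c \<noteq> d\<close> by (metis right_minus_eq)
        then have "q dvd scaleP c H" unfolding scaleP_def by (rule dvd_smult)
        then have "q dvd G" using 1(1) dvd_add_left_iff by blast
        then show False using G(2) q by blast
      qed
      then have "\<forall>c\<in>bad q. bad q \<subseteq> {c}" by blast
      then show ?thesis using finite_subset[of "bad q"] by (cases "bad q = {}") blast+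
    qed
    then have "finite ((\<Union>q\<in>set ps. bad q) \<union> {0})" by simp
    then have "(\<Union>q\<in>set ps. bad q) \<union> {0} \<noteq> UNIV" using infinite_UNIV_char_0 by metis
    then obtain c where c: "c \<noteq> 0" "\<forall>q\<in>set ps. c \<notin> bad q" by blast
    have "\<not> p dvd G + scaleP c H"
    proof
      assume "p dvd G + scaleP c H"
      then have "p dvd scaleP c H" using True dvd_add_right_iff by blast
      then show False using dvd_scaleP c(1) H(2) by blast
    qed
    moreover have "G + scaleP c H \<in> W" by (intro VR.subspace_add[OF W] VR.subspace_scale[OF W] G H)
    ultimately show ?thesis using c(2) unfolding bad_def by auto
  qed
qed

lemma coprime_cancel:
  fixes G v :: "'k::field poly poly"
  assumes "\<forall>p\<in>#A. prime_elem p \<and> \<not> p dvd G" "prod_mset A dvd G * v"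
  shows "prod_mset A dvd v"
  using assms
proof (induction A arbitrary: v)
  case empty
  then show ?case by simp
next
  case (add p A)
  have p: "prime_elem p" "\<not> p dvd G" using add.prems(1) by auto
  have d: "p * prod_mset A dvd G * v" using add.prems(2) by simp
  have "p dvd G * v" by (rule dvd_mult_left[OF d])
  then have "p dvd v" using prime_elem_dvd_multD[OF p(1), of G v] p(2) by blast
  then obtain w where w: "v = p * w" ..
  have "p * prod_mset A dvd p * (G * w)" using d unfolding w by (simp add: mult.left_commute)
  moreover have "p \<noteq> 0" using p(1) by (rule prime_elem_not_zeroI)
  moreover from calculation(1) obtain k where "p * (G * w) = p * prod_mset A * k" by (rule dvdE)
  then have "p * (G * w) = p * (prod_mset A * k)" unfolding mult.assoc .
  ultimately have "G * w = prod_mset A * k" using mult_left_cancel by blast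
  then have dw: "prod_mset A dvd G * w" by (rule dvdI)
  have "\<forall>q\<in>#A. prime_elem q \<and> \<not> q dvd G"
  proof
    fix q assume "q \<in># A"
    then have "q \<in># add_mset p A" by simp
    then show "prime_elem q \<and> \<not> q dvd G" by (rule bspec[OF add.prems(1)])
  qed
  from add.IH[OF this dw] have "prod_mset A dvd w" .
  then have "p * prod_mset A dvd p * w" by (rule mult_dvd_mono[OF dvd_refl])
  then show ?case unfolding w prod_mset.add_mset .
qed

text \<open>Two curves of degree at most \<open>n\<close> without common component meet in at most \<open>n\<^sup>2\<close> points,
  so a general line misses their intersection.\<close>

lemma coprime_pair_generic:
  fixes F G :: "'k::field_char_0 poly poly"
  assumes F: "exact_tdeg n F" and G: "G \<in> tpolys n" and cop: "\<And>v. F dvd G * v \<Longrightarrow> F dvd v"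
  defines "N \<equiv> n * n + 2 * n"
  shows "generic (\<lambda>a b. restr a b ` sumset ((*) F ` tpolys (N - n)) ((*) G ` tpolys (N - n)) = upolys N)"
proof -
  let ?T = "tpolys (N - n) :: 'k poly poly set"
  let ?A = "(*) F ` ?T" and ?B = "(*) G ` ?T"
  have n: "0 \<le> n" using exact_tdeg_nonneg[OF F] .
  moreover have "0 \<le> n * n" by simp
  ultimately have N: "0 \<le> N" "- 2 \<le> N - n" "- 2 \<le> N - 2 * n" unfolding N_def by linarith+
  have Fn: "F \<in> tpolys n" "F \<noteq> 0" using F exact_tdeg_nonzero[OF F] unfolding exact_tdeg_def by auto
  have A: "VR.subspace ?A" "?A \<subseteq> tpolys N" "pdim ?A = pdim ?T"
    using mult_tpolys_subset[OF Fn(1), of "N - n"] dim_mult[OF subspace_tpolys fin_dim_tpolys Fn(2)]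
    by (auto intro!: subspace_mult subspace_tpolys)
  have B: "VR.subspace ?B" "?B \<subseteq> tpolys N"
    using mult_tpolys_subset[OF G, of "N - n"] by (auto intro!: subspace_mult subspace_tpolys)
  let ?U = "sumset ?A ?B"
  have U: "VR.subspace ?U" "?U \<subseteq> tpolys N"
    by (rule VR.subspace_sumset[OF A(1) B(1)], rule VR.sumset_least[OF subspace_tpolys A(2) B(2)])
  have t: "2 * pdim (tpolys d :: 'k poly poly set) = (d + 1) * (d + 2)" if "- 2 \<le> d" for d
    by (rule dim_tpolys[OF that])
  define nn where "nn = n * n"
  have nn0: "0 \<le> nn" unfolding nn_def by simp
  \<comment> \<open>By coprimality the multiples of F and of G meet only in multiples of F G, and
    inclusion-exclusion gives the Bezout number n^2. If G = 0, coprimality makes F a unit, so n =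
    0.\<close>
  have codim: "2 * (pdim (tpolys N :: 'k poly poly set) - pdim ?U) \<le> 2 * nn"
  proof (cases "G = 0")
    case True
    have "F dvd G * 1" using True by simp
    then have "F dvd 1" by (rule cop)
    then obtain H where H: "1 = F * H" ..
    have "1 \<in> (tpolys 0 :: 'k poly poly set)" by (rule one_in_tpolys) simp
    then have "H \<in> tpolys (0 - n)" using tpolys_cancel[OF F, of H 0] H by simp
    have "n = 0"
    proof (rule ccontr)
      assume "n \<noteq> 0"
      then have "0 - n < 0" using n by simp
      from tpolys_neg[OF this] \<open>H \<in> tpolys (0 - n)\<close> have "H = 0" by blast
      then show False using H by simp
    qed
    then have "pdim ?A = pdim (tpolys N :: 'k poly poly set)" using A(3) by simp
    moreover have "pdim ?A \<le> pdim ?U" by (rule pdim_mono[OF VR.sumset_upper1[OF B(1)] U(2)])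
    moreover have "2 * (t - b) \<le> 2 * nn" if "a = t" "a \<le> b" for a b t :: int using nn0 that by simp
    ultimately show ?thesis by blast
  next
    case False
    have Bd: "pdim ?B = pdim ?T"
      using dim_mult[OF subspace_tpolys fin_dim_tpolys False] by simp
    have "?A \<inter> ?B \<subseteq> (*) (G * F) ` tpolys (N - 2 * n)"
    proof
      fix z assume z: "z \<in> ?A \<inter> ?B"
      then obtain v where v: "v \<in> ?T" "z = G * v" by blast
      obtain u where "z = F * u" using z by blast
      then have "F dvd G * v" using v(2) by (metis dvd_triv_left)
      then have "F dvd v" by (rule cop)
      then obtain w where w: "v = F * w" ..
      have "w \<in> tpolys (N - n - n)" using tpolys_cancel[OF F, of w "N - n"] v(1) w by simp
      then have "w \<in> tpolys (N - 2 * n)" by (simp add: algebra_simps)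
      moreover have "z = (G * F) * w" using v w by (simp add: mult.assoc)
      ultimately show "z \<in> (*) (G * F) ` tpolys (N - 2 * n)" by blast
    qed
    then have "VR.dim (?A \<inter> ?B) \<le> VR.dim ((*) (G * F) ` tpolys (N - 2 * n))"
      by (rule VR.dim_mono_fdim[OF fin_dim_mult[OF fin_dim_tpolys]])
    also have "\<dots> = VR.dim (tpolys (N - 2 * n) :: 'k poly poly set)"
      using dim_mult[OF subspace_tpolys fin_dim_tpolys, of "G * F"] False Fn(2) by simp
    finally have "pdim (?A \<inter> ?B) \<le> pdim (tpolys (N - 2 * n) :: 'k poly poly set)" by simp
    moreover have "pdim ?U + pdim (?A \<inter> ?B) = pdim ?A + pdim ?B"
      using VR.dim_sumset_Int[OF A(1) fin_dim_in_tpolys[OF A(2)] B(1) fin_dim_in_tpolys[OF B(2)]] by linarith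
    moreover have "2 * pdim (tpolys N :: 'k poly poly set) - 2 * (2 * pdim ?T) + 2 * pdim (tpolys (N - 2 * n) :: 'k poly poly set) = 2 * nn"
      unfolding nn_def using t[of N] t[OF N(2)] t[OF N(3)] N(1) by (simp add: algebra_simps)
    moreover have "2 * (tN - u) \<le> 2 * nn"
      if "i \<le> t2" "u + i = fa + fb" "2 * tN - 2 * (2 * t1) + 2 * t2 = 2 * nn" "fa = t1" "fb = t1"
      for tN u i t1 t2 fa fb :: int
    proof -
      have "tN - 2 * t1 + t2 = nn" using that(3) by simp
      then have "tN - u \<le> nn" using that by linarith
      then show ?thesis by simp
    qed
    ultimately show ?thesis using A(3) Bd by blast
  qed
  obtain M where M: "N = int M" using N(1) nonneg_int_cases by blast
  \<comment> \<open>The degree N = n^2 + 2 n is at least the codimension n^2, as the case c = 0 of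
    \<open>generic_restriction\<close> requires. The summand 2 n keeps N - 2 n nonnegative in the
    dimension count.\<close>
  have "2 * (pdim (tpolys (int M) :: 'k poly poly set) - pdim ?U) \<le> 2 * (0 + 1) * int M - 0 * (0 - 1)"
    using codim n unfolding M[symmetric] nn_def by (simp add: N_def)
  then have "generic (\<lambda>a b. int M + 1 - 0 \<le> rdim a b ?U)"
    using U unfolding M by (intro generic_restriction) auto
  then show ?thesis
  proof (rule generic_mono)
    fix a b assume "int M + 1 - 0 \<le> rdim a b ?U"
    then have "VX.dim (upolys N :: 'k poly set) \<le> VX.dim (restr a b ` ?U)"
      using dim_upolys[of N, where 'k='k] N(1) M by linarith
    then show "restr a b ` ?U = upolys N"
      by (rule VX.subspace_eq_fdim[OF fin_dim_upolys subspace_restr[OF U(1)] restr_in_upolys[OF U(2)]])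
  qed
qed

definition tdeg :: "'k::field poly poly \<Rightarrow> nat" where
  "tdeg F = (THE n. exact_tdeg (int n) F)"

lemma exact_tdeg_unique: "exact_tdeg m F \<Longrightarrow> exact_tdeg n F \<Longrightarrow> m = n"
proof -
  have "m \<le> n" if "exact_tdeg m F" "exact_tdeg n F" for m n
    using that tpolys_mono[of n "m - 1"] unfolding exact_tdeg_def by force
  then show "exact_tdeg m F \<Longrightarrow> exact_tdeg n F \<Longrightarrow> m = n" by (meson order_antisym)
qed

lemma exact_tdeg_tdeg: assumes "F \<noteq> 0" shows "exact_tdeg (int (tdeg F)) F"
proof -
  obtain d where "F \<in> tpolys d" by (rule tpolys_ex[of F])
  then obtain n where n: "exact_tdeg n F" "0 \<le> n" using exact_tdeg_ex[OF assms] by blast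
  then obtain m where m: "exact_tdeg (int m) F" by (metis nonneg_int_cases)
  show ?thesis unfolding tdeg_def
  proof (rule theI[of _ m])
    show "exact_tdeg (int m) F" by fact
    fix k assume "exact_tdeg (int k) F"
    then have "int k = int m" using m by (rule exact_tdeg_unique)
    then show "k = m" by simp
  qed
qed

lemma tdeg_le: assumes "F \<noteq> 0" "F \<in> tpolys d" shows "int (tdeg F) \<le> d"
proof (rule ccontr)
  assume "\<not> ?thesis"
  then have "F \<in> tpolys (int (tdeg F) - 1)" using tpolys_mono[of d "int (tdeg F) - 1"] assms(2) by auto
  then show False using exact_tdeg_tdeg[OF assms(1)] unfolding exact_tdeg_def by blast
qed

lemma tdeg_mult: assumes "F \<noteq> 0" "G \<noteq> 0" shows "tdeg (F * G) = tdeg F + tdeg G"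
proof -
  have "exact_tdeg (int (tdeg F) + int (tdeg G)) (F * G)"
    by (rule exact_tdeg_mult[OF exact_tdeg_tdeg[OF assms(1)] exact_tdeg_tdeg[OF assms(2)]])
  moreover have "exact_tdeg (int (tdeg (F * G))) (F * G)" using assms by (intro exact_tdeg_tdeg) simp
  ultimately have "int (tdeg F) + int (tdeg G) = int (tdeg (F * G))" by (rule exact_tdeg_unique)
  then show ?thesis by simp
qed

lemma in_tpolys_tdeg: "F \<noteq> 0 \<Longrightarrow> F \<in> tpolys (int (tdeg F))"
  using exact_tdeg_tdeg unfolding exact_tdeg_def by blast

lemma tdeg_0_unit: assumes "F \<noteq> 0" "tdeg F = 0" shows "F dvd 1"
proof -
  have F0: "F \<in> tpolys 0" using in_tpolys_tdeg[OF assms(1)] assms(2) by simp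
  have ceq: "coeff (coeff F i) j = coeff (coeff [:[:coeff (coeff F 0) 0:]:] i) j" for i j
    using tpolysD[OF F0, of i j] by (cases i; cases j) auto
  then have F_eq: "F = [:[:coeff (coeff F 0) 0:]:]" by (intro poly_eqI ceq)
  define c where "c = coeff (coeff F 0) 0"
  have "c \<noteq> 0" using F_eq assms(1) unfolding c_def by auto
  then have "[:[:c:]:] * [:[:inverse c:]:] = 1" by simp
  then have "1 = F * [:[:inverse c:]:]" using F_eq unfolding c_def[symmetric] by metis
  then show ?thesis by (rule dvdI)
qed

text \<open>D is a common divisor of W of largest total degree. The quotient W0 then contains two
  polynomials without common factor, and on a general line their multiples fill a whole degree.
  Hence Q divides the restriction of D, and degree counts in both directions fix the
  degrees.\<close>

theorem common_factor_of_generic_restriction: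
  fixes W :: "'k::field_char_0 poly poly set"
  assumes W: "VR.subspace W" "W \<subseteq> tpolys j" and c: "0 \<le> c" "c \<le> j"
    and gen: "generic (\<lambda>a b. \<exists>Q. restr a b ` W = (*) Q ` upolys (j - c))"
  obtains D where "D \<in> tpolys c" "W \<subseteq> (*) D ` tpolys (j - c)"
proof (cases "W = {0}")
  case True
  have "(0 :: 'k poly poly) = 0 * 0" by simp
  then have "W \<subseteq> (*) 0 ` tpolys (j - c)" unfolding True using tpolys_0 by blast
  then show ?thesis using that tpolys_0 by blast
next
  case False
  then obtain F0 where F0: "F0 \<in> W" "F0 \<noteq> 0" using VR.subspace_0[OF W(1)] by blast
  have "\<exists>D. (D \<noteq> 0 \<and> (\<forall>F\<in>W. D dvd F)) \<and> (\<forall>E. E \<noteq> 0 \<and> (\<forall>F\<in>W. E dvd F) \<longrightarrow> tdeg E \<le> tdeg D)"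
  proof (rule ex_has_greatest_nat[where b = "Suc (tdeg F0)"])
    show "1 \<noteq> (0 :: 'k poly poly) \<and> (\<forall>F\<in>W. 1 dvd F)" by simp
    show "\<forall>E. E \<noteq> 0 \<and> (\<forall>F\<in>W. E dvd F) \<longrightarrow> tdeg E < Suc (tdeg F0)"
    proof (intro allI impI, elim conjE)
      fix E :: "'k poly poly" assume E: "E \<noteq> 0" "\<forall>F\<in>W. E dvd F"
      then obtain H where H: "F0 = E * H" using F0(1) by blast
      then have "H \<noteq> 0" using F0(2) by auto
      then show "tdeg E < Suc (tdeg F0)" using tdeg_mult[OF E(1)] H by simp
    qed
  qed
  then obtain D where D: "D \<noteq> 0" "\<forall>F\<in>W. D dvd F"
    and Dmax: "\<And>E. E \<noteq> 0 \<Longrightarrow> (\<forall>F\<in>W. E dvd F) \<Longrightarrow> tdeg E \<le> tdeg D" by blast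
  define W0 where "W0 = {G. D * G \<in> W}"
  have W0: "VR.subspace W0"
  proof (rule VR.subspaceI)
    show "0 \<in> W0" unfolding W0_def using VR.subspace_0[OF W(1)] by simp
    fix x y c assume "x \<in> W0"
    then show "scaleP c x \<in> W0" unfolding W0_def
      using VR.subspace_scale[OF W(1), of "D * x" c] by (simp add: scaleP_mult)
    assume "y \<in> W0"
    then show "x + y \<in> W0" unfolding W0_def
      using VR.subspace_add[OF W(1), of "D * x" "D * y"] \<open>x \<in> W0\<close> by (simp add: distrib_left W0_def)
  qed
  have WD: "W = (*) D ` W0"
  proof (intro subset_antisym subsetI)
    fix F assume F: "F \<in> W"
    then obtain G where "F = D * G" using D(2) by blast
    then show "F \<in> (*) D ` W0" using F unfolding W0_def by blast
  qed (auto simp: W0_def)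
  obtain G0 where G0: "G0 \<in> W0" "F0 = D * G0" using F0(1) WD by blast
  have bd: "tdeg G < Suc (nat j)" if "G \<in> W0" "G \<noteq> 0" for G
  proof -
    have "D * G \<in> tpolys j" using that W(2) unfolding W0_def by blast
    then have "int (tdeg (D * G)) \<le> j" using D(1) that(2) by (intro tdeg_le) simp
    then show ?thesis using tdeg_mult[OF D(1) that(2)] by linarith
  qed
  have "\<exists>F. (F \<in> W0 \<and> F \<noteq> 0) \<and> (\<forall>G. G \<in> W0 \<and> G \<noteq> 0 \<longrightarrow> tdeg G \<le> tdeg F)"
  proof (rule ex_has_greatest_nat[where b = "Suc (nat j)"])
    show "G0 \<in> W0 \<and> G0 \<noteq> 0" using G0 F0(2) by auto
  qed (use bd in blast)
  then obtain F where F: "F \<in> W0" "F \<noteq> 0" and Fmax: "\<And>G. G \<in> W0 \<Longrightarrow> G \<noteq> 0 \<Longrightarrow> tdeg G \<le> tdeg F" by blast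
  define n where "n = int (tdeg F)"
  have exF: "exact_tdeg n F" unfolding n_def by (rule exact_tdeg_tdeg[OF F(2)])
  have W0n: "G \<in> tpolys n" if "G \<in> W0" for G
  proof (cases "G = 0")
    case False
    then have "int (tdeg G) \<le> n" using Fmax[OF that] unfolding n_def by simp
    then show ?thesis using in_tpolys_tdeg[OF False] tpolys_mono[of "int (tdeg G)" n] by blast
  qed (simp add: tpolys_0)
  obtain A u where A: "\<forall>p\<in>#A. prime_elem p" "u dvd 1" "F = u * prod_mset A"
    by (rule prime_factorization_ex[OF F(2)])
  obtain ps where ps: "mset ps = A" using ex_mset by blast
  have "\<exists>H\<in>W0. \<not> p dvd H" if "p \<in> set ps" for p
  proof (rule ccontr)
    assume "\<not> ?thesis"
    then have all: "\<forall>H\<in>W0. p dvd H" by blast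
    have pp: "prime_elem p" using A(1) that ps by auto
    then have p0: "p \<noteq> 0" by (rule prime_elem_not_zeroI)
    have "\<forall>H\<in>W. D * p dvd H" unfolding WD using all by (auto intro: mult_dvd_mono)
    then have "tdeg (D * p) \<le> tdeg D" using Dmax[of "D * p"] D(1) p0 by simp
    then have "tdeg p = 0" using tdeg_mult[OF D(1) p0] by simp
    then have "p dvd 1" by (rule tdeg_0_unit[OF p0])
    then show False using pp by (simp add: prime_elem_def)
  qed
  then obtain G where G: "G \<in> W0" "\<forall>p\<in>set ps. \<not> p dvd G" using avoid_primes[OF W0] by blast
  have cop: "F dvd v" if "F dvd G * v" for v
  proof -
    have "u * prod_mset A dvd G * v" using that unfolding A(3) .
    then have dv: "prod_mset A dvd G * v" by (rule dvd_mult_right)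
    have "\<forall>p\<in>#A. prime_elem p \<and> \<not> p dvd G" using A(1) G(2) unfolding ps[symmetric] by simp
    from coprime_cancel[OF this dv] obtain k where k: "v = prod_mset A * k" by (rule dvdE)
    obtain u' where "1 = u * u'" using A(2) by (rule dvdE)
    then have "v = u * u' * (prod_mset A * k)" using k by simp
    then have "v = F * (u' * k)" unfolding A(3) by (simp only: mult_ac)
    then show ?thesis by (rule dvdI)
  qed
  define N where "N = n * n + 2 * n"
  have n0: "0 \<le> n" unfolding n_def by simp
  then have N0: "0 \<le> N" unfolding N_def by simp
  have g1: "generic (\<lambda>a b. restr a b ` sumset ((*) F ` tpolys (N - n)) ((*) G ` tpolys (N - n)) = upolys N)"
    unfolding N_def by (rule coprime_pair_generic[OF exF W0n[OF G(1)] cop])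
  obtain a b where ab: "restr a b ` sumset ((*) F ` tpolys (N - n)) ((*) G ` tpolys (N - n)) = upolys N
    \<and> (\<exists>Q. restr a b ` W = (*) Q ` upolys (j - c)) \<and> restr a b D \<noteq> 0"
    by (rule generic_ex[OF generic_conj[OF g1 generic_conj[OF gen generic_restr_nonzero[OF D(1)]]]])
  note full = conjunct1[OF ab] and D0 = conjunct2[OF conjunct2[OF ab]]
  from conjunct1[OF conjunct2[OF ab]] obtain Q where Q: "restr a b ` W = (*) Q ` upolys (j - c)" by blast
  have mult: "\<exists>e\<in>upolys (j - c + (N - n)). restr a b D * f = Q * e" if f: "f \<in> upolys N" for f
  proof -
    obtain u v where uv: "u \<in> tpolys (N - n)" "v \<in> tpolys (N - n)" "f = restr a b (F * u + G * v)"
      using f unfolding full[symmetric] by (auto elim!: sumsetE)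
    have "D * F \<in> W" "D * G \<in> W" using F(1) G(1) unfolding W0_def by auto
    then have "restr a b (D * F) \<in> (*) Q ` upolys (j - c)" "restr a b (D * G) \<in> (*) Q ` upolys (j - c)"
      unfolding Q[symmetric] by blast+
    then obtain e1 e2 where e: "e1 \<in> upolys (j - c)" "restr a b (D * F) = Q * e1"
      "e2 \<in> upolys (j - c)" "restr a b (D * G) = Q * e2" by blast
    have "restr a b D * f = restr a b (D * F) * restr a b u + restr a b (D * G) * restr a b v"
      unfolding uv(3) by (simp add: restr_add restr_mult algebra_simps)
    also have "\<dots> = Q * (e1 * restr a b u + e2 * restr a b v)" unfolding e by (simp add: algebra_simps)
    finally have "restr a b D * f = Q * (e1 * restr a b u + e2 * restr a b v)" .
    moreover have "e1 * restr a b u + e2 * restr a b v \<in> upolys (j - c + (N - n))"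
      by (intro upolys_add upolys_mult e restr_tpolys uv)
    ultimately show ?thesis by blast
  qed
  \<comment> \<open>The choice f = 1 shows that Q divides the restricted D, with cofactor r. The
    choice f = x^N bounds deg r + N by j - c + N - n, which gives n <= j - c.\<close>
  have "1 \<in> (upolys N :: 'k poly set)" using N0 by (simp add: upolys_iff)
  then obtain r where r: "r \<in> upolys (j - c + (N - n))" "restr a b D = Q * r" using mult[of 1] by auto
  have "monom 1 (nat N) \<in> (upolys N :: 'k poly set)" using N0 by (simp add: upolys_iff degree_monom_eq)
  then obtain r1 where r1: "r1 \<in> upolys (j - c + (N - n))" "restr a b D * monom 1 (nat N) = Q * r1"
    using mult by blast
  have nz: "Q \<noteq> 0" "r \<noteq> 0" using r(2) D0 by auto
  have "Q * r1 = Q * (r * monom 1 (nat N))" using r1(2)[symmetric] unfolding r(2) mult.assoc .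
  then have r1_eq: "r1 = r * monom 1 (nat N)" using nz(1) by simp
  have mz: "monom (1::'k) (nat N) \<noteq> 0" by (simp add: monom_eq_0_iff)
  have "degree r1 = degree r + nat N"
    unfolding r1_eq using degree_mult_eq[OF nz(2) mz] by (simp add: degree_monom_eq)
  moreover have "r1 \<noteq> 0" unfolding r1_eq using nz(2) mz by simp
  ultimately have "N \<le> j - c + (N - n)" using r1(1) N0 unfolding upolys_iff by auto
  then have nle: "n \<le> j - c" by simp
  \<comment> \<open>For the converse, W0 restricts into degree at most n with dimension j - c + 1,
    so j - c <= n. Since D F has degree at most j and F has degree n = j - c, the degree of D is at
    most c.\<close>
  have "restr a b ` W = (*) (restr a b D) ` (restr a b ` W0)"
    unfolding WD image_image restr_mult ..
  moreover have sW0: "VX.subspace (restr a b ` W0)" by (rule subspace_restr[OF W0])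
  moreover have rW0: "restr a b ` W0 \<subseteq> upolys n" using W0n by (intro restr_in_upolys) blast
  ultimately have "VX.dim (restr a b ` W) = VX.dim (restr a b ` W0)"
    using dim_mult_u[OF _ fin_dim_in_upolys D0] by metis
  moreover have "VX.dim (restr a b ` W0) \<le> VX.dim (upolys n :: 'k poly set)"
    by (rule VX.dim_mono_fdim[OF fin_dim_upolys rW0])
  moreover have "VX.dim (restr a b ` W) = VX.dim (upolys (j - c) :: 'k poly set)"
    unfolding Q by (rule dim_mult_u[OF subspace_upolys fin_dim_upolys nz(1)])
  ultimately have "j - c \<le> n"
    using dim_upolys[of n, where 'k='k] dim_upolys[of "j - c", where 'k='k] n0 c(2) by linarith
  then have nj: "n = j - c" using nle by simp
  have "D * F \<in> tpolys j" using F(1) W(2) unfolding W0_def by blast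
  then have "int (tdeg (D * F)) \<le> j" using D(1) F(2) by (intro tdeg_le) simp
  then have "int (tdeg D) \<le> c" using tdeg_mult[OF D(1) F(2)] nj unfolding n_def by simp
  then have "D \<in> tpolys c" using in_tpolys_tdeg[OF D(1)] tpolys_mono[of "int (tdeg D)" c] by blast
  moreover have "W \<subseteq> (*) D ` tpolys (j - c)" unfolding WD using W0n nj by blast
  ultimately show ?thesis by (rule that)
qed

section \<open>Gorenstein ideals of linear functionals\<close>

abbreviation vx :: "'k::field poly poly" where "vx \<equiv> [:ux:]"

lemma vx_in: "vx \<in> tpolys 1"
  unfolding tpolys_const by (simp add: upolys_iff)

text \<open>The constant 1 is the dehomogenised third variable; together with \<open>vx\<close> and
  any \<open>line a b\<close> it spans the linear forms. These generate every form of positive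
  degree.\<close>

lemma tpolys_decompose:
  fixes G :: "'k::field poly poly"
  assumes G: "G \<in> tpolys d" and d: "1 \<le> d"
  obtains G0 G1 G2 where "G0 \<in> tpolys (d - 1)" "G1 \<in> tpolys (d - 1)" "G2 \<in> tpolys (d - 1)"
    "G = G0 + vx * G1 + line a b * G2"
proof -
  define f where "f = restr a b G"
  have fd: "f \<in> upolys d" unfolding f_def by (rule restr_tpolys[OF G])
  have "G - [:f:] \<in> tpolys d" using fd G tpolys_const tpolys_diff by blast
  moreover have "restr a b (G - [:f:]) = 0" unfolding restr_diff restr_const f_def by simp
  ultimately obtain G2 where G2: "G2 \<in> tpolys (d - 1)" "G - [:f:] = line a b * G2" by (rule restr_eq_0_tpolys)
  obtain c q where cq: "f = pCons c q" by (rule pCons_cases[of f])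
  have q: "q \<in> upolys (d - 1)" using fd unfolding cq upolys_iff by (cases "q = 0") auto
  have c: "[:c:] \<in> upolys (d - 1)" using d by (simp add: upolys_iff)
  have "f = [:c:] + ux * q" unfolding cq by simp
  then have "[:f:] = [:[:c:]:] + vx * [:q:]" by simp
  then have "G = [:[:c:]:] + vx * [:q:] + line a b * G2" using G2(2) by (metis diff_add_cancel add.commute)
  then show ?thesis using that[of "[:[:c:]:]" "[:q:]" G2] q c G2(1) tpolys_const by blast
qed

lemma pdim_tpolys_step: assumes "- 2 \<le> d"
  shows "pdim (tpolys (d + 1) :: 'k::field poly poly set) = pdim (tpolys d :: 'k poly poly set) + d + 2"
proof -
  have "2 * pdim (tpolys (d + 1) :: 'k poly poly set) = (d + 1 + 1) * (d + 1 + 2)"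
    by (rule dim_tpolys) (use assms in simp)
  moreover have "2 * pdim (tpolys d :: 'k poly poly set) = (d + 1) * (d + 2)" by (rule dim_tpolys[OF assms])
  moreover have "x = y + d + 2" if "2 * x = (d + 1 + 1) * (d + 1 + 2)" "2 * y = (d + 1) * (d + 2)" for x y :: int
    using that by (simp add: algebra_simps)
  ultimately show ?thesis by blast
qed

text \<open>A general line attains the maximum over all lines. \<open>tangent\<close> exploits this:
  at such a line no deformation can increase the dimension.\<close>

lemma colsum_dim_max:
  fixes U :: "'k::field_char_0 poly poly set"
  assumes U: "VR.subspace U" "fin_dim scaleP U" "U \<subseteq> tpolys d'"
    and sub: "\<And>a b. colsum U n (line a b) d \<subseteq> tpolys d'"
  shows "generic (\<lambda>a b. \<forall>a' b'. VR.dim (colsum U n (line a' b') d) \<le> VR.dim (colsum U n (line a b) d))"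
proof -
  have "\<exists>x. True \<and> (\<forall>y. True \<longrightarrow> VR.dim (colsum U n (line (fst y) (snd y)) d) \<le> VR.dim (colsum U n (line (fst x) (snd x)) d))"
  proof (rule ex_has_greatest_nat[where k = "(0, 0)" and b = "Suc (VR.dim (tpolys d' :: 'k poly poly set))"])
    show "\<forall>y. True \<longrightarrow> VR.dim (colsum U n (line (fst y) (snd y)) d) < Suc (VR.dim (tpolys d' :: 'k poly poly set))"
      using VR.dim_mono_fdim[OF fin_dim_tpolys sub] by (simp add: less_Suc_eq_le)
  qed simp
  then obtain x where x: "\<And>y. VR.dim (colsum U n (line (fst y) (snd y)) d) \<le> VR.dim (colsum U n (line (fst x) (snd x)) d)"
    by blast
  have "generic (\<lambda>a b. VR.dim (colsum U n (line (fst x) (snd x)) d) \<le> VR.dim (colsum U n (line a b) d))"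
    by (rule colsum_dim_semicontinuous[OF U(1,2) order_refl])
  then show ?thesis
  proof (rule generic_mono, intro allI)
    fix a b a' b'
    assume "VR.dim (colsum U n (line (fst x) (snd x)) d) \<le> VR.dim (colsum U n (line a b) d)"
    moreover have "VR.dim (colsum U n (line a' b') d) \<le> VR.dim (colsum U n (line (fst x) (snd x)) d)"
      using x[of "(a', b')"] by simp
    ultimately show "VR.dim (colsum U n (line a' b') d) \<le> VR.dim (colsum U n (line a b) d)" by simp
  qed
qed

lemma rdim_max:
  fixes W :: "'k::field_char_0 poly poly set"
  assumes W: "VR.subspace W" "W \<subseteq> tpolys d" and d: "0 \<le> d"
  obtains r where "generic (\<lambda>a b. rdim a b W = r)"
proof -
  have "\<exists>x. True \<and> (\<forall>y. True \<longrightarrow> VX.dim (restr (fst y) (snd y) ` W) \<le> VX.dim (restr (fst x) (snd x) ` W))"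
  proof (rule ex_has_greatest_nat[where k = "(0, 0)" and b = "Suc (VX.dim (upolys d :: 'k poly set))"])
    show "\<forall>y. True \<longrightarrow> VX.dim (restr (fst y) (snd y) ` W) < Suc (VX.dim (upolys d :: 'k poly set))"
      using VX.dim_mono_fdim[OF fin_dim_upolys restr_in_upolys[OF W(2)]] by (simp add: less_Suc_eq_le)
  qed simp
  then obtain x where x: "\<And>y. VX.dim (restr (fst y) (snd y) ` W) \<le> VX.dim (restr (fst x) (snd x) ` W)"
    by blast
  have "generic (\<lambda>a b. rdim (fst x) (snd x) W \<le> rdim a b W)"
    by (rule rdim_semicontinuous[OF W order_refl])
  then have "generic (\<lambda>a b. rdim a b W = rdim (fst x) (snd x) W)"
  proof (rule generic_mono)
    fix a b assume "rdim (fst x) (snd x) W \<le> rdim a b W"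
    moreover have "rdim a b W \<le> rdim (fst x) (snd x) W" using x[of "(a, b)"] by simp
    ultimately show "rdim a b W = rdim (fst x) (snd x) W" by simp
  qed
  then show ?thesis by (rule that)
qed

lemma power_line_exact: "exact_tdeg (int i) (line a b ^ i)"
proof (induction i)
  case 0
  have "1 \<in> (tpolys 0 :: 'a poly poly set)" by (rule one_in_tpolys) simp
  moreover have "(tpolys (- 1) :: 'a poly poly set) = {0}" by (rule tpolys_neg) simp
  then have "1 \<notin> (tpolys (- 1) :: 'a poly poly set)" by simp
  ultimately show ?case unfolding exact_tdeg_def by simp
next
  case (Suc i)
  then show ?case using exact_tdeg_mult[OF exact_line Suc.IH, of a b] by simp
qed

lemma power_line_dvd_cancel:
  assumes "restr a b q \<noteq> 0" "line a b ^ i dvd q * u" shows "line a b ^ i dvd u"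
  using assms(2)
proof (induction i arbitrary: u)
  case (Suc i)
  have d: "line a b * line a b ^ i dvd q * u" using Suc.prems by simp
  have "line a b dvd q * u" by (rule dvd_mult_left[OF d])
  then have "restr a b q * restr a b u = 0" unfolding restr_eq_0[symmetric] restr_mult .
  then have "restr a b u = 0" using assms(1) by simp
  then have "line a b dvd u" unfolding restr_eq_0 .
  then obtain w where w: "u = line a b * w" by (rule dvdE)
  obtain k where "q * u = line a b * line a b ^ i * k" using d by (rule dvdE)
  then have "line a b * (q * w) = line a b * (line a b ^ i * k)"
    unfolding w by (simp only: mult.assoc mult.left_commute)
  then have "q * w = line a b ^ i * k" using line_nonzero mult_left_cancel by blast
  then have "line a b ^ i dvd q * w" by (rule dvdI)
  then have "line a b ^ i dvd w" by (rule Suc.IH)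
  then show ?case unfolding w power_Suc by (rule mult_dvd_mono[OF dvd_refl])
qed simp

text \<open>The directions \<open>vx\<close> and 1 change the slope and the intercept of the line.
  If either product lay outside, \<open>colsum_dim_jump\<close> would yield a line of larger
  dimension.\<close>

lemma tangent:
  fixes U :: "'k::field_char_0 poly poly set"
  assumes U: "VR.subspace U" "fin_dim scaleP U"
    and max: "\<forall>a' b'. VR.dim (colsum U n (line a' b') d) \<le> VR.dim (colsum U n (line a b) d)"
    and g: "g \<in> tpolys d" "line a b ^ n * g \<in> U" and n: "0 < n"
  shows "line a b ^ (n - 1) * vx * g \<in> colsum U n (line a b) d"
    and "line a b ^ (n - 1) * 1 * g \<in> colsum U n (line a b) d"
proof -
  have e1: "line a b - [:[:\<epsilon>:]:] * vx = line (a + \<epsilon>) b" for \<epsilon> by (simp add: line_def)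
  have e2: "line a b - [:[:\<epsilon>:]:] * 1 = line a (b + \<epsilon>)" for \<epsilon> by (simp add: line_def)
  show "line a b ^ (n - 1) * vx * g \<in> colsum U n (line a b) d"
  proof (rule ccontr)
    assume "\<not> ?thesis"
    then obtain \<epsilon> where "VR.dim (colsum U n (line a b) d) < VR.dim (colsum U n (line a b - [:[:\<epsilon>:]:] * vx) d)"
      by (rule colsum_dim_jump[OF U g n])
    then show False using max unfolding e1 by (meson not_le)
  qed
  show "line a b ^ (n - 1) * 1 * g \<in> colsum U n (line a b) d"
  proof (rule ccontr)
    assume "\<not> ?thesis"
    then obtain \<epsilon> where "VR.dim (colsum U n (line a b) d) < VR.dim (colsum U n (line a b - [:[:\<epsilon>:]:] * 1) d)"
      by (rule colsum_dim_jump[OF U g n])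
    then show False using max unfolding e2 by (meson not_le)
  qed
qed

locale graded_functional =
  fixes \<phi> :: "'k::field_char_0 poly poly \<Rightarrow> 'k" and e :: int
  assumes \<phi>_add: "\<phi> (F + G) = \<phi> F + \<phi> G"
    and \<phi>_scale: "\<phi> (scaleP c F) = c * \<phi> F"
begin

text \<open>The degree j part of the ideal, as the radical of the pairing with degree e - j. Above e
  the partner is the zero space, so every polynomial of degree at most j belongs to it.\<close>

definition gid :: "int \<Rightarrow> 'k poly poly set" where
  "gid j = {F \<in> tpolys j. \<forall>G\<in>tpolys (e - j). \<phi> (F * G) = 0}"

definition h :: "int \<Rightarrow> int" where
  "h j = pdim (tpolys j :: 'k poly poly set) - pdim (gid j)"

lemma \<phi>_0: "\<phi> 0 = 0" using \<phi>_scale[of 0 0] by simp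

lemma gid_in: "gid j \<subseteq> tpolys j" unfolding gid_def by blast

lemma gidD: "F \<in> gid j \<Longrightarrow> G \<in> tpolys (e - j) \<Longrightarrow> \<phi> (F * G) = 0" unfolding gid_def by blast

lemma subspace_gid: "VR.subspace (gid j)"
proof (rule VR.subspaceI)
  show "0 \<in> gid j" unfolding gid_def by (simp add: \<phi>_0 tpolys_0)
  fix x y c assume x: "x \<in> gid j"
  show "scaleP c x \<in> gid j" unfolding gid_def
  proof (intro CollectI conjI ballI)
    show "scaleP c x \<in> tpolys j" using x gid_in tpolys_scale by blast
    fix G :: "'k poly poly" assume "G \<in> tpolys (e - j)"
    then show "\<phi> (scaleP c x * G) = 0" using gidD[OF x] by (simp add: scaleP_mult \<phi>_scale)
  qed
  assume y: "y \<in> gid j"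
  show "x + y \<in> gid j" unfolding gid_def
  proof (intro CollectI conjI ballI)
    show "x + y \<in> tpolys j" using x y gid_in tpolys_add by blast
    fix G :: "'k poly poly" assume "G \<in> tpolys (e - j)"
    then show "\<phi> ((x + y) * G) = 0" using gidD[OF x] gidD[OF y] by (simp add: distrib_right \<phi>_add)
  qed
qed

lemma gid_mult: assumes "F \<in> gid j" "G \<in> tpolys d" shows "G * F \<in> gid (j + d)"
  unfolding gid_def
proof (intro CollectI conjI ballI)
  show "G * F \<in> tpolys (j + d)" using tpolys_mult[of F j G d] assms gid_in by (auto simp: mult.commute)
  fix H :: "'k poly poly" assume "H \<in> tpolys (e - (j + d))"
  then have "G * H \<in> tpolys (d + (e - (j + d)))" by (rule tpolys_mult[OF assms(2)])
  then have "G * H \<in> tpolys (e - j)" by simp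
  then have "\<phi> (F * (G * H)) = 0" by (rule gidD[OF assms(1)])
  then show "\<phi> (G * F * H) = 0" by (simp only: mult_ac)
qed

text \<open>The socle sits in degree e only: below it, a class killed by three linear forms that
  span all of them is zero.\<close>

lemma gid_descend:
  assumes F: "F \<in> tpolys j" "j < e" and g: "F \<in> gid (j + 1)" "vx * F \<in> gid (j + 1)" "line a b * F \<in> gid (j + 1)"
  shows "F \<in> gid j"
  unfolding gid_def
proof (intro CollectI conjI ballI)
  show "F \<in> tpolys j" by fact
  fix G :: "'k poly poly" assume "G \<in> tpolys (e - j)"
  then obtain G0 G1 G2 where G: "G0 \<in> tpolys (e - j - 1)" "G1 \<in> tpolys (e - j - 1)" "G2 \<in> tpolys (e - j - 1)"
    "G = G0 + vx * G1 + line a b * G2"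
    by (rule tpolys_decompose[of G "e - j" a b]) (use F(2) in auto)
  have ej: "e - j - 1 = e - (j + 1)" by simp
  have eq: "F * G = F * G0 + vx * F * G1 + line a b * F * G2" unfolding G(4) by (simp only: distrib_left mult_ac)
  show "\<phi> (F * G) = 0" unfolding eq \<phi>_add
    using gidD[OF g(1)] gidD[OF g(2)] gidD[OF g(3)] G(1-3) unfolding ej by simp
qed

lemma h_sym: "h (e - j) = h j"
proof -
  have r: "VR.dim (tpolys (e - j) :: 'k poly poly set) + VR.dim {u \<in> tpolys j. \<forall>w\<in>tpolys (e - j). \<phi> (u * w) = 0}
    = VR.dim (tpolys j :: 'k poly poly set) + VR.dim {w \<in> tpolys (e - j). \<forall>u\<in>tpolys j. \<phi> (u * w) = 0}"
    by (rule VR.pairing_rank[where \<beta> = "\<lambda>u w. \<phi> (u * w)"])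
      (simp_all add: subspace_tpolys fin_dim_tpolys distrib_left distrib_right \<phi>_add \<phi>_scale scaleP_mult)
  have "{u \<in> tpolys j. \<forall>w\<in>tpolys (e - j). \<phi> (u * w) = 0} = gid j" unfolding gid_def ..
  moreover have "{w \<in> tpolys (e - j). \<forall>u\<in>tpolys j. \<phi> (u * w) = 0} = gid (e - j)"
    unfolding gid_def by (simp add: mult.commute)
  ultimately show ?thesis using r unfolding h_def by simp
qed

text \<open>The residual ideal belongs to the functional \<phi>(D F). It is therefore of the same
  kind, with socle degree e - c, and symmetry and all growth bounds apply to it again.\<close>

lemma colon_gid:
  assumes D: "D \<in> tpolys c"
  shows "colon (gid (i + c)) D i = graded_functional.gid (\<lambda>F. \<phi> (D * F)) (e - c) i"
proof -
  interpret D: graded_functional "\<lambda>F. \<phi> (D * F)" "e - c"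
    by unfold_locales (simp_all add: distrib_left \<phi>_add \<phi>_scale scaleP_mult)
  have ei: "e - (i + c) = e - c - i" by simp
  have "D * G \<in> tpolys (i + c)" if "G \<in> tpolys i" for G
    using tpolys_mult[OF D that] by (simp add: add.commute)
  then show ?thesis unfolding colon_def gid_def D.gid_def ei by (auto simp: mult.assoc)
qed

lemma graded_functional_mult: "graded_functional (\<lambda>F. \<phi> (D * F))"
  by unfold_locales (simp_all add: distrib_left \<phi>_add \<phi>_scale scaleP_mult)

section \<open>Kernel and cokernel of multiplication by a line\<close>

abbreviation \<beta> :: "'k \<Rightarrow> 'k \<Rightarrow> int \<Rightarrow> int" where
  "\<beta> a b j \<equiv> j + 1 - rdim a b (gid j)"

text \<open>Dimension of the kernel of multiplication by the line from degree j to j + 1 in the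
  quotient algebra; \<open>\<beta> a b j\<close> is the dimension of the cokernel of the
  multiplication that ends in degree j.\<close>

abbreviation \<kappa> :: "'k \<Rightarrow> 'k \<Rightarrow> int \<Rightarrow> int" where
  "\<kappa> a b j \<equiv> pdim (colon (gid (j + 1)) (line a b) j) - pdim (gid j)"

lemma \<beta>_nonneg: "- 1 \<le> j \<Longrightarrow> 0 \<le> \<beta> a b j"
  using rdim_le[OF gid_in, of j a b] by simp

lemma colon_line: "pdim (tpolys j :: 'k poly poly set) - pdim (colon (gid (j + 1)) (line a b) j) = h (j + 1) - \<beta> a b (j + 1)"
  if "- 2 \<le> j"
  using colon_rank[OF subspace_gid gid_in, of j a b] pdim_tpolys_step[OF that, where 'k='k]
  unfolding h_def by linarith

lemma \<kappa>_eq: "- 2 \<le> j \<Longrightarrow> \<kappa> a b j = h j - h (j + 1) + \<beta> a b (j + 1)"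
  using colon_line[of j a b] unfolding h_def by linarith

text \<open>Multiplication by the line is self-adjoint for the pairing, so its kernel in degree j is
  dual to its cokernel in degree e - j. Numerically this is the symmetry of the Hilbert function of
  the residual ideal, of socle degree e - 1.\<close>

lemma \<kappa>_dual: assumes "- 2 \<le> j" "j \<le> e + 1" shows "\<kappa> a b j = \<beta> a b (e - j)"
proof -
  interpret L: graded_functional "\<lambda>F. \<phi> (line a b * F)" "e - 1" by (rule graded_functional_mult)
  have L: "L.h i = h (i + 1) - \<beta> a b (i + 1)" if "- 2 \<le> i" for i
    using colon_line[OF that, of a b] unfolding L.h_def colon_gid[OF line_in] .
  have "L.h (e - 1 - j) = L.h j" by (rule L.h_sym)
  moreover have "L.h (e - 1 - j) = h (e - j) - \<beta> a b (e - j)" using L[of "e - 1 - j"] assms(2) by simp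
  moreover have "h (e - j) = h j" by (rule h_sym)
  moreover have "\<kappa> a b j = h j - L.h j"
    using L[OF assms(1)] \<kappa>_eq[OF assms(1), of a b] by simp
  ultimately show ?thesis by simp
qed

lemma colon_lower: "gid j \<subseteq> colon (gid (j + 1)) (line a b) j"
  unfolding colon_def using gid_in gid_mult[OF _ line_in] by blast

lemma \<kappa>_pos_iff: "0 < \<kappa> a b j \<longleftrightarrow> (\<exists>F\<in>tpolys j. line a b * F \<in> gid (j + 1) \<and> F \<notin> gid j)"
proof
  assume p: "0 < \<kappa> a b j"
  have "\<not> colon (gid (j + 1)) (line a b) j \<subseteq> gid j"
  proof
    assume "colon (gid (j + 1)) (line a b) j \<subseteq> gid j"
    from pdim_mono[OF this gid_in] show False using p by simp
  qed
  then show "\<exists>F\<in>tpolys j. line a b * F \<in> gid (j + 1) \<and> F \<notin> gid j" unfolding colon_def by blast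
next
  assume "\<exists>F\<in>tpolys j. line a b * F \<in> gid (j + 1) \<and> F \<notin> gid j"
  then have "gid j \<subset> colon (gid (j + 1)) (line a b) j" using colon_lower[of j a b] unfolding colon_def by blast
  then have "VR.dim (gid j) < VR.dim (colon (gid (j + 1)) (line a b) j)"
    by (rule VR.dim_strict_fdim[OF fin_dim_in_tpolys[OF colon_in_tpolys] subspace_gid])
  then show "0 < \<kappa> a b j" by simp
qed

lemma \<kappa>_nonneg: "0 \<le> \<kappa> a b j"
  using pdim_mono[OF colon_lower colon_in_tpolys, of j a b] by simp

text \<open>The line kills a kernel element F. If 1 and \<open>vx\<close> killed it too,
  \<open>gid_descend\<close> would make it zero, so one of these two products is a nonzero kernel
  element in the next degree.\<close>

lemma \<kappa>_step: assumes "0 < \<kappa> a b i" "i < e" shows "0 < \<kappa> a b (i + 1)"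
proof -
  obtain F where F: "F \<in> tpolys i" "line a b * F \<in> gid (i + 1)" "F \<notin> gid i"
    using assms(1) unfolding \<kappa>_pos_iff by blast
  have "\<exists>w\<in>{1, vx}. w * F \<notin> gid (i + 1)"
    using gid_descend[OF F(1) assms(2) _ _ F(2)] F(3) by auto
  then obtain w where w: "w \<in> {1, vx}" "w * F \<notin> gid (i + 1)" by blast
  have w1: "w \<in> tpolys 1" using w(1) vx_in one_in_tpolys[of 1] by auto
  have "w * F \<in> tpolys (1 + i)" by (rule tpolys_mult[OF w1 F(1)])
  then have "w * F \<in> tpolys (i + 1)" by (simp add: add.commute)
  moreover have "w * (line a b * F) \<in> gid (i + 1 + 1)" by (rule gid_mult[OF F(2) w1])
  then have "line a b * (w * F) \<in> gid (i + 1 + 1)" by (simp only: mult.left_commute)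
  ultimately show ?thesis unfolding \<kappa>_pos_iff using w(2) by blast
qed

lemma \<kappa>_propagates: assumes "0 < \<kappa> a b i" "i \<le> j" "j \<le> e" shows "0 < \<kappa> a b j"
  using assms(2,3)
proof (induction j rule: int_ge_induct)
  case base then show ?case using assms(1) by simp
next
  case (step j)
  then have "0 < \<kappa> a b j" by simp
  then show ?case by (rule \<kappa>_step) (use step in simp)
qed

lemma restr_gid_xhull: "xhull (restr a b ` gid j) \<subseteq> restr a b ` gid (j + 1)"
proof (rule xhull_least[OF subspace_restr[OF subspace_gid]])
  have "F \<in> gid (j + 1)" if "F \<in> gid j" for F using gid_mult[OF that one_in_tpolys[of 1]] by simp
  then show "restr a b ` gid j \<subseteq> restr a b ` gid (j + 1)" by blast
  have "ux * restr a b F = restr a b (vx * F)" for F by (simp only: restr_mult restr_const)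
  then show "(*) ux ` restr a b ` gid j \<subseteq> restr a b ` gid (j + 1)" using gid_mult[OF _ vx_in] by auto
qed

lemma restr_gid_in: "restr a b ` gid j \<subseteq> upolys j"
  by (rule restr_in_upolys[OF gid_in])

lemma restr_gid_nonzero: assumes "\<beta> a b j \<le> j" shows "restr a b ` gid j \<noteq> {0}"
proof
  assume "restr a b ` gid j = {0}"
  then show False using assms by simp
qed

lemma \<beta>_step: assumes "\<beta> a b j \<le> j" shows "\<beta> a b (j + 1) \<le> \<beta> a b j"
proof -
  have "VX.dim (restr a b ` gid j) + 1 \<le> VX.dim (xhull (restr a b ` gid j))"
    by (rule xhull_grows[OF subspace_restr[OF subspace_gid] restr_gid_in restr_gid_nonzero[OF assms]])
  also have "\<dots> \<le> VX.dim (restr a b ` gid (j + 1))"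
    by (rule VX.dim_mono_fdim[OF fin_dim_in_upolys[OF restr_gid_in] restr_gid_xhull])
  finally show ?thesis by simp
qed

lemma \<beta>_antimono: assumes "\<beta> a b i \<le> i" "i \<le> j" shows "\<beta> a b j \<le> \<beta> a b i"
  using assms(2)
proof (induction j rule: int_ge_induct)
  case (step j)
  then have "\<beta> a b j \<le> j" using assms(1) by linarith
  from \<beta>_step[OF this] show ?case using step.IH by linarith
qed simp

text \<open>Equal codimensions mean growth of the dimension by exactly one, the extremal case for
  \<open>xhull\<close>. The degree of Q is at most c, and smaller if the common factor vanishes at
  infinity on the line.\<close>

lemma \<beta>_stationary:
  assumes "\<beta> a b j = c" "\<beta> a b (j + 1) = c" "c \<le> j"
  obtains Q where "restr a b ` gid j = (*) Q ` upolys (j - c)" "restr a b ` gid (j + 1) = (*) Q ` upolys (j + 1 - c)"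
proof -
  let ?V = "restr a b ` gid j" and ?W = "restr a b ` gid (j + 1)"
  have V: "VX.subspace ?V" by (rule subspace_restr[OF subspace_gid])
  have "?V \<noteq> {0}" by (rule restr_gid_nonzero) (use assms in simp)
  then have g: "VX.dim ?V + 1 \<le> VX.dim (xhull ?V)" by (rule xhull_grows[OF V restr_gid_in])
  have le: "VX.dim (xhull ?V) \<le> VX.dim ?W"
    by (rule VX.dim_mono_fdim[OF fin_dim_in_upolys[OF restr_gid_in] restr_gid_xhull])
  have dW: "VX.dim ?W = VX.dim ?V + 1" using assms(1,2) by linarith
  have eq: "xhull ?V = ?W"
    by (rule VX.subspace_eq_fdim[OF fin_dim_in_upolys[OF restr_gid_in] subspace_xhull[OF V] restr_gid_xhull])
      (use g dW in simp)
  have hull: "VX.dim (xhull ?V) = VX.dim ?V + 1" using eq dW by simp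
  obtain Q where Q: "?V = (*) Q ` upolys (int (VX.dim ?V) - 1)"
    by (rule xhull_minimal_growth[OF V restr_gid_in hull])
  have d: "int (VX.dim ?V) - 1 = j - c" using assms(1) by linarith
  have "xhull ((*) Q ` upolys (j - c)) = (*) Q ` upolys (j - c + 1)"
    by (rule xhull_mult_upolys) (use assms(3) in simp)
  then have "?W = (*) Q ` upolys (j - c + 1)" using eq Q unfolding d by simp
  moreover have "j - c + 1 = j + 1 - c" by simp
  ultimately show ?thesis using that Q unfolding d by simp
qed

lemma generic_\<beta>_le:
  assumes "0 \<le> c" "0 \<le> n" "2 * h n \<le> 2 * (c + 1) * n - c * (c - 1)"
  shows "generic (\<lambda>a b. \<beta> a b n \<le> c)"
proof -
  obtain m where m: "n = int m" using assms(2) by (rule nonneg_int_cases)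
  have "generic (\<lambda>a b. int m + 1 - c \<le> rdim a b (gid (int m)))"
    by (rule generic_restriction[OF subspace_gid gid_in assms(1)]) (use assms(3) in \<open>simp add: m h_def\<close>)
  then show ?thesis unfolding m by (rule generic_mono) simp
qed

text \<open>From degree n on, \<beta> <= 1 on a suitable line. The drop at i makes \<kappa> positive
  there, and positivity propagates to j, so that \<open>\<kappa>_eq\<close> gives h (j + 1) <= h j -
  1 + 1.\<close>

lemma decrease_persists:
  assumes c: "0 \<le> c" "c \<le> 1" "c \<le> n" "2 * h n \<le> 2 * (c + 1) * n - c * (c - 1)"
    and "n \<le> i" "i \<le> j" "j \<le> e" "h (i + 1) < h i"
  shows "h (j + 1) \<le> h j"
proof -
  have n: "0 \<le> n" using c by simp
  obtain a b where ab: "\<beta> a b n \<le> c" using generic_ex[OF generic_\<beta>_le[OF c(1) n c(4)]] by blast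
  have bd: "\<beta> a b k \<le> c" if "n \<le> k" for k
  proof -
    have "\<beta> a b n \<le> n" using ab c(3) by (rule order_trans)
    from \<beta>_antimono[OF this that] show ?thesis using ab by (rule order_trans)
  qed
  have "0 < \<kappa> a b i"
    using \<kappa>_eq[of i a b] \<beta>_nonneg[of "i + 1" a b] assms(5,8) n by linarith
  then have "0 < \<kappa> a b j" using assms(6,7) by (rule \<kappa>_propagates)
  then show ?thesis using \<kappa>_eq[of j a b] bd[of "j + 1"] c(2) assms(5,6) n by linarith
qed

text \<open>The case c = 0: on a general line \<beta> vanishes, so multiplication by it is
  surjective from degree n on.\<close>

lemma nonincreasing:
  assumes "0 \<le> n" "h n \<le> n" "n \<le> j" shows "h (j + 1) \<le> h j"
proof -
  have "generic (\<lambda>a b. \<beta> a b n \<le> 0)"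
    by (rule generic_\<beta>_le) (use assms(1,2) in simp_all)
  then obtain a b where ab: "\<beta> a b n \<le> 0" by (rule generic_ex)
  then have "\<beta> a b n \<le> n" using assms(1) by (rule order_trans)
  from \<beta>_antimono[OF this, of "j + 1"] have "\<beta> a b (j + 1) \<le> 0" using ab assms(3) by linarith
  then show ?thesis using \<kappa>_eq[of j a b] \<kappa>_nonneg[where a = a and b = b and j = j] assms(1,3) by linarith
qed

lemma residual_eq:
  assumes D: "D \<in> tpolys c" "D \<noteq> 0" "gid j \<subseteq> (*) D ` tpolys (j - c)"
  shows "pdim (graded_functional.gid (\<lambda>F. \<phi> (D * F)) (e - c) (j - c)) = pdim (gid j)"
proof -
  have g: "graded_functional.gid (\<lambda>F. \<phi> (D * F)) (e - c) (j - c) = colon (gid j) D (j - c)"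
    using colon_gid[OF D(1), of "j - c"] by simp
  have "gid j = (*) D ` colon (gid j) D (j - c)" using D(3) unfolding colon_def by blast
  then have "pdim (gid j) = pdim ((*) D ` colon (gid j) D (j - c))" by simp
  also have "\<dots> = pdim (colon (gid j) D (j - c))"
    using dim_mult[OF subspace_colon[OF subspace_gid] fin_dim_in_tpolys[OF colon_in_tpolys] D(2)] by simp
  finally show ?thesis unfolding g by simp
qed

text \<open>Membership of F itself bounds the degree of the cofactor by j + 1 - c only. The cofactor
  of a line times F obeys the same bound and is divisible by the line, which gains the missing
  degree.\<close>

lemma factor_descends:
  assumes "gid (j + 1) \<subseteq> (*) D ` tpolys (j + 1 - c)" "D \<noteq> 0"
  shows "gid j \<subseteq> (*) D ` tpolys (j - c)"
proof
  fix F assume F: "F \<in> gid j"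
  let ?L = "line 0 0 :: 'k poly poly"
  have "1 * F \<in> gid (j + 1)" "?L * F \<in> gid (j + 1)"
    using gid_mult[OF F one_in_tpolys[of 1]] gid_mult[OF F line_in[of 0 0]] by simp_all
  then have "F \<in> (*) D ` tpolys (j + 1 - c)" "?L * F \<in> (*) D ` tpolys (j + 1 - c)" using assms(1) by auto
  then obtain G G' where G: "F = D * G" "?L * F = D * G'" "G' \<in> tpolys (j + 1 - c)" by (elim imageE) blast
  have "D * (?L * G) = D * G'" using G(1,2) by (simp only: mult.left_commute)
  then have "G' = ?L * G" using assms(2) by simp
  then have "G \<in> tpolys (j + 1 - c - 1)" using tpolys_cancel[OF exact_line] G(3) by blast
  moreover have "j + 1 - c - 1 = j - c" by simp
  ultimately have "G \<in> tpolys (j - c)" by simp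
  then show "F \<in> (*) D ` tpolys (j - c)" unfolding G(1) by (rule imageI)
qed

end

section \<open>Injectivity in the middle degree\<close>

context graded_functional
begin

text \<open>The exceptional case: on a general line the ideal acquires a conic \<open>q\<close> in degree \<open>m\<close>, but is
  only of codimension one in degree \<open>m + 1\<close>.  If every element of the kernel \<open>K\<close> of the
  multiplication modulo \<open>q\<close> were divisible by \<open>l\<close>, then first-order deformation of \<open>l\<close> would show
  inductively that it is divisible by every power of \<open>l\<close>.\<close>

lemma conic_case:
  fixes m :: int
  assumes e: "e = 2 * m + 1" and m: "3 \<le> m" and hm: "h m \<le> 3 * m - 1"
    and gen: "generic (\<lambda>a b. \<beta> a b (m - 1) = 2 \<and> \<beta> a b m = 2 \<and> \<beta> a b (m + 1) = 1)"
  shows "generic (\<lambda>a b. \<exists>Q. restr a b ` gid (m + 1) = (*) Q ` upolys m)"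
proof -
  let ?tp = "\<lambda>d. tpolys d :: 'k poly poly set"
  have genq: "generic (\<lambda>a b. \<exists>Q. restr a b ` gid m = (*) Q ` upolys (m - 2))"
    using gen
  proof (rule generic_mono)
    fix a b assume "\<beta> a b (m - 1) = 2 \<and> \<beta> a b m = 2 \<and> \<beta> a b (m + 1) = 1"
    then have "\<beta> a b (m - 1) = 2" "\<beta> a b (m - 1 + 1) = 2" by simp_all
    then obtain Q where "restr a b ` gid (m - 1 + 1) = (*) Q ` upolys (m - 1 + 1 - 2)"
      by (rule \<beta>_stationary) (use m in simp)
    then show "\<exists>Q. restr a b ` gid m = (*) Q ` upolys (m - 2)" by auto
  qed
  obtain q where q: "q \<in> tpolys 2" "gid m \<subseteq> (*) q ` tpolys (m - 2)"
    by (rule common_factor_of_generic_restriction[OF subspace_gid gid_in _ _ genq]) (use m in simp_all)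
  obtain a0 b0 where ab0: "\<beta> a0 b0 (m - 1) = 2 \<and> \<beta> a0 b0 m = 2 \<and> \<beta> a0 b0 (m + 1) = 1"
    by (rule generic_ex[OF gen])
  have q0: "q \<noteq> 0"
  proof
    assume "q = 0"
    then have "gid m \<subseteq> {0}" using q(2) by auto
    then have "gid m = {0}" using VR.subspace_0[OF subspace_gid] by blast
    then have "restr a0 b0 ` gid m = {0}" by simp
    moreover have "restr a0 b0 ` gid m \<noteq> {0}" by (rule restr_gid_nonzero) (use ab0 m in auto)
    ultimately show False by simp
  qed
  interpret q: graded_functional "\<lambda>F. \<phi> (q * F)" "e - 2" by (rule graded_functional_mult)
  have res: "pdim (q.gid (m - 2)) = pdim (gid m)" by (rule residual_eq[OF q(1) q0 q(2)])
  have s1: "pdim (?tp (m - 1)) = pdim (?tp (m - 2)) + m"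
    using pdim_tpolys_step[of "m - 2", where 'k='k] m by simp
  have s2: "pdim (?tp m) = pdim (?tp (m - 1)) + m + 1"
    using pdim_tpolys_step[of "m - 1", where 'k='k] m by simp
  have s3: "pdim (?tp (m + 1)) = pdim (?tp m) + m + 2"
    using pdim_tpolys_step[of m, where 'k='k] m by simp
  \<comment> \<open>Dividing by the conic subtracts 2 m + 1, the difference of the ambient
    dimensions. The bound 3 m - 1 becomes m - 2, as \<open>nonincreasing\<close> requires.\<close>
  have qh: "q.h (m - 2) = h m - (2 * m + 1)"
    unfolding q.h_def h_def res using s1 s2 by simp
  have small: "q.h (m - 2) \<le> m - 2" unfolding qh using hm by simp
  have "0 \<le> m - 2" using m by simp
  note ni = q.nonincreasing[OF this small]
  \<comment> \<open>The residual symmetry pairs m - 2 with m + 1. A nonincreasing function with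
    equal values at these two degrees is constant between them.\<close>
  have "q.h (m - 2 + 1) \<le> q.h (m - 2)" "q.h (m - 1 + 1) \<le> q.h (m - 1)" "q.h (m + 1) \<le> q.h m"
    by (rule ni, simp)+
  moreover have "q.h (e - 2 - (m + 1)) = q.h (m + 1)" by (rule q.h_sym)
  moreover have "e - 2 - (m + 1) = m - 2" "m - 2 + 1 = m - 1" "m - 1 + 1 = m" using e by simp_all
  ultimately have flat: "q.h (m - 1) = q.h (m - 2)" by simp
  have hsym: "h (m + 1) = h m" using h_sym[of m] e by simp
  let ?C = "(*) q ` ?tp (m - 1)"
  \<comment> \<open>The ideal in degree m + 1, enlarged by the multiples of q. By
    \<open>flat\<close> its codimension is 2 m + 1, whatever the value of h m.\<close>
  define V where "V = sumset (gid (m + 1)) ?C"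
  have C: "VR.subspace ?C" "?C \<subseteq> tpolys (m + 1)" "pdim ?C = pdim (?tp (m - 1))"
  proof -
    show "VR.subspace ?C" by (rule subspace_mult[OF subspace_tpolys])
    have "?C \<subseteq> tpolys (m - 1 + 2)" by (rule mult_tpolys_subset[OF q(1)])
    moreover have "m - 1 + 2 = m + 1" by simp
    ultimately show "?C \<subseteq> tpolys (m + 1)" by (simp only:)
    show "pdim ?C = pdim (?tp (m - 1))" using dim_mult[OF subspace_tpolys fin_dim_tpolys q0] by simp
  qed
  have V: "VR.subspace V" "V \<subseteq> tpolys (m + 1)" "fin_dim scaleP V"
  proof -
    show "VR.subspace V" unfolding V_def by (rule VR.subspace_sumset[OF subspace_gid C(1)])
    show "V \<subseteq> tpolys (m + 1)" unfolding V_def by (rule VR.sumset_least[OF subspace_tpolys gid_in C(2)])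
    then show "fin_dim scaleP V" by (rule fin_dim_in_tpolys)
  qed
  have qV: "q * u \<in> V" if "u \<in> tpolys (m - 1)" for u
    unfolding V_def using VR.sumset_upper2[OF subspace_gid, of ?C] that by blast
  have dV: "pdim V = pdim (?tp (m + 1)) - (2 * m + 1)"
  proof -
    have "gid (m + 1) \<inter> ?C = (*) q ` colon (gid (m + 1)) q (m - 1)" unfolding colon_def by blast
    moreover have "colon (gid (m - 1 + 2)) q (m - 1) = q.gid (m - 1)" by (rule colon_gid[OF q(1)])
    moreover have "m - 1 + 2 = m + 1" by simp
    ultimately have "gid (m + 1) \<inter> ?C = (*) q ` q.gid (m - 1)" by (simp only:)
    then have "pdim (gid (m + 1) \<inter> ?C) = pdim (q.gid (m - 1))"
      using dim_mult[OF q.subspace_gid fin_dim_in_tpolys[OF q.gid_in] q0] by simp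
    moreover have "pdim V + pdim (gid (m + 1) \<inter> ?C) = pdim (gid (m + 1)) + pdim ?C"
      using VR.dim_sumset_Int[OF subspace_gid fin_dim_in_tpolys[OF gid_in] C(1) fin_dim_in_tpolys[OF C(2)]]
      unfolding V_def by (metis of_nat_add)
    moreover have "pdim (gid (m + 1)) = pdim (?tp (m + 1)) - h m" using hsym unfolding h_def by simp
    moreover have "pdim (q.gid (m - 1)) = pdim (?tp (m - 1)) - (h m - (2 * m + 1))"
      using flat qh unfolding q.h_def by simp
    ultimately show ?thesis using C(3) by simp
  qed
  have subi: "colsum V i (line a b) (m + 1 - int i) \<subseteq> tpolys (m + 1)" for i a b
  proof -
    have "(line a b ^ i) \<in> tpolys (int i)" using power_line_exact unfolding exact_tdeg_def by blast
    from mult_tpolys_subset[OF this, of "m + 1 - int i"] show ?thesis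
      unfolding colsum_def by (intro VR.sumset_least[OF subspace_tpolys V(2)]) simp
  qed
  \<comment> \<open>Maximality is needed for all exponents up to m + 1 on one and the same line,
    because the induction below runs until the power of L exceeds degree m.\<close>
  have gen2: "generic (\<lambda>a b. \<forall>i\<in>{1..nat (m + 1)}. \<forall>a' b'.
      VR.dim (colsum V i (line a' b') (m + 1 - int i)) \<le> VR.dim (colsum V i (line a b) (m + 1 - int i)))"
    by (rule generic_ball) (simp, rule colsum_dim_max[OF V(1,3,2) subi])
  show ?thesis using generic_conj[OF gen generic_conj[OF gen2 generic_restr_nonzero[OF q0]]]
  proof (rule generic_mono, elim conjE)
    fix a b
    assume b2: "\<beta> a b (m - 1) = 2" "\<beta> a b m = 2" "\<beta> a b (m + 1) = 1" and rq: "restr a b q \<noteq> 0"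
      and max: "\<forall>i\<in>{1..nat (m + 1)}. \<forall>a' b'.
        VR.dim (colsum V i (line a' b') (m + 1 - int i)) \<le> VR.dim (colsum V i (line a b) (m + 1 - int i))"
    define L where "L = line a b"
    define r where "r = restr a b q"
    have rq: "r \<noteq> 0" using rq unfolding r_def .
    have Lin: "L \<in> tpolys 1" unfolding L_def by (rule line_in)
    have Lpow: "exact_tdeg (int i) (L ^ i)" for i unfolding L_def by (rule power_line_exact)
    have Lpow_in: "L ^ i \<in> tpolys (int i)" for i using Lpow unfolding exact_tdeg_def by blast
    have tan: "L ^ (i - 1) * w * g \<in> colsum V i L (m + 1 - int i)"
      if "g \<in> tpolys (m + 1 - int i)" "L ^ i * g \<in> V" "1 \<le> i" "int i \<le> m + 1" "w \<in> {vx, 1}" for i w g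
    proof -
      have i: "i \<in> {1..nat (m + 1)}" using that(3,4) by auto
      have "0 < i" using that(3) by simp
      from tangent[OF V(1,3) bspec[OF max i] that(1) that(2)[unfolded L_def] this]
      show ?thesis using that(5) unfolding L_def by blast
    qed
    have rgm: "restr a b ` gid m = (*) r ` upolys (m - 2)"
    proof (rule VX.subspace_eq_fdim)
      show "fin_dim smult ((*) r ` upolys (m - 2))" by (rule VXX.fdim_image[OF linear_mult_u fin_dim_upolys])
      show "VX.subspace (restr a b ` gid m)" by (rule subspace_restr[OF subspace_gid])
      show "restr a b ` gid m \<subseteq> (*) r ` upolys (m - 2)"
      proof
        fix f assume "f \<in> restr a b ` gid m"
        then obtain G where "G \<in> tpolys (m - 2)" "f = restr a b (q * G)" using q(2) by blast
        then show "f \<in> (*) r ` upolys (m - 2)" unfolding restr_mult r_def using restr_tpolys by blast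
      qed
      have "VX.dim ((*) r ` upolys (m - 2)) = VX.dim (upolys (m - 2) :: 'k poly set)"
        by (rule dim_mult_u[OF subspace_upolys fin_dim_upolys rq])
      moreover have "int (VX.dim (upolys (m - 2) :: 'k poly set)) = m - 2 + 1" by (rule dim_upolys) (use m in simp)
      ultimately show "VX.dim ((*) r ` upolys (m - 2)) \<le> VX.dim (restr a b ` gid m)" using b2(2) by simp
    qed
    have "(*) r ` upolys (m - 2 + 1) = xhull ((*) r ` upolys (m - 2))"
      by (rule xhull_mult_upolys[symmetric]) (use m in simp)
    then have hull: "(*) r ` upolys (m - 1) \<subseteq> restr a b ` gid (m + 1)"
      using restr_gid_xhull[of a b m] rgm by simp
    have rV: "restr a b ` V = restr a b ` gid (m + 1)"
    proof (intro subset_antisym subsetI)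
      fix f assume "f \<in> restr a b ` V"
      then obtain x u where xu: "x \<in> gid (m + 1)" "u \<in> tpolys (m - 1)" "f = restr a b (x + q * u)"
        unfolding V_def by (auto elim!: sumsetE)
      have "r * restr a b u \<in> restr a b ` gid (m + 1)" using hull restr_tpolys[OF xu(2)] by blast
      moreover have "restr a b x \<in> restr a b ` gid (m + 1)" using xu(1) by blast
      ultimately have "restr a b x + r * restr a b u \<in> restr a b ` gid (m + 1)"
        by (intro VX.subspace_add[OF subspace_restr[OF subspace_gid]])
      then show "f \<in> restr a b ` gid (m + 1)" unfolding xu(3) restr_add restr_mult r_def .
    next
      fix f assume "f \<in> restr a b ` gid (m + 1)"
      then show "f \<in> restr a b ` V" unfolding V_def using VR.sumset_upper1[OF C(1), of "gid (m + 1)"] by blast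
    qed
    define K where "K = colon V L m"
    have r1: "restr a b 1 = 1" by (simp add: restr_def)
    \<comment> \<open>V and the ideal have the same restriction, of codimension one. Hence K is
      exactly one dimension larger than the space of multiples of q that it contains.\<close>
    have dK: "pdim K = pdim (?tp (m - 2)) + 1"
      using colon_rank[OF V(1,2), of a b] dV s1 s2 s3 b2(3) unfolding K_def L_def rV by simp
    let ?U = "(*) q ` ?tp (m - 2)"
    have U: "VR.subspace ?U" by (rule subspace_mult[OF subspace_tpolys])
    have notall: "\<not> K \<subseteq> colsum ?U 1 L (m - 1)"
    proof
      assume K1: "K \<subseteq> colsum ?U 1 L (m - 1)"
      have all: "int j \<le> m + 1 \<longrightarrow> K \<subseteq> colsum ?U j L (m - int j)" if "1 \<le> j" for j
        using that
      proof (induction j rule: nat_induct_at_least)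
        case base
        show ?case using K1 by simp
      next
        case (Suc j)
        show ?case
        proof (intro impI subsetI)
          fix f assume jm: "int (Suc j) \<le> m + 1" and f: "f \<in> K"
          then have KS: "K \<subseteq> colsum ?U j L (m - int j)" using Suc.IH by simp
          then obtain u g where ug: "u \<in> tpolys (m - 2)" "g \<in> tpolys (m - int j)" "f = q * u + L ^ j * g"
            using f unfolding colsum_def by (blast elim: sumsetE)
          have Lf: "L * f \<in> V" using f unfolding K_def colon_def by blast
          have "L * u \<in> tpolys (1 + (m - 2))" by (rule tpolys_mult[OF Lin ug(1)])
          then have "q * (L * u) \<in> V" by (intro qV) simp
          then have "L * f - q * (L * u) \<in> V" by (rule VR.subspace_diff[OF V(1) Lf])
          moreover have "L * f - q * (L * u) = L ^ Suc j * g" unfolding ug(3) by (simp add: algebra_simps)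
          ultimately have Lg: "L ^ Suc j * g \<in> V" by simp
          have degs: "m + 1 - int (Suc j) = m - int j" by simp
          \<comment> \<open>The first-order variation of \<open>L ^ Suc j * g\<close> in direction w
            lies in V up to multiples of \<open>L ^ Suc j\<close>. After division by L it gives an
            element y of K, to which the induction hypothesis applies; cancelling
            \<open>L ^ j'\<close>, coprime to q, shows that w g is divisible by L modulo q.\<close>
          have key: "\<exists>w1\<in>upolys (m - 1 - int j). restr a b (w * g) = r * w1" if w: "w \<in> {vx, 1}" for w
          proof -
            have "L ^ (Suc j - 1) * w * g \<in> colsum V (Suc j) L (m + 1 - int (Suc j))"
              by (rule tan[OF _ Lg _ jm w]) (use ug(2) degs in simp_all)
            then obtain v g' where v: "v \<in> V" "g' \<in> tpolys (m - int j)" "L ^ j * w * g = v + L ^ Suc j * g'"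
              unfolding colsum_def degs by (auto elim!: sumsetE)
            have w1: "w \<in> tpolys 1" using w vx_in one_in_tpolys[of 1] by auto
            define j' where "j' = j - 1"
            have j': "j = Suc j'" using Suc.hyps unfolding j'_def by simp
            define y where "y = L ^ j' * (w * g) - L ^ j * g'"
            have "L * y = v" using v(3) unfolding y_def j' by (simp add: algebra_simps)
            have "w * g \<in> tpolys (1 + (m - int j))" by (rule tpolys_mult[OF w1 ug(2)])
            then have "L ^ j' * (w * g) \<in> tpolys (int j' + (1 + (m - int j)))" by (rule tpolys_mult[OF Lpow_in])
            then have y1: "L ^ j' * (w * g) \<in> tpolys m" unfolding j' by simp
            have "L ^ j * g' \<in> tpolys (int j + (m - int j))" by (rule tpolys_mult[OF Lpow_in v(2)])
            then have "L ^ j * g' \<in> tpolys m" by simp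
            with y1 have "y \<in> tpolys m" unfolding y_def by (rule tpolys_diff)
            then have "y \<in> K" unfolding K_def colon_def using v(1) \<open>L * y = v\<close> by simp
            then obtain u' g2 where u': "u' \<in> tpolys (m - 2)" "g2 \<in> tpolys (m - int j)" "y = q * u' + L ^ j * g2"
              using KS unfolding colsum_def by (blast elim: sumsetE)
            define g3 where "g3 = g' + g2"
            have e1: "L ^ j' * (w * g - L * g3) = q * u'"
              using u'(3) unfolding y_def g3_def j' by (simp add: algebra_simps)
            then have "L ^ j' dvd q * u'" by (metis dvd_triv_left)
            then have "L ^ j' dvd u'" unfolding L_def by (rule power_line_dvd_cancel[OF rq[unfolded r_def]])
            then obtain u2 where u2: "u' = L ^ j' * u2" by (rule dvdE)
            have "u2 \<in> tpolys (m - 2 - int j')" using tpolys_cancel[OF Lpow] u'(1) unfolding u2 by blast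
            then have u2d: "restr a b u2 \<in> upolys (m - 1 - int j)" using restr_tpolys[of u2 "m - 2 - int j'"] unfolding j' by (simp add: algebra_simps)
            have "L ^ j' * (w * g - L * g3) = L ^ j' * (q * u2)" using e1 unfolding u2 by (simp only: mult.left_commute)
            moreover have "L ^ j' \<noteq> 0" unfolding L_def by (rule power_not_zero[OF line_nonzero])
            ultimately have "w * g - L * g3 = q * u2" by (simp only: mult_cancel_left if_False HOL.simp_thms)
            then have "restr a b (w * g - L * g3) = restr a b (q * u2)" by simp
            then have "restr a b (w * g) = r * restr a b u2" unfolding restr_diff restr_mult r_def L_def by simp
            then show ?thesis using u2d by blast
          qed
          obtain w1 where w1: "w1 \<in> upolys (m - 1 - int j)" "restr a b (1 * g) = r * w1" using key[of 1] by blast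
          obtain w2 where w2: "w2 \<in> upolys (m - 1 - int j)" "restr a b (vx * g) = r * w2" using key[of vx] by blast
          \<comment> \<open>The multiplier of \<open>vx * g\<close> is x times that of g and obeys
            the same degree bound, so the degree of w1 is one smaller than \<open>key\<close> alone
            says. This keeps q w1 within degree m - j.\<close>
          have "r * w2 = ux * (r * w1)" using w1(2) w2(2) unfolding restr_mult restr_const r1 by (simp only: mult_1_left)
          then have "r * w2 = r * (ux * w1)" by (simp only: mult.left_commute)
          then have "w2 = ux * w1" using rq by (simp only: mult_cancel_left HOL.simp_thms)
          then have w1d: "w1 \<in> upolys (m - 2 - int j)"
            using w2(1) unfolding upolys_iff by (cases "w1 = 0") (auto simp: degree_mult_eq)
          have "[:w1:] \<in> tpolys (m - 2 - int j)" using w1d unfolding tpolys_const .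
          then have qw: "q * [:w1:] \<in> tpolys (2 + (m - 2 - int j))" by (rule tpolys_mult[OF q(1)])
          then have "g - q * [:w1:] \<in> tpolys (m - int j)" by (intro tpolys_diff ug(2)) simp
          moreover have "restr a b (g - q * [:w1:]) = 0" unfolding restr_diff restr_mult restr_const using w1(2) unfolding r_def by simp
          ultimately obtain g1 where g1: "g1 \<in> tpolys (m - int j - 1)" "g - q * [:w1:] = L * g1"
            unfolding L_def by (rule restr_eq_0_tpolys)
          have "L ^ j * [:w1:] \<in> tpolys (int j + (m - 2 - int j))"
            by (rule tpolys_mult[OF Lpow_in]) (use w1d in \<open>simp add: tpolys_const\<close>)
          then have uu: "u + L ^ j * [:w1:] \<in> tpolys (m - 2)" by (intro tpolys_add ug(1)) simp
          define cw where "cw = [:w1:]"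
          have "g = q * cw + L * g1" using g1(2) unfolding cw_def by (metis add.commute diff_add_cancel)
          then have "f = q * (u + L ^ j * cw) + L ^ Suc j * g1" unfolding ug(3) by (simp add: algebra_simps)
          moreover have "g1 \<in> tpolys (m - int (Suc j))" using g1(1) by (simp add: algebra_simps)
          moreover have "u + L ^ j * cw \<in> tpolys (m - 2)" using uu unfolding cw_def .
          ultimately show "f \<in> colsum ?U (Suc j) L (m - int (Suc j))"
            unfolding colsum_def by (auto intro!: sumsetI)
        qed
      qed
      \<comment> \<open>At exponent m + 1 the summand with the power of L vanishes for reasons of
        degree, which would leave K inside the multiples of q.\<close>
      define M where "M = nat (m + 1)"
      have M: "1 \<le> M" "int M = m + 1" unfolding M_def using m by auto
      then have "K \<subseteq> colsum ?U M L (m - int M)" by (intro mp[OF all]) simp_all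
      moreover have "m - int M < 0" using M by simp
      then have "?tp (m - int M) = {0}" by (rule tpolys_neg)
      then have "colsum ?U M L (m - int M) = ?U" unfolding colsum_def sumset_def by auto
      ultimately have "K \<subseteq> ?U" by simp
      then have "VR.dim K \<le> VR.dim ?U" by (rule VR.dim_mono_fdim[OF fin_dim_mult[OF fin_dim_tpolys]])
      then show False using dK dim_mult[OF subspace_tpolys fin_dim_tpolys q0, of "m - 2"] by simp
    qed
    then obtain f where f: "f \<in> K" "f \<notin> colsum ?U 1 L (m - 1)" by blast
    have fm: "f \<in> tpolys m" "L * f \<in> V" using f(1) unfolding K_def colon_def by auto
    have t1: "L ^ (1 - 1) * w * f \<in> colsum V 1 L (m + 1 - int 1)" if "w \<in> {vx, 1}" for w
      by (rule tan[OF _ _ _ _ that]) (use fm m in simp_all)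
    have inJ: "restr a b (w * f) \<in> restr a b ` gid (m + 1)" if "w \<in> {vx, 1}" for w
    proof -
      have "w * f \<in> colsum V 1 L (m + 1 - int 1)" using t1[OF that] by simp
      then obtain v g where "v \<in> V" "w * f = v + L ^ 1 * g" unfolding colsum_def by (auto elim!: sumsetE)
      then have "restr a b (w * f) = restr a b v" by (simp add: restr_add restr_mult L_def)
      then show ?thesis using \<open>v \<in> V\<close> rV by blast
    qed
    \<comment> \<open>The restriction of an element of K that is not explained by q. Deforming L
      once puts both \<rho> and x \<rho> into the restriction of the ideal in degree m + 1, while
      \<rho> lies outside its restriction in degree m.\<close>
    define \<rho> where "\<rho> = restr a b f"
    have \<rho>m: "\<rho> \<in> upolys m" unfolding \<rho>_def by (rule restr_tpolys[OF fm(1)])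
    have \<rho>J: "\<rho> \<in> restr a b ` gid (m + 1)" "ux * \<rho> \<in> restr a b ` gid (m + 1)"
      using inJ[of 1] inJ[of vx] unfolding restr_mult restr_const r1 mult_1_left \<rho>_def by blast+
    have \<rho>out: "\<rho> \<notin> restr a b ` gid m"
    proof
      assume "\<rho> \<in> restr a b ` gid m"
      then obtain w where w: "w \<in> upolys (m - 2)" "\<rho> = r * w" unfolding rgm by blast
      have cw: "[:w:] \<in> tpolys (m - 2)" using w(1) unfolding tpolys_const .
      have "q * [:w:] \<in> tpolys (2 + (m - 2))" by (rule tpolys_mult[OF q(1) cw])
      then have "f - q * [:w:] \<in> tpolys m" by (intro tpolys_diff fm(1)) simp
      moreover have "restr a b (f - q * [:w:]) = 0"
        unfolding restr_diff restr_mult restr_const using w(2) unfolding r_def \<rho>_def by simp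
      ultimately obtain g1 where g1: "g1 \<in> tpolys (m - 1)" "f - q * [:w:] = L * g1"
        unfolding L_def by (rule restr_eq_0_tpolys)
      have "f = q * [:w:] + L ^ 1 * g1" using g1(2) by (metis add.commute diff_add_cancel power_one_right)
      moreover have "q * [:w:] + L ^ 1 * g1 \<in> colsum ?U 1 L (m - 1)" unfolding colsum_def
        using cw g1(1) by (intro sumsetI imageI)
      ultimately show False using f(2) by simp
    qed
    let ?J = "restr a b ` gid (m + 1)"
    have J: "VX.subspace ?J" "fin_dim smult ?J"
      by (rule subspace_restr[OF subspace_gid], rule fin_dim_in_upolys[OF restr_gid_in])
    define Z where "Z = sumset (restr a b ` gid m) (VX.span {\<rho>})"
    have Z: "VX.subspace Z" "Z \<subseteq> upolys m"
    proof -
      show "VX.subspace Z" unfolding Z_def by (intro VX.subspace_sumset subspace_restr subspace_gid VX.subspace_span)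
      have "VX.span {\<rho>} \<subseteq> upolys m" by (rule VX.span_minimal[OF _ subspace_upolys]) (use \<rho>m in simp)
      then show "Z \<subseteq> upolys m" unfolding Z_def by (intro VX.sumset_least[OF subspace_upolys restr_gid_in])
    qed
    have gZ: "restr a b ` gid m \<subseteq> Z" unfolding Z_def by (rule VX.sumset_upper1[OF VX.subspace_span])
    have "VX.span {\<rho>} \<subseteq> Z" unfolding Z_def by (rule VX.sumset_upper2[OF subspace_restr[OF subspace_gid]])
    then have \<rho>Z: "\<rho> \<in> Z" using VX.span_base[of \<rho> "{\<rho>}"] by blast
    have "restr a b ` gid m \<subset> Z" using gZ \<rho>Z \<rho>out by blast
    then have dZ: "VX.dim (restr a b ` gid m) < VX.dim Z"
      by (rule VX.dim_strict_fdim[OF fin_dim_in_upolys[OF Z(2)] subspace_restr[OF subspace_gid]])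
    have hullZ: "xhull Z \<subseteq> ?J"
    proof (rule xhull_least[OF J(1)])
      have xg: "xhull (restr a b ` gid m) \<subseteq> ?J" by (rule restr_gid_xhull)
      have g1: "restr a b ` gid m \<subseteq> ?J" using xg xhull_upper(1)[OF subspace_restr[OF subspace_gid]] by blast
      have "VX.span {\<rho>} \<subseteq> ?J" by (rule VX.span_minimal[OF _ J(1)]) (use \<rho>J(1) in simp)
      then show "Z \<subseteq> ?J" unfolding Z_def by (rule VX.sumset_least[OF J(1) g1])
      show "(*) ux ` Z \<subseteq> ?J"
      proof
        fix z assume "z \<in> (*) ux ` Z"
        then obtain x c where x: "x \<in> restr a b ` gid m" "z = ux * (x + smult c \<rho>)"
          unfolding Z_def VX.span_singleton by (auto elim!: sumsetE)
        have "ux * x \<in> ?J" using xg xhull_upper(2)[OF subspace_restr[OF subspace_gid] x(1)] by blast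
        moreover have "smult c (ux * \<rho>) \<in> ?J" by (rule VX.subspace_scale[OF J(1) \<rho>J(2)])
        ultimately have "ux * x + smult c (ux * \<rho>) \<in> ?J" by (rule VX.subspace_add[OF J(1)])
        moreover have "z = ux * x + smult c (ux * \<rho>)" unfolding x(2) by (simp only: distrib_left mult_smult_right)
        ultimately show "z \<in> ?J" by simp
      qed
    qed
    have "Z \<noteq> {0}"
    proof
      assume "Z = {0}"
      then have "\<rho> = 0" using \<rho>Z by simp
      then show False using \<rho>out VX.subspace_0[OF subspace_restr[OF subspace_gid]] by simp
    qed
    then have grow: "VX.dim Z + 1 \<le> VX.dim (xhull Z)" by (rule xhull_grows[OF Z])
    have le: "VX.dim (xhull Z) \<le> VX.dim ?J" by (rule VX.dim_mono_fdim[OF J(2) hullZ])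
    \<comment> \<open>The restricted ideal has dimension m - 1 in degree m and m + 1 in degree m +
      1. This forces dimension m for Z and growth by exactly one.\<close>
    have dims: "int (VX.dim Z) = m" "VX.dim (xhull Z) = VX.dim Z + 1" "VX.dim ?J = VX.dim Z + 1"
      using grow le dZ b2(2,3) by linarith+
    have JZ: "xhull Z = ?J"
      by (rule VX.subspace_eq_fdim[OF J(2) subspace_xhull[OF Z(1)] hullZ]) (simp add: dims)
    obtain Q where Q: "Z = (*) Q ` upolys (int (VX.dim Z) - 1)"
      by (rule xhull_minimal_growth[OF Z dims(2)])
    have "xhull ((*) Q ` upolys (m - 1)) = (*) Q ` upolys (m - 1 + 1)"
      by (rule xhull_mult_upolys) (use m in simp)
    then have "?J = (*) Q ` upolys m" using JZ Q unfolding dims(1) by simp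
    then show "\<exists>Q. restr a b ` gid (m + 1) = (*) Q ` upolys m" by blast
  qed
qed

theorem middle_injective:
  assumes s: "3 \<le> s" "2 * s + 2 \<le> e" "h s \<le> 3 * s - 1"
  defines "t \<equiv> (e - 1) div 2"
  obtains a b where "\<And>F. F \<in> tpolys t \<Longrightarrow> line a b * F \<in> gid (t + 1) \<Longrightarrow> F \<in> gid t"
proof -
  have "\<exists>a b. \<not> 0 < \<kappa> a b t"
  proof (rule ccontr)
    assume "\<not> ?thesis"
    then have pos: "0 < \<kappa> a b t" for a b by blast
    have t: "s \<le> t" "t + 2 \<le> e" "e = 2 * t + 1 \<or> e = 2 * t + 2" using s unfolding t_def by auto
    \<comment> \<open>Finitely many degrees occur, so one generic condition \<open>good\<close>
      fixes the ranks in all of them and makes B independent of the line.\<close>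
    have "\<exists>r. \<forall>j\<in>{0..e}. generic (\<lambda>a b. rdim a b (gid j) = r j)"
    proof (rule bchoice, rule ballI)
      fix j assume "j \<in> {0..e}"
      then have "0 \<le> j" by simp
      from rdim_max[OF subspace_gid gid_in this] show "\<exists>r. generic (\<lambda>a b. rdim a b (gid j) = r)" by blast
    qed
    then obtain r where r: "\<forall>j\<in>{0..e}. generic (\<lambda>a b. rdim a b (gid j) = r j)" by blast
    define good where "good = (\<lambda>a b. \<forall>j\<in>{0..e}. rdim a b (gid j) = r j)"
    have ggood: "generic good" unfolding good_def by (rule generic_ball) (use r in auto)
    define B where "B = (\<lambda>j. j + 1 - r j)"
    have B: "\<beta> a b j = B j" if "good a b" "0 \<le> j" "j \<le> e" for a b j
      using that unfolding good_def B_def by simp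
    \<comment> \<open>The hypothesis of the theorem enters here: for c = 2 the bound in
      \<open>generic_\<beta>_le\<close> reads 2 h s <= 6 s - 2.\<close>
    have "generic (\<lambda>a b. \<beta> a b s \<le> 2)" by (rule generic_\<beta>_le) (use s in simp_all)
    from generic_conj[OF this ggood] obtain a b where "\<beta> a b s \<le> 2 \<and> good a b" by (rule generic_ex)
    then have ab: "\<beta> a b s \<le> 2" "good a b" by auto
    note Bab = B[OF ab(2)]
    have Bs: "B s \<le> 2" using ab(1) Bab[of s] s(1) t by simp
    have mono: "B j \<le> B i" if "s \<le> i" "i \<le> j" "j \<le> e" for i j
    proof -
      have "\<beta> a b s \<le> s" using ab(1) s(1) by linarith
      then have "\<beta> a b i \<le> \<beta> a b s" using that(1) by (rule \<beta>_antimono)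
      then have "\<beta> a b i \<le> i" using ab(1) s(1) that(1) by linarith
      from \<beta>_antimono[OF this that(2)] show ?thesis using Bab[of i] Bab[of j] that s(1) by simp
    qed
    have nonneg: "0 \<le> B j" if "0 \<le> j" "j \<le> e" for j
      using \<beta>_nonneg[of j a b] Bab[OF that] that by simp
    have kd: "\<kappa> a b j = B (e - j)" if "0 \<le> j" "j \<le> e" for j
      using \<kappa>_dual[of j a b] Bab[of "e - j"] that by simp
    have ke: "\<kappa> a b j = h j - h (j + 1) + B (j + 1)" if "0 \<le> j" "j < e" for j
      using \<kappa>_eq[of j a b] Bab[of "j + 1"] that by simp
    \<comment> \<open>Since e - t is at least t + 1, the codimension c is at least B (e - t), which
      by duality is the dimension of a kernel assumed to be nonzero.\<close>
    define c where "c = B (t + 1)"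
    have k_t: "0 < B (e - t)" using kd[of t] pos[of a b] t s(1) by simp
    have c1: "1 \<le> c"
    proof -
      have "B (e - t) \<le> B (t + 1)" by (rule mono) (use t in auto)
      then show ?thesis using k_t unfolding c_def by simp
    qed
    have c2: "c \<le> 2" using mono[of s "t + 1"] Bs t unfolding c_def by simp
    have Bt: "c \<le> B t" "B t \<le> 2" using mono[of t "t + 1"] mono[of s t] Bs t unfolding c_def by auto
    \<comment> \<open>Beyond s the Hilbert function grows by at most B <= 2 per step, so the bound 3
      s - 1 carries over to 3 t - 1.\<close>
    have hbound: "s \<le> j \<longrightarrow> j \<le> e \<longrightarrow> h j \<le> h s + 2 * (j - s)" if "s \<le> j" for j
      using that
    proof (induction j rule: int_ge_induct)
      case (step j)
      show ?case
      proof (intro impI)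
        assume j: "j + 1 \<le> e"
        have "B (j + 1) \<le> 2" using mono[of s "j + 1"] Bs step.hyps j by simp
        then have "h (j + 1) \<le> h j + 2"
          using ke[of j] \<kappa>_nonneg[where a = a and b = b and j = j] step.hyps j s(1) by simp
        then show "h (j + 1) \<le> h s + 2 * (j + 1 - s)" using step j by simp
      qed
    qed simp
    have ht: "h t \<le> 3 * t - 1" using hbound[of t] t s(3) by simp
    have H: "generic (\<lambda>a b. \<exists>Q. restr a b ` gid (t + 1) = (*) Q ` upolys (t + 1 - c))"
    proof -
      \<comment> \<open>Stationarity on either side of t + 1 determines the common factor there. If
        e is even, e - t = t + 2 and duality makes B (t + 2) positive, so c = 1 persists; only odd e
        leaves the third case.\<close>
      consider "B t = c" | "B (t + 2) = c" | "B t = 2" "c = 1" "e = 2 * t + 1"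
      proof (cases "B t = c")
        case True then show ?thesis by (rule that(1))
      next
        case False
        then have "B t = 2" "c = 1" using Bt c1 by linarith+
        show ?thesis
        proof (cases "e = 2 * t + 1")
          case True
          then show ?thesis using that(3) \<open>B t = 2\<close> \<open>c = 1\<close> by blast
        next
          case False
          then have "e - t = t + 2" using t(3) by linarith
          then have "0 < B (t + 2)" using k_t by simp
          moreover have "B (t + 2) \<le> c" unfolding c_def by (rule mono) (use t in auto)
          ultimately show ?thesis using that(2) \<open>c = 1\<close> by simp
        qed
      qed
      then show ?thesis
      proof cases
        case 1
        show ?thesis using ggood
        proof (rule generic_mono)
          fix a b assume g: "good a b"
          have "\<beta> a b t = c" "\<beta> a b (t + 1) = c"
            using B[OF g, of t] B[OF g, of "t + 1"] 1 t s(1) unfolding c_def by simp_all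
          then obtain Q where "restr a b ` gid (t + 1) = (*) Q ` upolys (t + 1 - c)"
            by (rule \<beta>_stationary) (use c2 t s(1) in simp)
          then show "\<exists>Q. restr a b ` gid (t + 1) = (*) Q ` upolys (t + 1 - c)" by blast
        qed
      next
        case 2
        show ?thesis using ggood
        proof (rule generic_mono)
          fix a b assume g: "good a b"
          have "\<beta> a b (t + 1) = c" "\<beta> a b (t + 1 + 1) = c"
            using B[OF g, of "t + 2"] B[OF g, of "t + 1"] 2 t s(1) unfolding c_def by (simp_all add: add.assoc)
          then obtain Q where "restr a b ` gid (t + 1) = (*) Q ` upolys (t + 1 - c)"
            by (rule \<beta>_stationary) (use c2 t s(1) in simp)
          then show "\<exists>Q. restr a b ` gid (t + 1) = (*) Q ` upolys (t + 1 - c)" by blast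
        qed
      next
        case 3
        \<comment> \<open>For odd e the inequality 2 s + 2 <= e leaves room for degree t - 1, where
          B is squeezed between B t = 2 and B s <= 2.\<close>
        have st: "s \<le> t - 1" using s(2) 3(3) by linarith
        then have Bt1: "B (t - 1) = 2" using mono[of "t - 1" t] mono[of s "t - 1"] Bs 3(1) t by linarith
        have g3: "generic (\<lambda>a b. \<beta> a b (t - 1) = 2 \<and> \<beta> a b t = 2 \<and> \<beta> a b (t + 1) = 1)"
          using ggood
        proof (rule generic_mono)
          fix a b assume g: "good a b"
          show "\<beta> a b (t - 1) = 2 \<and> \<beta> a b t = 2 \<and> \<beta> a b (t + 1) = 1"
            using B[OF g, of "t - 1"] B[OF g, of t] B[OF g, of "t + 1"] Bt1 3(1,2) t st s(1) unfolding c_def by simp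
        qed
        have "generic (\<lambda>a b. \<exists>Q. restr a b ` gid (t + 1) = (*) Q ` upolys t)"
          by (rule conic_case[OF 3(3) _ ht g3]) (use t s(1) in simp)
        then show ?thesis using 3(2) by simp
      qed
    qed
    obtain D where D: "D \<in> tpolys c" "gid (t + 1) \<subseteq> (*) D ` tpolys (t + 1 - c)"
      by (rule common_factor_of_generic_restriction[OF subspace_gid gid_in _ _ H]) (use c1 c2 t s(1) in simp_all)
    have D0: "D \<noteq> 0"
    proof
      assume "D = 0"
      then have "gid (t + 1) \<subseteq> {0}" using D(2) by auto
      then have "gid (t + 1) = {0}" using VR.subspace_0[OF subspace_gid] by blast
      then have "restr a b ` gid (t + 1) = {0}" by simp
      moreover have "restr a b ` gid (t + 1) \<noteq> {0}"
        by (rule restr_gid_nonzero) (use Bab[of "t + 1"] c2 t s(1) in \<open>simp add: c_def\<close>)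
      ultimately show False by simp
    qed
    have D': "gid t \<subseteq> (*) D ` tpolys (t - c)" by (rule factor_descends[OF D(2) D0])
    interpret D: graded_functional "\<lambda>F. \<phi> (D * F)" "e - c" by (rule graded_functional_mult)
    have r1: "pdim (D.gid (t + 1 - c)) = pdim (gid (t + 1))" by (rule residual_eq[OF D(1) D0 D(2)])
    have r2: "pdim (D.gid (t - c)) = pdim (gid t)" by (rule residual_eq[OF D(1) D0 D'])
    have tc: "t + 1 - c = t - c + 1" by simp
    have st1: "pdim (tpolys (t - c + 1) :: 'k poly poly set) = pdim (tpolys (t - c) :: 'k poly poly set) + (t - c) + 2"
      by (rule pdim_tpolys_step) (use c2 t s(1) in simp)
    have st2: "pdim (tpolys (t + 1) :: 'k poly poly set) = pdim (tpolys t :: 'k poly poly set) + t + 2"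
      by (rule pdim_tpolys_step) (use t s(1) in simp)
    have kt: "\<kappa> a b t = h t - h (t + 1) + c" using ke[of t] t s(1) unfolding c_def by simp
    \<comment> \<open>The ideal and its residual have equal dimensions in degrees t and t + 1,
      whereas the ambient increments differ by c. The residual first difference is therefore -
      \<kappa>, negative by assumption.\<close>
    have "D.h (t - c + 1) = D.h (t - c) - \<kappa> a b t"
      unfolding kt using r1 r2 st1 st2 unfolding D.h_def h_def tc by simp
    then have dec: "D.h (t - c + 1) < D.h (t - c)" using pos[of a b] by simp
    \<comment> \<open>Division by D lowers the bound 3 t - 1 by t + 1 or by 2 t + 1. What remains, 2
      (t - 1) or t - 2, is the bound of \<open>generic_\<beta>_le\<close> with 2 - c in place of
      2.\<close>
    have small: "2 * D.h (t - c) \<le> 2 * (2 - c + 1) * (t - c) - (2 - c) * (2 - c - 1)"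
    proof -
      have g: "pdim (gid t) = pdim (tpolys t :: 'k poly poly set) - h t" unfolding h_def by simp
      have u1: "pdim (tpolys (t - 1 + 1) :: 'k poly poly set) = pdim (tpolys (t - 1) :: 'k poly poly set) + (t - 1) + 2"
        by (rule pdim_tpolys_step) (use t s(1) in simp)
      have u2: "pdim (tpolys (t - 2 + 1) :: 'k poly poly set) = pdim (tpolys (t - 2) :: 'k poly poly set) + (t - 2) + 2"
        by (rule pdim_tpolys_step) (use t s(1) in simp)
      have Dh: "D.h (t - c) = pdim (tpolys (t - c) :: 'k poly poly set) - pdim (tpolys t :: 'k poly poly set) + h t"
        unfolding D.h_def r2 g by simp
      consider "c = 1" | "c = 2" using c1 c2 by linarith
      then show ?thesis
      proof cases
        case 1
        have "pdim (tpolys (t - c) :: 'k poly poly set) = pdim (tpolys t :: 'k poly poly set) - t - 1"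
          unfolding 1 using u1 by simp
        then have "2 * D.h (t - c) \<le> 2 * (2 * (t - 1))" unfolding Dh using ht by simp
        moreover have "2 * (2 - c + 1) * (t - c) - (2 - c) * (2 - c - 1) = 2 * (2 * (t - 1))" unfolding 1 by simp
        ultimately show ?thesis by (simp only:)
      next
        case 2
        have "pdim (tpolys (t - c) :: 'k poly poly set) = pdim (tpolys t :: 'k poly poly set) - 2 * t - 1"
          unfolding 2 using u1 u2 by simp
        then have "2 * D.h (t - c) \<le> 2 * (t - 2)" unfolding Dh using ht by simp
        moreover have "2 * (2 - c + 1) * (t - c) - (2 - c) * (2 - c - 1) = 2 * (t - 2)" unfolding 2 by simp
        ultimately show ?thesis by (simp only:)
      qed
    qed
    \<comment> \<open>Under the residual symmetry the drop from t - c to t - c + 1 becomes a rise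
      from e - t - 1 to e - t, a later degree where no rise is possible.\<close>
    have "D.h (e - t - 1 + 1) \<le> D.h (e - t - 1)"
      by (rule D.decrease_persists[OF _ _ _ small _ _ _ dec]) (use c1 c2 t s(1) in auto)
    moreover have "D.h (e - c - (t - c)) = D.h (t - c)" "D.h (e - c - (t - c + 1)) = D.h (t - c + 1)"
      by (rule D.h_sym)+
    moreover have "e - c - (t - c) = e - t - 1 + 1" "e - c - (t - c + 1) = e - t - 1" by simp_all
    ultimately show False using dec by simp
  qed
  then obtain a b where "\<not> 0 < \<kappa> a b t" by blast
  then have "F \<in> gid t" if "F \<in> tpolys t" "line a b * F \<in> gid (t + 1)" for F
    using that unfolding \<kappa>_pos_iff by blast
  then show ?thesis by (rule that)
qed

end

section \<open>Multiplication by a linear form in all degrees\<close>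

context graded_functional
begin

definition injective_at :: "'k poly poly \<Rightarrow> int \<Rightarrow> bool" where
  "injective_at L j \<longleftrightarrow> (\<forall>F\<in>tpolys j. L * F \<in> gid (j + 1) \<longrightarrow> F \<in> gid j)"

text \<open>If L kills a class in degree i - 1, it kills its multiples by linear forms in degree i.
  These are then zero, and \<open>gid_descend\<close> makes the class itself zero.\<close>

lemma injective_below:
  assumes "L \<in> tpolys 1" "injective_at L t" "i \<le> t" "t \<le> e"
  shows "injective_at L i"
  using assms(3)
proof (induction i rule: int_le_induct)
  case base
  show ?case by (rule assms(2))
next
  case (step i)
  show ?case unfolding injective_at_def
  proof (intro ballI impI)
    fix F assume F: "F \<in> tpolys (i - 1)" "L * F \<in> gid (i - 1 + 1)"
    have "w * F \<in> gid i" if w: "w \<in> tpolys 1" for w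
    proof -
      have "w * F \<in> tpolys (1 + (i - 1))" by (rule tpolys_mult[OF w F(1)])
      then have "w * F \<in> tpolys i" by simp
      moreover have "w * (L * F) \<in> gid (i - 1 + 1 + 1)" by (rule gid_mult[OF F(2) w])
      then have "L * (w * F) \<in> gid (i + 1)" by (simp add: mult.left_commute)
      ultimately show ?thesis using step.IH unfolding injective_at_def by blast
    qed
    note g = this[OF one_in_tpolys] this[OF vx_in] this[OF line_in]
    show "F \<in> gid (i - 1)"
      by (rule gid_descend[OF F(1), of 0 0]) (use g step.hyps assms(4) in simp_all)
  qed
qed

text \<open>The transpose of an injective multiplication is surjective. Injectivity in degree i says
  that the residual of L agrees with the ideal there, and symmetry turns this into a dimension count
  in degree e - i.\<close>

lemma surjective_dual:
  assumes L: "L \<in> tpolys 1" and i: "injective_at L i" "- 2 \<le> e - 1 - i" and G: "G \<in> tpolys (e - i)"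
  obtains F where "F \<in> tpolys (e - 1 - i)" "G - L * F \<in> gid (e - i)"
proof -
  let ?j = "e - 1 - i"
  let ?tp = "\<lambda>d. tpolys d :: 'k poly poly set"
  let ?C = "(*) L ` ?tp ?j"
  have j: "?j + 1 = e - i" by simp
  have full: "sumset (gid (e - i)) ?C = tpolys (e - i)"
  proof (cases "L = 0")
    case True
    have "h (e - i) = 0"
    proof -
      have "gid i = tpolys i"
        using i(1) gid_in[of i] VR.subspace_0[OF subspace_gid] unfolding injective_at_def True by auto
      then show ?thesis unfolding h_sym unfolding h_def by simp
    qed
    then have g: "gid (e - i) = tpolys (e - i)"
      by (intro VR.subspace_eq_fdim[OF fin_dim_tpolys subspace_gid gid_in]) (simp add: h_def)
    have "0 \<in> ?tp ?j" by (rule tpolys_0)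
    then have "?C = {0}" unfolding True by auto
    then show ?thesis unfolding g sumset_def by auto
  next
    case False
    have C: "VR.subspace ?C" "?C \<subseteq> tpolys (e - i)" "pdim ?C = pdim (?tp ?j)"
    proof -
      show "VR.subspace ?C" by (rule subspace_mult[OF subspace_tpolys])
      show "?C \<subseteq> tpolys (e - i)" using mult_tpolys_subset[OF L, of ?j] unfolding j .
      show "pdim ?C = pdim (?tp ?j)" using dim_mult[OF subspace_tpolys fin_dim_tpolys False] by simp
    qed
    interpret L: graded_functional "\<lambda>F. \<phi> (L * F)" "e - 1" by (rule graded_functional_mult)
    have Lgid: "L.gid d = colon (gid (d + 1)) L d" for d using colon_gid[OF L] by simp
    have "L.gid i = gid i"
    proof
      show "L.gid i \<subseteq> gid i" unfolding Lgid colon_def using i(1) unfolding injective_at_def by blast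
      show "gid i \<subseteq> L.gid i" unfolding Lgid colon_def using gid_in gid_mult[OF _ L] by auto
    qed
    then have "L.h i = h i" unfolding L.h_def h_def by simp
    then have "L.h ?j = h (e - i)" using L.h_sym[of i] h_sym[of i] by simp
    moreover have "gid (e - i) \<inter> ?C = (*) L ` L.gid ?j" unfolding Lgid j colon_def by blast
    then have "pdim (gid (e - i) \<inter> ?C) = pdim (L.gid ?j)"
      using dim_mult[OF L.subspace_gid fin_dim_in_tpolys[OF L.gid_in] False] by simp
    moreover have "pdim (sumset (gid (e - i)) ?C) + pdim (gid (e - i) \<inter> ?C) = pdim (gid (e - i)) + pdim ?C"
      using VR.dim_sumset_Int[OF subspace_gid fin_dim_in_tpolys[OF gid_in] C(1) fin_dim_in_tpolys[OF C(2)]]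
      by (metis of_nat_add)
    ultimately have "pdim (sumset (gid (e - i)) ?C) = pdim (?tp (e - i))"
      using C(3) unfolding L.h_def h_def by simp
    then show ?thesis
      by (intro VR.subspace_eq_fdim[OF fin_dim_tpolys VR.subspace_sumset[OF subspace_gid C(1)]
            VR.sumset_least[OF subspace_tpolys gid_in C(2)]]) simp
  qed
  then have "G \<in> sumset (gid (e - i)) ?C" using G by simp
  then obtain g F where F: "g \<in> gid (e - i)" "F \<in> tpolys ?j" "G = g + L * F" by (auto elim!: sumsetE)
  show ?thesis by (rule that[OF F(2)]) (use F(1,3) in simp)
qed

lemma gid_complement:
  obtains B where "finite B" "VR.independent B" "B \<subseteq> tpolys j" "VR.span B \<inter> gid j = {0}"
    "sumset (VR.span B) (gid j) = tpolys j"
proof -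
  obtain A where A: "A \<subseteq> gid j" "VR.independent A" "gid j \<subseteq> VR.span A" by (rule VR.maximal_independent_subset[of "gid j"])
  have Ag: "VR.span A = gid j" using A(3) VR.span_minimal[OF A(1) subspace_gid] by blast
  have "A \<subseteq> tpolys j" using A(1) gid_in by blast
  then obtain D where D: "A \<subseteq> D" "D \<subseteq> tpolys j" "VR.independent D" "tpolys j \<subseteq> VR.span D" "finite D"
    "card D = VR.dim (tpolys j :: 'k poly poly set)"
    by (rule VR.fdim_basis_extend[OF fin_dim_tpolys _ A(2)])
  let ?B = "D - A"
  have iB: "VR.independent ?B" by (rule VR.independent_mono[OF D(3)]) blast
  have B: "?B \<subseteq> tpolys j" "VR.span ?B \<subseteq> tpolys j"
    using D(2) VR.span_minimal[OF _ subspace_tpolys, of ?B j] by blast+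
  have "VR.span (?B \<union> A) = sumset (VR.span ?B) (VR.span A)"
    unfolding VR.span_Un sumset_def by blast
  moreover have "?B \<union> A = D" using D(1) by blast
  moreover have "VR.span D = tpolys j" using D(4) VR.span_minimal[OF D(2) subspace_tpolys] by blast
  ultimately have sum: "sumset (VR.span ?B) (gid j) = tpolys j" unfolding Ag by simp
  have "VR.dim (sumset (VR.span ?B) (gid j)) + VR.dim (VR.span ?B \<inter> gid j) = VR.dim (VR.span ?B) + VR.dim (gid j)"
    by (rule VR.dim_sumset_Int[OF VR.subspace_span fin_dim_in_tpolys[OF B(2)] subspace_gid fin_dim_in_tpolys[OF gid_in]])
  moreover have "VR.dim (VR.span ?B) = card ?B" by (rule VR.dim_span_eq_card_independent[OF iB])
  moreover have "VR.dim (gid j) = card A" using VR.dim_span_eq_card_independent[OF A(2)] unfolding Ag .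
  moreover have "card ?B + card A = card D"
    using D(1,5) by (metis add.commute card_Diff_subset card_mono finite_subset le_add_diff_inverse)
  ultimately have "VR.dim (VR.span ?B \<inter> gid j) = 0" unfolding sum using D(6) by simp
  then have "{0} = VR.span ?B \<inter> gid j"
    by (intro VR.subspace_eq_fdim[OF VR.fdim_subset[OF fin_dim_in_tpolys[OF gid_in], of _ j] VR.subspace_single_0])
      (auto simp: VR.span_zero VR.subspace_0[OF subspace_gid])
  then show ?thesis using that[OF _ iB B(1) _ sum] D(5) by simp
qed

text \<open>This step passes from one line to an open set of linear forms. On a basis of a
  complement of \<open>gid t\<close> injectivity is the linear independence of the functionals G
  \<mapsto> \<phi>(l b G), and these depend on l through functions in \<open>PP\<close>.\<close>

lemma injective_open:
  assumes PP: "fun_algebra PP" and l: "\<And>x. l x \<in> tpolys 1"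
    and lin: "\<And>H. H \<in> tpolys (e - 1) \<Longrightarrow> (\<lambda>x. \<phi> (l x * H)) \<in> PP"
    and x0: "injective_at (l x0) t"
  obtains p where "p \<in> PP" "p x0 \<noteq> 0" "\<And>x. p x \<noteq> 0 \<Longrightarrow> injective_at (l x) t"
proof -
  interpret fun_algebra PP by (rule PP)
  obtain B where B: "finite B" "VR.independent B" "B \<subseteq> tpolys t" "VR.span B \<inter> gid t = {0}"
    "sumset (VR.span B) (gid t) = tpolys t" by (rule gid_complement[of t])
  \<comment> \<open>The coordinates are indexed by all polynomials G; outside the dual degree they
    are set to 0 and impose no condition.\<close>
  define v where "v = (\<lambda>b x G. if G \<in> tpolys (e - (t + 1)) then \<phi> (l x * (b * G)) else 0)"
  define S where "S = (\<lambda>\<alpha>. \<Sum>b\<in>B. scaleP (\<alpha> b) b)"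
  have S: "S \<alpha> \<in> VR.span B" "S \<alpha> \<in> tpolys t" for \<alpha>
  proof -
    show "S \<alpha> \<in> VR.span B" unfolding S_def by (intro VR.span_sum VR.span_scale VR.span_base)
    then show "S \<alpha> \<in> tpolys t" using VR.span_minimal[OF B(3) subspace_tpolys] by blast
  qed
  have zero: "(\<forall>G. (\<Sum>b\<in>B. \<alpha> b * v b x G) = 0) \<longleftrightarrow> l x * S \<alpha> \<in> gid (t + 1)" for \<alpha> x
  proof -
    have sum: "\<phi> (\<Sum>b\<in>B. f b) = (\<Sum>b\<in>B. \<phi> (f b))" for f :: "'k poly poly \<Rightarrow> 'k poly poly"
      by (induction B rule: infinite_finite_induct) (simp_all add: \<phi>_0 \<phi>_add)
    have eq: "(\<Sum>b\<in>B. \<alpha> b * v b x G) = \<phi> (l x * S \<alpha> * G)" if "G \<in> tpolys (e - (t + 1))" for G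
    proof -
      have "(\<Sum>b\<in>B. \<alpha> b * v b x G) = (\<Sum>b\<in>B. \<phi> (scaleP (\<alpha> b) (l x * (b * G))))"
        using that unfolding v_def \<phi>_scale by simp
      also have "\<dots> = \<phi> (\<Sum>b\<in>B. scaleP (\<alpha> b) (l x * (b * G)))" by (rule sum[symmetric])
      also have "(\<Sum>b\<in>B. scaleP (\<alpha> b) (l x * (b * G))) = l x * S \<alpha> * G"
        unfolding S_def by (simp add: sum_distrib_left sum_distrib_right scaleP_mult mult.assoc)
      finally show ?thesis .
    qed
    have z: "(\<Sum>b\<in>B. \<alpha> b * v b x G) = 0" if "G \<notin> tpolys (e - (t + 1))" for G
      using that unfolding v_def by simp
    have "l x * S \<alpha> \<in> tpolys (t + 1)" using tpolys_mult[OF l S(2)] by (simp add: add.commute)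
    then have "l x * S \<alpha> \<in> gid (t + 1) \<longleftrightarrow> (\<forall>G\<in>tpolys (e - (t + 1)). \<phi> (l x * S \<alpha> * G) = 0)"
      unfolding gid_def by simp
    also have "\<dots> \<longleftrightarrow> (\<forall>G\<in>tpolys (e - (t + 1)). (\<Sum>b\<in>B. \<alpha> b * v b x G) = 0)" by (simp add: eq)
    also have "\<dots> \<longleftrightarrow> (\<forall>G. (\<Sum>b\<in>B. \<alpha> b * v b x G) = 0)" using z by blast
    finally show ?thesis ..
  qed
  have van: "\<forall>b\<in>B. \<alpha> b = 0" if "S \<alpha> \<in> gid t" for \<alpha>
  proof -
    have "S \<alpha> = 0" using that S(1) B(4) by blast
    then show ?thesis using VR.independentD[OF B(2,1) order_refl] unfolding S_def by blast
  qed
  obtain p where p: "p \<in> PP" "p x0 \<noteq> 0"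
    "\<forall>x \<alpha>. p x \<noteq> 0 \<longrightarrow> (\<forall>G. (\<Sum>b\<in>B. \<alpha> b * v b x G) = 0) \<longrightarrow> (\<forall>b\<in>B. \<alpha> b = 0)"
  proof (rule independence_open[of B v x0])
    show "finite B" by (rule B(1))
    fix b G assume "b \<in> B"
    then have "b * G \<in> tpolys (e - 1)" if "G \<in> tpolys (e - (t + 1))"
      using tpolys_mult[of b t G "e - (t + 1)"] B(3) that by auto
    then show "(\<lambda>x. v b x G) \<in> PP" unfolding v_def
      by (cases "G \<in> tpolys (e - (t + 1))") (simp_all add: lin PP_const)
  next
    fix \<alpha> assume "\<And>G. (\<Sum>b\<in>B. \<alpha> b * v b x0 G) = 0"
    then have "l x0 * S \<alpha> \<in> gid (t + 1)" using zero by blast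
    then show "\<forall>b\<in>B. \<alpha> b = 0" using x0 S(2) van unfolding injective_at_def by blast
  qed
  show ?thesis
  proof (rule that[OF p(1,2)])
    fix x assume px: "p x \<noteq> 0"
    show "injective_at (l x) t" unfolding injective_at_def
    proof (intro ballI impI)
      fix F assume F: "F \<in> tpolys t" "l x * F \<in> gid (t + 1)"
      have "F \<in> sumset (VR.span B) (gid t)" using F(1) B(5) by simp
      then obtain s g where sg: "s \<in> VR.span B" "g \<in> gid t" "F = s + g" by (rule sumsetE)
      obtain \<alpha> where \<alpha>: "s = S \<alpha>" using sg(1) unfolding S_def VR.span_finite[OF B(1)] by blast
      have "l x * g \<in> gid (t + 1)" by (rule gid_mult[OF sg(2) l])
      then have "l x * F - l x * g \<in> gid (t + 1)" by (rule VR.subspace_diff[OF subspace_gid F(2)])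
      then have "l x * S \<alpha> \<in> gid (t + 1)" unfolding sg(3) \<alpha> by (simp add: distrib_left)
      then have "\<forall>G. (\<Sum>b\<in>B. \<alpha> b * v b x G) = 0" using zero by blast
      then have "\<forall>b\<in>B. \<alpha> b = 0" using p(3) px by blast
      then have "S \<alpha> = 0" unfolding S_def by simp
      then show "F \<in> gid t" using sg(2) unfolding sg(3) \<alpha> by simp
    qed
  qed
qed

end

section \<open>Dehomogenisation\<close>

abbreviation (input) lk where "lk \<equiv> Poly_Mapping.lookup"
abbreviation (input) cst where "cst c \<equiv> Poly_Mapping.single 0 c"

lemma three_distinct: "(2 :: 3) \<noteq> 0" "(2 :: 3) \<noteq> 1" "(0 :: 3) \<noteq> 2" "(1 :: 3) \<noteq> 2"
  by simp_all

lemma UNIV_3: "(UNIV :: 3 set) = {0, 1, 2}"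
proof (rule card_subset_eq[symmetric])
  show "card {0, 1, 2 :: 3} = card (UNIV :: 3 set)" using three_distinct by auto
qed simp_all

lemma mon_degree_3: "mon_degree (m :: 3 \<Rightarrow>\<^sub>0 nat) = lk m 0 + lk m 1 + lk m 2"
proof -
  have "mon_degree m = (\<Sum>i\<in>UNIV. lk m i)" unfolding mon_degree_def
    by (rule sum.mono_neutral_left) (auto simp: in_keys_iff)
  then show ?thesis unfolding UNIV_3 using three_distinct by simp
qed

lemma mon_degree_add: "mon_degree (m + n :: 3 \<Rightarrow>\<^sub>0 nat) = mon_degree m + mon_degree n"
  by (simp add: mon_degree_3 lookup_add)

lemma forms_iff: "f \<in> forms d \<longleftrightarrow> (\<forall>m. lk f m \<noteq> 0 \<longrightarrow> mon_degree m = d)"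
  by (auto simp: forms_def in_keys_iff)

lemma forms_0: "0 \<in> forms d" by (simp add: forms_iff)

lemma forms_add: "f \<in> forms d \<Longrightarrow> g \<in> forms d \<Longrightarrow> f + g \<in> forms d"
  unfolding forms_iff lookup_add by (metis add_0)

lemma forms_sum: "(\<And>i. i \<in> A \<Longrightarrow> f i \<in> forms d) \<Longrightarrow> (\<Sum>i\<in>A. f i) \<in> forms d"
  by (induction A rule: infinite_finite_induct) (simp_all add: forms_0 forms_add)

lemma forms_single: "mon_degree m = d \<Longrightarrow> Poly_Mapping.single m c \<in> forms d"
  by (simp add: forms_iff lookup_single when_def)

lemma forms_mult:
  fixes f g :: "(3, 'k::comm_ring_1) mpoly"
  assumes "f \<in> forms i" "g \<in> forms j" shows "f * g \<in> forms (i + j)"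
  unfolding forms_def
proof (intro CollectI ballI)
  fix m assume "m \<in> Poly_Mapping.keys (f * g)"
  then obtain a b where "m = a + b" "a \<in> Poly_Mapping.keys f" "b \<in> Poly_Mapping.keys g"
    using keys_mult[of f g] by blast
  then show "mon_degree m = i + j" using assms unfolding forms_def by (simp add: mon_degree_add)
qed

lemma forms_scale: "f \<in> forms d \<Longrightarrow> cst c * f \<in> forms d" for f :: "(3, 'k::comm_ring_1) mpoly"
  using forms_mult[OF forms_single[of 0 0 c], of f d] by (simp add: mon_degree_3)

lemma forms_diff: "f \<in> forms d \<Longrightarrow> g \<in> forms d \<Longrightarrow> f - g \<in> forms d"
  unfolding forms_iff lookup_minus by (metis diff_self)

lemma sum_monomials: "f = (\<Sum>m\<in>Poly_Mapping.keys f. Poly_Mapping.single m (lk f m))"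
proof (rule poly_mapping_eqI)
  fix n
  have "lk (\<Sum>m\<in>Poly_Mapping.keys f. Poly_Mapping.single m (lk f m)) n
    = (\<Sum>m\<in>Poly_Mapping.keys f. if m = n then lk f m else 0)"
    by (simp add: lookup_sum lookup_single when_def)
  also have "\<dots> = lk f n" by (simp add: in_keys_iff)
  finally show "lk f n = lk (\<Sum>m\<in>Poly_Mapping.keys f. Poly_Mapping.single m (lk f m)) n" ..
qed

text \<open>Index 0 is the inner variable, index 1 the outer one, and index 2 is set to 1.\<close>

definition mon2 :: "(3 \<Rightarrow>\<^sub>0 nat) \<Rightarrow> 'k::field_char_0 poly poly" where
  "mon2 m = Polynomial.monom (Polynomial.monom 1 (lk m 0)) (lk m 1)"

text \<open>The substitution \<open>x\<^sub>3 = 1\<close>, which identifies forms of degree \<open>d\<close> with polynomials of degree at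
  most \<open>d\<close> in two variables.\<close>

definition dehom :: "(3, 'k::field_char_0) mpoly \<Rightarrow> 'k poly poly" where
  "dehom f = (\<Sum>m\<in>Poly_Mapping.keys f. scaleP (lk f m) (mon2 m))"

lemma mon2_add: "mon2 (m + n) = mon2 m * mon2 n"
  by (simp add: mon2_def lookup_add mult_monom)

lemma mon2_0: "mon2 0 = 1" by (simp add: mon2_def monom_0 pCons_one)

lemma coeff_mon2: "coeff (coeff (mon2 m) b) a = (if (a, b) = (lk m 0, lk m 1) then 1 else 0)"
  by (simp add: mon2_def)

lemma mon2_in: "mon_degree m \<le> d \<Longrightarrow> mon2 m \<in> tpolys (int d)"
  unfolding tpolys_def by (auto simp: mon2_def mon_degree_3 split: if_splits)

lemma dehom_superset:
  assumes "finite K" "Poly_Mapping.keys f \<subseteq> K"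
  shows "dehom f = (\<Sum>m\<in>K. scaleP (lk f m) (mon2 m))"
  unfolding dehom_def using assms by (intro sum.mono_neutral_left) (auto simp: in_keys_iff scaleP_def)

lemma dehom_add: "dehom (f + g) = dehom f + dehom g"
proof -
  let ?K = "Poly_Mapping.keys f \<union> Poly_Mapping.keys g"
  have "dehom (f + g) = (\<Sum>m\<in>?K. scaleP (lk (f + g) m) (mon2 m))"
    by (rule dehom_superset[OF _ Poly_Mapping.keys_add]) simp
  also have "\<dots> = (\<Sum>m\<in>?K. scaleP (lk f m) (mon2 m)) + (\<Sum>m\<in>?K. scaleP (lk g m) (mon2 m))"
    unfolding sum.distrib[symmetric] lookup_add VR.scale_left_distrib ..
  also have "\<dots> = dehom f + dehom g" using dehom_superset[of ?K f] dehom_superset[of ?K g] by simp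
  finally show ?thesis .
qed

lemma dehom_0: "dehom 0 = 0" by (simp add: dehom_def)

lemma dehom_diff: "dehom (f - g) = dehom f - dehom g"
  using dehom_add[of "f - g" g] by simp

lemma dehom_sum: "dehom (\<Sum>i\<in>A. f i) = (\<Sum>i\<in>A. dehom (f i))"
  by (induction A rule: infinite_finite_induct) (simp_all add: dehom_0 dehom_add)

lemma dehom_single: "dehom (Poly_Mapping.single m c) = scaleP c (mon2 m)"
  using dehom_superset[of "{m}" "Poly_Mapping.single m c"] by simp

lemma dehom_mult: "dehom (f * g) = dehom f * dehom g"
proof -
  have "f * g = (\<Sum>m\<in>Poly_Mapping.keys f. \<Sum>n\<in>Poly_Mapping.keys g. Poly_Mapping.single (m + n) (lk f m * lk g n))"
    by (subst (1) sum_monomials[of f], subst (1) sum_monomials[of g])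
      (simp only: sum_product mult_single)
  then have "dehom (f * g) = (\<Sum>m\<in>Poly_Mapping.keys f. \<Sum>n\<in>Poly_Mapping.keys g.
      scaleP (lk f m * lk g n) (mon2 m * mon2 n))"
    by (simp only: dehom_sum dehom_single mon2_add)
  also have "\<dots> = dehom f * dehom g"
    unfolding dehom_def sum_product scaleP_mult VR.scale_scale by (simp only: mult.commute)
  finally show ?thesis .
qed

lemma dehom_cst: "dehom (cst c * f) = scaleP c (dehom f)"
  unfolding dehom_mult dehom_single mon2_0 scaleP_mult by simp

lemma dehom_in:
  fixes f :: "(3, 'k::field_char_0) mpoly"
  assumes "f \<in> forms d" shows "dehom f \<in> tpolys (int d)"
  unfolding dehom_def
proof (intro VR.subspace_sum[OF subspace_tpolys] VR.subspace_scale[OF subspace_tpolys])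
  fix m assume "m \<in> Poly_Mapping.keys f"
  then show "mon2 m \<in> (tpolys (int d) :: 'k poly poly set)" using assms unfolding forms_def by (intro mon2_in) simp
qed

definition mono3 :: "nat \<Rightarrow> nat \<Rightarrow> nat \<Rightarrow> (3 \<Rightarrow>\<^sub>0 nat)" where
  "mono3 d i j = Poly_Mapping.single 0 i + Poly_Mapping.single 1 j + Poly_Mapping.single 2 (d - i - j)"

lemma lookup_mono3: "lk (mono3 d i j) 0 = i" "lk (mono3 d i j) 1 = j" "lk (mono3 d i j) 2 = d - i - j"
  using three_distinct unfolding mono3_def by (simp_all add: lookup_add lookup_single when_def)

lemma mon_degree_mono3: "i + j \<le> d \<Longrightarrow> mon_degree (mono3 d i j) = d"
  unfolding mon_degree_3 lookup_mono3 by simp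

lemma mono3_lookup: assumes "mon_degree m = d" shows "mono3 d (lk m 0) (lk m 1) = m"
proof (rule poly_mapping_eqI)
  fix k :: 3
  have "k \<in> {0, 1, 2}" using UNIV_3 by blast
  then show "lk (mono3 d (lk m 0) (lk m 1)) k = lk m k"
    using assms unfolding mon_degree_3 by (auto simp: lookup_mono3)
qed

text \<open>Inverse to \<open>dehom\<close> on forms of degree d. Monomials of total degree above d
  are discarded, which makes it a linear map on all polynomials.\<close>

definition homog :: "nat \<Rightarrow> 'k::field_char_0 poly poly \<Rightarrow> (3, 'k) mpoly" where
  "homog d G = (\<Sum>(i, j)\<in>{(i, j). i + j \<le> d}. Poly_Mapping.single (mono3 d i j) (coeff (coeff G j) i))"

lemma finite_triangle: "finite {(i, j). i + j \<le> (d::nat)}"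
  by (rule finite_subset[of _ "{..d} \<times> {..d}"]) auto

lemma homog_in: "homog d G \<in> forms d"
  unfolding homog_def by (intro forms_sum) (auto intro: forms_single mon_degree_mono3)

lemma homog_add: "homog d (F + G) = homog d F + homog d G"
  unfolding homog_def by (simp add: single_add sum.distrib case_prod_unfold)

lemma homog_scale: "homog d (scaleP c F) = cst c * homog d F"
  unfolding homog_def by (simp add: sum_distrib_left mult_single case_prod_unfold coeff_scaleP)

lemma homog_0: "homog d 0 = 0" unfolding homog_def by simp

lemma homog_sum: "homog d (\<Sum>i\<in>A. f i) = (\<Sum>i\<in>A. homog d (f i))"
  by (induction A rule: infinite_finite_induct) (simp_all add: homog_0 homog_add)

lemma homog_mon2: assumes "mon_degree m = d" shows "homog d (mon2 m) = Poly_Mapping.single m 1"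
proof -
  let ?T = "{(i, j). i + j \<le> d}"
  have "homog d (mon2 m) = (\<Sum>x\<in>?T. if x = (lk m 0, lk m 1) then Poly_Mapping.single m 1 else 0)"
    unfolding homog_def by (intro sum.cong refl) (auto simp: coeff_mon2 mono3_lookup[OF assms] split: if_splits)
  also have "\<dots> = Poly_Mapping.single m 1"
    using assms unfolding mon_degree_3 by (simp add: finite_triangle)
  finally show ?thesis .
qed

lemma homog_dehom: assumes "f \<in> forms d" shows "homog d (dehom f) = f"
proof -
  have "homog d (dehom f) = (\<Sum>m\<in>Poly_Mapping.keys f. cst (lk f m) * homog d (mon2 m))"
    unfolding dehom_def homog_sum homog_scale ..
  also have "\<dots> = (\<Sum>m\<in>Poly_Mapping.keys f. Poly_Mapping.single m (lk f m))"
    using assms unfolding forms_def by (intro sum.cong) (simp_all add: homog_mon2 mult_single)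
  also have "\<dots> = f" by (rule sum_monomials[symmetric])
  finally show ?thesis .
qed

lemma dehom_homog: assumes "G \<in> tpolys (int d)" shows "dehom (homog d G) = G"
proof (intro poly_eqI)
  fix j i
  let ?T = "{(i, j). i + j \<le> d}"
  have "dehom (homog d G) = (\<Sum>x\<in>?T. scaleP (coeff (coeff G (snd x)) (fst x)) (mon2 (mono3 d (fst x) (snd x))))"
    unfolding homog_def dehom_sum case_prod_unfold dehom_single ..
  then have "coeff (coeff (dehom (homog d G)) j) i
      = (\<Sum>x\<in>?T. if x = (i, j) then coeff (coeff G j) i else 0)"
    by (auto simp: coeff_sum coeff_scaleP mon2_def lookup_mono3 intro!: sum.cong)
  also have "\<dots> = (if i + j \<le> d then coeff (coeff G j) i else 0)" by (simp add: finite_triangle)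
  also have "\<dots> = coeff (coeff G j) i" using assms unfolding tpolys_def by force
  finally show "coeff (coeff (dehom (homog d G)) j) i = coeff (coeff G j) i" .
qed

lemma dehom_onto: assumes "G \<in> tpolys (int d)" obtains g where "g \<in> forms d" "dehom g = G"
  using homog_in dehom_homog[OF assms] by blast

section \<open>Homogeneous components\<close>

definition hcomp :: "nat \<Rightarrow> (3, 'k::comm_ring_1) mpoly \<Rightarrow> (3, 'k) mpoly" where
  "hcomp d f = (\<Sum>m\<in>{m \<in> Poly_Mapping.keys f. mon_degree m = d}. Poly_Mapping.single m (lk f m))"

lemma lookup_hcomp: "lk (hcomp d f) n = (if mon_degree n = d then lk f n else 0)"
proof -
  have "lk (hcomp d f) n = (\<Sum>m\<in>{m \<in> Poly_Mapping.keys f. mon_degree m = d}. if m = n then lk f m else 0)"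
    unfolding hcomp_def by (simp add: lookup_sum lookup_single when_def)
  also have "\<dots> = (if mon_degree n = d then lk f n else 0)" by (simp add: in_keys_iff)
  finally show ?thesis .
qed

lemma hcomp_add: "hcomp d (f + g) = hcomp d f + hcomp d g"
  by (rule poly_mapping_eqI) (simp add: lookup_hcomp lookup_add)

lemma hcomp_0: "hcomp d 0 = 0" by (rule poly_mapping_eqI) (simp add: lookup_hcomp)

lemma hcomp_uminus: "hcomp d (- f) = - hcomp d f"
  by (rule poly_mapping_eqI) (simp add: lookup_hcomp)

lemma hcomp_sum: "hcomp d (\<Sum>i\<in>A. f i) = (\<Sum>i\<in>A. hcomp d (f i))"
  by (induction A rule: infinite_finite_induct) (simp_all add: hcomp_0 hcomp_add)

lemma hcomp_in: "hcomp d f \<in> forms d" by (simp add: forms_iff lookup_hcomp)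

lemma hcomp_form: "f \<in> forms n \<Longrightarrow> hcomp d f = (if n = d then f else 0)"
  unfolding forms_iff by (intro poly_mapping_eqI) (auto simp: lookup_hcomp)

lemma hcomp_total: "(\<Sum>d\<in>mon_degree ` Poly_Mapping.keys f. hcomp d f) = f"
proof (rule poly_mapping_eqI)
  fix n
  have "lk (\<Sum>d\<in>mon_degree ` Poly_Mapping.keys f. hcomp d f) n
    = (\<Sum>d\<in>mon_degree ` Poly_Mapping.keys f. if mon_degree n = d then lk f n else 0)"
    by (simp add: lookup_sum lookup_hcomp)
  also have "\<dots> = lk f n" by (auto simp: in_keys_iff)
  finally show "lk (\<Sum>d\<in>mon_degree ` Poly_Mapping.keys f. hcomp d f) n = lk f n" .
qed

section \<open>The functional of a Gorenstein ideal\<close>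

interpretation MP: cring "poly_ring :: (3, 'k::comm_ring_1) mpoly ring"
  by (rule cring_from_type_algebra)

locale gorenstein_ideal =
  fixes I :: "(3, 'k::field_char_0) mpoly set" and e :: nat
  assumes homogeneous: "homogeneous_ideal I" and gor: "gorenstein I" and socle_deg: "has_socle_degree I e"
begin

abbreviation A where "A \<equiv> quot_alg I"
abbreviation cls where "cls \<equiv> residue_class I"

lemma ideal: "ideal I poly_ring"
proof -
  obtain S :: "(3, 'k) mpoly set" where "I = Idl\<^bsub>poly_ring\<^esub> S"
    using homogeneous unfolding homogeneous_ideal_def by blast
  then show ?thesis using MP.genideal_ideal[of S] by (simp add: ring_of_type_algebra_def)
qed

sublocale I: ideal I poly_ring by (rule ideal)

lemma I_0: "0 \<in> I" using I.zero_closed by (simp add: ring_of_type_algebra_def)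

lemma I_add: "f \<in> I \<Longrightarrow> g \<in> I \<Longrightarrow> f + g \<in> I"
  using I.a_closed[of f g] by (simp add: ring_of_type_algebra_def)

lemma I_mult: "f \<in> I \<Longrightarrow> g * f \<in> I"
  using I.I_l_closed[of f g] by (simp add: ring_of_type_algebra_def)

lemma I_uminus: "f \<in> I \<Longrightarrow> - f \<in> I" using I_mult[of f "- 1"] by simp

lemma I_diff: "f \<in> I \<Longrightarrow> g \<in> I \<Longrightarrow> f - g \<in> I" using I_add[OF _ I_uminus, of f g] by simp

lemma I_sum: "(\<And>i. i \<in> T \<Longrightarrow> f i \<in> I) \<Longrightarrow> (\<Sum>i\<in>T. f i) \<in> I"
  by (induction T rule: infinite_finite_induct) (simp_all add: I_0 I_add)

text \<open>The polynomials whose components all lie in I form an ideal, and this ideal contains the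
  homogeneous generators of I.\<close>

lemma hcomp_I: assumes "f \<in> I" shows "hcomp d f \<in> I"
proof -
  obtain S where S: "S \<subseteq> (\<Union>d. forms d)" "I = Idl\<^bsub>poly_ring\<^esub> S"
    using homogeneous unfolding homogeneous_ideal_def by blast
  define J where "J = {f. \<forall>d. hcomp d f \<in> I}"
  have Jmult: "g * f \<in> J" if "f \<in> J" for f g
  proof -
    have "g * f = (\<Sum>i\<in>mon_degree ` Poly_Mapping.keys g. \<Sum>j\<in>mon_degree ` Poly_Mapping.keys f. hcomp i g * hcomp j f)"
      unfolding sum_product[symmetric] hcomp_total ..
    moreover have "hcomp d (hcomp i g * hcomp j f) \<in> I" for d i j
    proof -
      have "hcomp i g * hcomp j f \<in> forms (i + j)" by (rule forms_mult[OF hcomp_in hcomp_in])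
      moreover have "hcomp i g * hcomp j f \<in> I" using that unfolding J_def by (intro I_mult) simp
      ultimately show ?thesis using I_0 by (simp add: hcomp_form[of _ "i + j"])
    qed
    ultimately show ?thesis unfolding J_def by (auto simp: hcomp_sum intro!: I_sum)
  qed
  have "ideal J poly_ring"
  proof (rule idealI)
    show "ring (poly_ring :: (3, 'k) mpoly ring)" by (rule MP.ring_axioms)
    show "subgroup J (add_monoid poly_ring)"
    proof (rule MP.add.subgroupI)
      have "0 \<in> J" unfolding J_def by (simp add: hcomp_0 I_0)
      then show "J \<noteq> {}" by blast
      fix a assume a: "a \<in> J"
      then have "- a \<in> J" unfolding J_def by (simp add: hcomp_uminus I_uminus)
      moreover have "\<ominus>\<^bsub>poly_ring\<^esub> a = - a"
        by (rule MP.minus_equality) (simp_all add: ring_of_type_algebra_def)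
      ultimately show "\<ominus>\<^bsub>poly_ring\<^esub> a \<in> J" by simp
      fix b assume "b \<in> J"
      with a show "a \<oplus>\<^bsub>poly_ring\<^esub> b \<in> J"
        unfolding J_def by (simp add: ring_of_type_algebra_def hcomp_add I_add)
    qed (simp add: ring_of_type_algebra_def)
    fix a x assume "a \<in> J"
    then show "x \<otimes>\<^bsub>poly_ring\<^esub> a \<in> J" "a \<otimes>\<^bsub>poly_ring\<^esub> x \<in> J"
      using Jmult[of a x] by (simp_all add: ring_of_type_algebra_def mult.commute)
  qed
  moreover have "S \<subseteq> J"
  proof
    fix f assume f: "f \<in> S"
    then obtain n where "f \<in> forms n" using S(1) by blast
    moreover have "f \<in> I" unfolding S(2) using MP.genideal_self[of S] f by (auto simp: ring_of_type_algebra_def)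
    ultimately show "f \<in> J" unfolding J_def using hcomp_form[of f n] I_0 by auto
  qed
  ultimately have "I \<subseteq> J" unfolding S(2) by (rule MP.genideal_minimal)
  then show ?thesis using assms unfolding J_def by blast
qed

lemma cls_eq: "cls f = cls g \<longleftrightarrow> f - g \<in> I"
proof -
  have "\<ominus>\<^bsub>poly_ring\<^esub> g = - g"
    by (rule MP.minus_equality) (simp_all add: ring_of_type_algebra_def)
  then have "f \<ominus>\<^bsub>poly_ring\<^esub> g = f - g"
    unfolding a_minus_def by (simp add: ring_of_type_algebra_def)
  then show ?thesis
    using MP.quotient_eq_iff_same_a_r_cos[OF ideal, of f g]
    unfolding residue_class_def by (simp add: ring_of_type_algebra_def)
qed

lemma cls_add: "cls f \<oplus>\<^bsub>A\<^esub> cls g = cls (f + g)"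
  using I.a_rcos_sum[of f g] unfolding residue_class_def FactRing_def by (simp add: ring_of_type_algebra_def)

lemma cls_mult: "cls f \<otimes>\<^bsub>A\<^esub> cls g = cls (f * g)"
  using I.rcoset_mult_add[of f g] unfolding residue_class_def FactRing_def by (simp add: ring_of_type_algebra_def)

lemma cls_one: "\<one>\<^bsub>A\<^esub> = cls 1"
  unfolding residue_class_def FactRing_def by (simp add: ring_of_type_algebra_def)

lemma cls_zero: "\<zero>\<^bsub>A\<^esub> = cls 0"
  unfolding residue_class_def FactRing_def a_r_coset_def' by (simp add: ring_of_type_algebra_def)

lemma cls_eq_0: "cls f = \<zero>\<^bsub>A\<^esub> \<longleftrightarrow> f \<in> I"
  unfolding cls_zero cls_eq by simp

lemma carrier_A: "carrier A = range cls"
  unfolding residue_class_def FactRing_def A_RCOSETS_def' by (auto simp: ring_of_type_algebra_def)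

lemma cls_in: "cls f \<in> carrier A" unfolding carrier_A by blast

sublocale A: cring A by (rule I.quotient_is_cring[OF MP.cring_axioms])

lemma scalar_mult: "scalar I c \<otimes>\<^bsub>A\<^esub> cls f = cls (cst c * f)"
  unfolding scalar_def by (rule cls_mult)

lemma forms_above: assumes "f \<in> forms j" "e < j" shows "f \<in> I"
proof -
  have "cls f \<in> graded_piece I j" unfolding graded_piece_def using assms(1) by blast
  then show ?thesis using socle_deg assms(2) unfolding has_socle_degree_def by (auto simp: cls_eq_0)
qed

lemma forms_top: obtains f where "f \<in> forms e" "f \<notin> I"
proof -
  have "cls 0 \<in> graded_piece I e" unfolding graded_piece_def using forms_0 by blast
  then obtain a where "a \<in> graded_piece I e" "a \<noteq> \<zero>\<^bsub>A\<^esub>"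
    using socle_deg unfolding has_socle_degree_def by (auto simp: cls_zero)
  then obtain f where "f \<in> forms e" "cls f \<noteq> \<zero>\<^bsub>A\<^esub>" unfolding graded_piece_def by blast
  then show ?thesis using that unfolding cls_eq_0 by blast
qed

lemma socle_iff: "cls f \<in> socle I \<longleftrightarrow> (\<forall>i>0. \<forall>g\<in>forms i. g * f \<in> I)"
  unfolding socle_def graded_piece_def by (auto simp: cls_in cls_mult cls_eq_0)

lemma subfield_scalar: "subfield (range (scalar I)) A"
proof -
  interpret K: field "ring_of_type_algebra :: 'k ring" by (rule field_from_type_algebra)
  have "scalar I \<in> Ring.ring_hom (ring_of_type_algebra :: 'k ring) A"
  proof (rule ring_hom_memI)
    fix x y :: 'k
    have ops: "x \<otimes>\<^bsub>ring_of_type_algebra\<^esub> y = x * y" "x \<oplus>\<^bsub>ring_of_type_algebra\<^esub> y = x + y"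
      by (simp_all add: ring_of_type_algebra_def)
    show "scalar I x \<in> carrier A" unfolding scalar_def by (rule cls_in)
    show "scalar I (x \<otimes>\<^bsub>ring_of_type_algebra\<^esub> y) = scalar I x \<otimes>\<^bsub>A\<^esub> scalar I y"
      unfolding ops scalar_def cls_mult mult_single by simp
    show "scalar I (x \<oplus>\<^bsub>ring_of_type_algebra\<^esub> y) = scalar I x \<oplus>\<^bsub>A\<^esub> scalar I y"
      unfolding ops scalar_def cls_add single_add ..
  next
    have "\<one>\<^bsub>ring_of_type_algebra\<^esub> = (1 :: 'k)" by (simp add: ring_of_type_algebra_def)
    then show "scalar I \<one>\<^bsub>ring_of_type_algebra\<^esub> = \<one>\<^bsub>A\<^esub>" unfolding scalar_def cls_one by simp
  qed
  then interpret h: ring_hom_ring "ring_of_type_algebra :: 'k ring" A "scalar I"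
    by (intro ring_hom_ringI2 K.ring_axioms A.ring_axioms)
  obtain f where "f \<in> forms e" "f \<notin> I" by (rule forms_top)
  then have "1 \<notin> I" using I_mult[of 1 f] by auto
  then have "\<one>\<^bsub>A\<^esub> \<noteq> \<zero>\<^bsub>A\<^esub>" unfolding cls_one cls_eq_0 .
  from h.img_is_subfield(2)[OF K.carrier_is_subfield this] show ?thesis
    by (simp add: ring_of_type_algebra_def)
qed

lemma socle_multiple:
  assumes "cls f \<in> socle I" "cls g \<in> socle I" "g \<notin> I"
  obtains c where "f - cst c * g \<in> I"
proof -
  obtain Vs where Vs: "set Vs \<subseteq> carrier A" "length Vs = 1" "A.Span (range (scalar I)) Vs = socle I"
    using A.exists_base[OF subfield_scalar] gor unfolding gorenstein_def by blast
  then obtain w where w: "Vs = [cls w]" unfolding carrier_A by (cases Vs) auto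
  have mult: "\<exists>c. f - cst c * w \<in> I" if f: "cls f \<in> socle I" for f
  proof -
    have "cls f \<in> A.line_extension (range (scalar I)) (cls w) {\<zero>\<^bsub>A\<^esub>}"
      using f unfolding Vs(3)[symmetric] w by simp
    then obtain c where "cls f = scalar I c \<otimes>\<^bsub>A\<^esub> cls w \<oplus>\<^bsub>A\<^esub> \<zero>\<^bsub>A\<^esub>"
      unfolding A.line_extension_mem_iff by blast
    then show ?thesis unfolding scalar_mult cls_zero cls_add cls_eq by auto
  qed
  obtain a b where ab: "f - cst a * w \<in> I" "g - cst b * w \<in> I" using mult assms(1,2) by blast
  have "b \<noteq> 0"
  proof
    assume "b = 0"
    then show False using ab(2) assms(3) by simp
  qed
  then have "cst (a / b) * cst b = (cst a :: (3, 'k) mpoly)" by (simp add: mult_single)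
  then have "f - cst (a / b) * g = (f - cst a * w) - cst (a / b) * (g - cst b * w)"
    by (simp add: right_diff_distrib mult.assoc[symmetric])
  then have "f - cst (a / b) * g \<in> I" using I_diff[OF ab(1) I_mult[OF ab(2), of "cst (a / b)"]] by (simp only:)
  then show ?thesis by (rule that)
qed

definition top_form where "top_form = (SOME f. f \<in> forms e \<and> f \<notin> I)"

lemma top_form: "top_form \<in> forms e" "top_form \<notin> I"
proof -
  obtain f where "f \<in> forms e" "f \<notin> I" by (rule forms_top)
  then have "top_form \<in> forms e \<and> top_form \<notin> I"
    unfolding top_form_def by (intro someI[of "\<lambda>f. f \<in> forms e \<and> f \<notin> I"] conjI)
  then show "top_form \<in> forms e" "top_form \<notin> I" by auto
qed

lemma socle_top: assumes "f \<in> forms e" shows "cls f \<in> socle I"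
  unfolding socle_iff
proof (intro allI impI ballI)
  fix i :: nat and g :: "(3, 'k) mpoly" assume "0 < i" "g \<in> forms i"
  then show "g * f \<in> I" using forms_above[OF forms_mult[OF _ assms], of g i] by simp
qed

text \<open>Every monomial of positive degree has a linear factor, so f represents a socle element
  and is a multiple of \<open>top_form\<close> modulo I. The two have different degrees, and the
  component of degree j leaves f in I.\<close>

lemma socle_step:
  assumes f: "f \<in> forms j" "j \<noteq> e" and lin: "\<And>x. x \<in> forms 1 \<Longrightarrow> x * f \<in> I"
  shows "f \<in> I"
proof -
  have "cls f \<in> socle I" unfolding socle_iff
  proof (intro allI impI ballI)
    fix i g assume i: "0 < i" and g: "(g :: (3, 'k) mpoly) \<in> forms i"
    have "Poly_Mapping.single m c * f \<in> I" if m: "m \<in> Poly_Mapping.keys g" for m c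
    proof -
      have "mon_degree m = i" using g m unfolding forms_def by blast
      then have "\<exists>v. 0 < lk m v" using i unfolding mon_degree_3 by force
      then obtain v where v: "0 < lk m v" by blast
      have "m = (m - Poly_Mapping.single v 1) + Poly_Mapping.single v 1"
        using v by (intro poly_mapping_eqI) (auto simp: lookup_add lookup_minus lookup_single when_def)
      then have "Poly_Mapping.single m c = Poly_Mapping.single (m - Poly_Mapping.single v 1) c
          * Poly_Mapping.single (Poly_Mapping.single v 1) 1"
        by (simp add: mult_single)
      moreover have "mon_degree (Poly_Mapping.single v (1::nat)) = 1" unfolding mon_degree_def by simp
      then have "Poly_Mapping.single (Poly_Mapping.single v 1) 1 * f \<in> I" by (intro lin forms_single)
      ultimately show ?thesis by (simp add: mult.assoc I_mult)
    qed
    moreover have "g * f = (\<Sum>m\<in>Poly_Mapping.keys g. Poly_Mapping.single m (lk g m) * f)"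
      by (subst (1) sum_monomials[of g]) (rule sum_distrib_right)
    ultimately show "g * f \<in> I" by (auto intro: I_sum)
  qed
  then obtain c where "f - cst c * top_form \<in> I" by (rule socle_multiple[OF _ socle_top[OF top_form(1)] top_form(2)])
  then have "hcomp j (f - cst c * top_form) \<in> I" by (rule hcomp_I)
  moreover have "hcomp j (f - cst c * top_form) = f"
  proof -
    have "hcomp j (f + - (cst c * top_form)) = f"
      unfolding hcomp_add hcomp_uminus hcomp_form[OF f(1)] hcomp_form[OF forms_scale[OF top_form(1)]] using f(2) by simp
    then show ?thesis by simp
  qed
  ultimately show ?thesis by simp
qed

text \<open>The coordinate along \<open>top_form\<close> of the class in degree e: an identification
  of the one-dimensional top piece with the field.\<close>

definition \<phi> :: "'k poly poly \<Rightarrow> 'k" where "\<phi> F = (THE c. homog e F - cst c * top_form \<in> I)"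

lemma \<phi>_eqI: assumes c: "homog e F - cst c * top_form \<in> I" shows "\<phi> F = c"
  unfolding \<phi>_def
proof (rule the_equality, rule c)
  fix d assume "homog e F - cst d * top_form \<in> I"
  from I_diff[OF c this] have "cst (d - c) * top_form \<in> I" by (simp add: single_diff left_diff_distrib)
  then have "cst (1 / (d - c)) * (cst (d - c) * top_form) \<in> I" by (rule I_mult)
  then have "d - c \<noteq> 0 \<Longrightarrow> top_form \<in> I" by (simp add: mult.assoc[symmetric] mult_single)
  then show "d = c" using top_form(2) by auto
qed

lemma \<phi>: "homog e F - cst (\<phi> F) * top_form \<in> I"
proof -
  obtain c where "homog e F - cst c * top_form \<in> I"
    by (rule socle_multiple[OF socle_top[OF homog_in[of e F]] socle_top[OF top_form(1)] top_form(2)])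
  then show ?thesis using \<phi>_eqI by metis
qed

lemma \<phi>_zero_iff: "\<phi> F = 0 \<longleftrightarrow> homog e F \<in> I"
  using \<phi>[of F] \<phi>_eqI[of F 0] by auto

sublocale G: graded_functional \<phi> "int e"
proof
  fix F G c
  have "homog e (F + G) - cst (\<phi> F + \<phi> G) * top_form = (homog e F - cst (\<phi> F) * top_form) + (homog e G - cst (\<phi> G) * top_form)"
    by (simp add: homog_add single_add algebra_simps)
  then show "\<phi> (F + G) = \<phi> F + \<phi> G" using I_add[OF \<phi> \<phi>, of F G] by (intro \<phi>_eqI) simp
  have "homog e (scaleP c F) - cst (c * \<phi> F) * top_form = cst c * (homog e F - cst (\<phi> F) * top_form)"
    unfolding homog_scale right_diff_distrib mult.assoc[symmetric] mult_single by simp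
  then show "\<phi> (scaleP c F) = c * \<phi> F" using I_mult[OF \<phi>[of F]] by (intro \<phi>_eqI) simp
qed

text \<open>Macaulay duality: the functional determines I. Orthogonality means membership in degree
  e by construction, and \<open>socle_step\<close> carries this down one degree at a time.\<close>

lemma gid_iff: assumes "f \<in> forms j" shows "dehom f \<in> G.gid (int j) \<longleftrightarrow> f \<in> I"
proof
  assume f: "f \<in> I"
  show "dehom f \<in> G.gid (int j)" unfolding G.gid_def
  proof (intro CollectI conjI ballI dehom_in[OF assms])
    fix G :: "'k poly poly" assume G: "G \<in> tpolys (int e - int j)"
    show "\<phi> (dehom f * G) = 0"
    proof (cases "j \<le> e")
      case True
      then obtain g where g: "g \<in> forms (e - j)" "dehom g = G"
        using dehom_onto[of G "e - j"] G by (metis of_nat_diff)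
      have "f * g \<in> forms e" using forms_mult[OF assms g(1)] True by simp
      then have "homog e (dehom f * G) = f * g" unfolding g(2)[symmetric] dehom_mult[symmetric] by (rule homog_dehom)
      then show ?thesis unfolding \<phi>_zero_iff using I_mult[OF f, of g] by (simp add: mult.commute)
    next
      case False
      then have "G = 0" using G tpolys_neg[of "int e - int j"] by auto
      then show ?thesis by (simp add: G.\<phi>_0)
    qed
  qed
next
  show "dehom f \<in> G.gid (int j) \<Longrightarrow> f \<in> I" using assms
  proof (induction "e - j" arbitrary: j f)
    case 0
    show ?case
    proof (cases "j = e")
      case True
      have "\<phi> (dehom f * 1) = 0" by (rule G.gidD[OF 0(2)]) (simp add: True one_in_tpolys)
      then show ?thesis unfolding \<phi>_zero_iff using homog_dehom[OF 0(3)] True by simp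
    next
      case False
      then show ?thesis using forms_above[OF 0(3)] 0(1) by simp
    qed
  next
    case (Suc k)
    show ?case
    proof (rule socle_step[OF Suc.prems(2)])
      show "j \<noteq> e" using Suc.hyps(2) by auto
      fix x :: "(3, 'k) mpoly" assume x: "x \<in> forms 1"
      have xf: "x * f \<in> forms (j + 1)" using forms_mult[OF x Suc.prems(2)] by (simp add: add.commute)
      have "dehom x * dehom f \<in> G.gid (int j + int 1)" by (rule G.gid_mult[OF Suc.prems(1) dehom_in[OF x]])
      then have "dehom (x * f) \<in> G.gid (int (j + 1))" unfolding dehom_mult of_nat_add .
      then show "x * f \<in> I" using Suc.hyps(1)[of "j + 1" "x * f"] Suc.hyps(2) xf by simp
    qed
  qed
qed

section \<open>Comparison with the Hilbert function\<close>

lemma Span_lift: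
  assumes "x \<in> A.Span (range (scalar I)) (map cls fs)"
  obtains g where "x = cls g" "dehom g \<in> VR.span (dehom ` set fs)" "set fs \<subseteq> forms s \<longrightarrow> g \<in> forms s"
proof -
  have "\<exists>g. x = cls g \<and> dehom g \<in> VR.span (dehom ` set fs) \<and> (set fs \<subseteq> forms s \<longrightarrow> g \<in> forms s)"
    using assms
  proof (induction fs arbitrary: x)
    case Nil
    then have "x = cls 0" by (simp add: cls_zero)
    then show ?case by (intro exI[of _ 0]) (simp add: dehom_0 forms_0)
  next
    case (Cons f fs)
    then obtain c y where y: "x = scalar I c \<otimes>\<^bsub>A\<^esub> cls f \<oplus>\<^bsub>A\<^esub> y" "y \<in> A.Span (range (scalar I)) (map cls fs)"
      by (auto simp: A.line_extension_mem_iff)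
    from Cons.IH[OF y(2)] obtain g where g: "y = cls g" "dehom g \<in> VR.span (dehom ` set fs)"
      "set fs \<subseteq> forms s \<longrightarrow> g \<in> forms s" by (elim exE conjE)
    have "dehom f \<in> VR.span (dehom ` set (f # fs))" by (rule VR.span_base) simp
    moreover have "VR.span (dehom ` set fs) \<subseteq> VR.span (dehom ` set (f # fs))" by (rule VR.span_mono) auto
    then have "dehom g \<in> VR.span (dehom ` set (f # fs))" using g(2) by (rule subsetD)
    ultimately have "dehom (cst c * f + g) \<in> VR.span (dehom ` set (f # fs))" unfolding dehom_add dehom_cst
      by (intro VR.span_add VR.span_scale)
    moreover have "x = cls (cst c * f + g)" unfolding y(1) g(1) scalar_mult cls_add ..
    ultimately show ?case using g(3) by (intro exI[of _ "cst c * f + g"]) (simp add: forms_add forms_scale)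
  qed
  then show ?thesis using that by blast
qed

text \<open>\<open>hilbert_function\<close> is given by \<open>dim\<close>, which carries
  information only once the dimension is known to be finite. The monomials of degree s span.\<close>

lemma finite_dimension_graded_piece: "A.finite_dimension (range (scalar I)) (graded_piece I s)"
proof -
  let ?K = "range (scalar I)"
  let ?M = "(\<lambda>(i, j). Poly_Mapping.single (mono3 s i j) 1) ` {(i, j). i + j \<le> s} :: (3, 'k) mpoly set"
  have "finite ?M" by (rule finite_imageI[OF finite_triangle])
  then obtain ms where ms: "set ms = ?M" using finite_list by blast
  have M: "?M \<subseteq> forms s" by (auto intro: forms_single mon_degree_mono3)
  have car: "set (map cls ms) \<subseteq> carrier A" using cls_in by auto
  note props = A.Span_subgroup_props[OF subfield_scalar car]
  have "graded_piece I s = A.Span ?K (map cls ms)"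
  proof (intro subset_antisym subsetI)
    fix a assume "a \<in> graded_piece I s"
    then obtain f where f: "f \<in> forms s" "a = cls f" unfolding graded_piece_def by blast
    have sum: "(\<And>i. i \<in> T \<Longrightarrow> cls (F i) \<in> A.Span ?K (map cls ms)) \<Longrightarrow> cls (\<Sum>i\<in>T. F i) \<in> A.Span ?K (map cls ms)"
      for T :: "(nat \<times> nat) set" and F
      using props(2,3) by (induction T rule: infinite_finite_induct) (auto simp: cls_zero cls_add[symmetric] simp del: A.Span.simps)
    have "f = homog s (dehom f)" by (rule homog_dehom[OF f(1), symmetric])
    also have "\<dots> = (\<Sum>x\<in>{(i, j). i + j \<le> s}. cst (coeff (coeff (dehom f) (snd x)) (fst x)) * Poly_Mapping.single (mono3 s (fst x) (snd x)) 1)"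
      unfolding homog_def by (simp add: case_prod_unfold mult_single)
    finally have f_eq: "f = (\<Sum>x\<in>{(i, j). i + j \<le> s}. cst (coeff (coeff (dehom f) (snd x)) (fst x)) * Poly_Mapping.single (mono3 s (fst x) (snd x)) 1)" .
    have "cls (cst c * Poly_Mapping.single (mono3 s (fst x) (snd x)) 1) \<in> A.Span ?K (map cls ms)"
      if "x \<in> {(i, j). i + j \<le> s}" for c x
    proof -
      have "cls (Poly_Mapping.single (mono3 s (fst x) (snd x)) 1) \<in> set (map cls ms)"
        using that unfolding set_map ms by force
      then have "cls (Poly_Mapping.single (mono3 s (fst x) (snd x)) 1) \<in> A.Span ?K (map cls ms)"
        using A.Span_base_incl[OF subfield_scalar car] by blast
      then show ?thesis unfolding scalar_mult[symmetric]
        by (intro A.Span_smult_closed[OF subfield_scalar car]) auto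
    qed
    then have "cls (\<Sum>x\<in>{(i, j). i + j \<le> s}. cst (coeff (coeff (dehom f) (snd x)) (fst x)) * Poly_Mapping.single (mono3 s (fst x) (snd x)) 1)
        \<in> A.Span ?K (map cls ms)" by (rule sum)
    then show "a \<in> A.Span ?K (map cls ms)" unfolding f(2) f_eq[symmetric] .
  next
    fix a assume "a \<in> A.Span ?K (map cls ms)"
    then obtain g where "a = cls g" "set ms \<subseteq> forms s \<longrightarrow> g \<in> forms s" by (rule Span_lift[where s = s])
    then show "a \<in> graded_piece I s" using M ms unfolding graded_piece_def by blast
  qed
  then show ?thesis using A.Span_finite_dimension[OF subfield_scalar car] by simp
qed

text \<open>Representatives of a basis of the graded piece, dehomogenised, span
  \<open>tpolys s\<close> modulo the ideal. The assumption is an upper bound on the Hilbert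
  function, so this direction transfers it.\<close>

lemma h_le_hilbert_function: "G.h (int s) \<le> int (hilbert_function I s)"
proof -
  let ?K = "range (scalar I)"
  have "A.dimension (hilbert_function I s) ?K (graded_piece I s)"
    using A.finite_dimensionE[OF subfield_scalar finite_dimension_graded_piece]
    unfolding hilbert_function_def over_def .
  then obtain Vs where Vs: "set Vs \<subseteq> carrier A" "length Vs = hilbert_function I s" "A.Span ?K Vs = graded_piece I s"
    using A.exists_base[OF subfield_scalar] by blast
  have "set Vs \<subseteq> cls ` forms s"
    using A.Span_base_incl[OF subfield_scalar Vs(1)] unfolding Vs(3) graded_piece_def .
  then have "Vs \<in> lists (cls ` forms s)" unfolding in_lists_conv_set by blast
  then obtain fs where "fs \<in> lists (forms s)" "Vs = map cls fs" unfolding lists_image by (rule imageE)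
  then have fs: "set fs \<subseteq> forms s" "Vs = map cls fs" by auto
  let ?D = "dehom ` set fs"
  have D: "VR.span ?D \<subseteq> tpolys (int s)"
    by (rule VR.span_minimal[OF _ subspace_tpolys]) (use fs(1) dehom_in in blast)
  have "tpolys (int s) \<subseteq> sumset (G.gid (int s)) (VR.span ?D)"
  proof
    fix F assume "F \<in> (tpolys (int s) :: 'k poly poly set)"
    then obtain f where f: "f \<in> forms s" "dehom f = F" by (rule dehom_onto)
    then have "cls f \<in> A.Span ?K (map cls fs)" using Vs(3) unfolding fs(2) graded_piece_def by blast
    then obtain g where g: "cls f = cls g" "dehom g \<in> VR.span ?D" "set fs \<subseteq> forms s \<longrightarrow> g \<in> forms s" by (rule Span_lift[where s = s])
    then have "f - g \<in> I" "f - g \<in> forms s" using f(1) fs(1) forms_diff unfolding cls_eq by blast+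
    then have "dehom f - dehom g \<in> G.gid (int s)" using gid_iff[of "f - g" s] by (simp add: dehom_diff)
    from sumsetI[OF this g(2)] show "F \<in> sumset (G.gid (int s)) (VR.span ?D)" using f(2) by simp
  qed
  then have "sumset (G.gid (int s)) (VR.span ?D) = tpolys (int s)"
    using VR.sumset_least[OF subspace_tpolys G.gid_in D] by blast
  moreover have "VR.dim (sumset (G.gid (int s)) (VR.span ?D)) + VR.dim (G.gid (int s) \<inter> VR.span ?D)
      = VR.dim (G.gid (int s)) + VR.dim (VR.span ?D)"
    by (rule VR.dim_sumset_Int[OF G.subspace_gid fin_dim_in_tpolys[OF G.gid_in] VR.subspace_span fin_dim_in_tpolys[OF D]])
  moreover have "VR.dim (VR.span ?D) \<le> length fs"
  proof -
    have "VR.dim (VR.span ?D) \<le> card ?D" unfolding VR.dim_span by (rule VR.dim_le_card') simp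
    also have "\<dots> \<le> card (set fs)" by (rule card_image_le) simp
    also have "\<dots> \<le> length fs" by (rule card_length)
    finally show ?thesis .
  qed
  ultimately show ?thesis using Vs(2) unfolding G.h_def fs(2) by simp
qed

section \<open>The open set of Lefschetz elements\<close>

definition lift where "lift x = (if x \<in> graded_piece I 1 then SOME f. f \<in> forms 1 \<and> cls f = x else 0)"

lemma lift_in: "lift x \<in> forms 1"
  unfolding lift_def graded_piece_def
  using someI_ex[of "\<lambda>f. f \<in> forms 1 \<and> cls f = x"] forms_0 by (auto simp: image_iff)

lemma cls_lift: "x \<in> graded_piece I 1 \<Longrightarrow> cls (lift x) = x"
  unfolding lift_def graded_piece_def
  using someI_ex[of "\<lambda>f. f \<in> forms 1 \<and> cls f = x"] by auto

text \<open>Two representatives differ by an element of I, which \<phi> annihilates against H. So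
  the value depends only on the class, although \<open>lift\<close> is an arbitrary choice.\<close>

lemma linear_functional_lift:
  assumes H: "H \<in> tpolys (int e - 1)"
  shows "(\<lambda>x. \<phi> (dehom (lift x) * H)) \<in> linear_functionals I"
proof -
  have well: "\<phi> (dehom f * H) = \<phi> (dehom g * H)" if "f \<in> forms 1" "g \<in> forms 1" "cls f = cls g" for f g
  proof -
    have "dehom (f - g) \<in> G.gid (int 1)" using that gid_iff[OF forms_diff[OF that(1,2)]] unfolding cls_eq by simp
    then have "\<phi> (dehom (f - g) * H) = 0" by (rule G.gidD) (use H in simp)
    moreover have "dehom f * H = dehom (f - g) * H + dehom g * H"
      unfolding dehom_diff left_diff_distrib by simp
    ultimately show ?thesis using G.\<phi>_add by simp
  qed
  show ?thesis unfolding linear_functionals_def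
  proof (intro CollectI conjI ballI allI)
    fix a b assume ab: "a \<in> graded_piece I 1" "b \<in> graded_piece I 1"
    have s: "a \<oplus>\<^bsub>A\<^esub> b = cls (lift a + lift b)" using cls_lift[OF ab(1)] cls_lift[OF ab(2)] by (simp add: cls_add[symmetric])
    have f: "lift a + lift b \<in> forms 1" by (intro forms_add lift_in)
    have "a \<oplus>\<^bsub>A\<^esub> b \<in> graded_piece I 1" unfolding s graded_piece_def using f by blast
    from cls_lift[OF this] have "cls (lift (a \<oplus>\<^bsub>A\<^esub> b)) = cls (lift a + lift b)" unfolding s .
    from well[OF lift_in f this]
    show "\<phi> (dehom (lift (a \<oplus>\<^bsub>A\<^esub> b)) * H) = \<phi> (dehom (lift a) * H) + \<phi> (dehom (lift b) * H)"
      by (simp only: dehom_add distrib_right G.\<phi>_add)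
  next
    fix c a assume a: "a \<in> graded_piece I 1"
    have s: "scalar I c \<otimes>\<^bsub>A\<^esub> a = cls (cst c * lift a)" using cls_lift[OF a] by (simp add: scalar_mult[symmetric])
    have f: "cst c * lift a \<in> forms 1" by (intro forms_scale lift_in)
    have "scalar I c \<otimes>\<^bsub>A\<^esub> a \<in> graded_piece I 1" unfolding s graded_piece_def using f by blast
    from cls_lift[OF this] have "cls (lift (scalar I c \<otimes>\<^bsub>A\<^esub> a)) = cls (cst c * lift a)" unfolding s .
    from well[OF lift_in f this]
    show "\<phi> (dehom (lift (scalar I c \<otimes>\<^bsub>A\<^esub> a)) * H) = c * \<phi> (dehom (lift a) * H)"
      by (simp only: dehom_cst scaleP_mult G.\<phi>_scale)
  qed
qed

text \<open>Up to t multiplication is injective. For i > t the bound e <= 2 t + 2 gives e - 1 - i <=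
  t, so injectivity in that dual degree yields surjectivity out of degree i; from e on the target is
  zero.\<close>

lemma max_rank_from_middle:
  assumes x: "x \<in> graded_piece I 1" and inj: "G.injective_at (dehom (lift x)) (int t)" and t: "t \<le> e" "e \<le> 2 * t + 2"
  shows "max_rank_mult I x i"
proof -
  let ?L = "dehom (lift x)"
  have L: "?L \<in> tpolys 1" using dehom_in[OF lift_in] by simp
  have xc: "x \<otimes>\<^bsub>A\<^esub> cls f = cls (lift x * f)" for f
    using cls_mult[of "lift x" f] unfolding cls_lift[OF x] .
  have lf: "lift x * f \<in> forms (i + 1)" if "f \<in> forms i" for f
    using forms_mult[OF lift_in that] by (simp add: add.commute)
  show ?thesis
  proof (cases "i \<le> t")
    case True
    have inj_i: "G.injective_at ?L (int i)" by (rule G.injective_below[OF L inj]) (use True t in simp_all)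
    have "inj_on (\<lambda>a. x \<otimes>\<^bsub>A\<^esub> a) (graded_piece I i)"
    proof (rule inj_onI)
      fix a b assume "a \<in> graded_piece I i" "b \<in> graded_piece I i" and eq: "x \<otimes>\<^bsub>A\<^esub> a = x \<otimes>\<^bsub>A\<^esub> b"
      then obtain f g where fg: "f \<in> forms i" "a = cls f" "g \<in> forms i" "b = cls g" unfolding graded_piece_def by blast
      have d: "f - g \<in> forms i" by (rule forms_diff[OF fg(1,3)])
      have "lift x * (f - g) \<in> I" using eq unfolding fg(2,4) xc cls_eq by (simp add: right_diff_distrib)
      then have "?L * dehom (f - g) \<in> G.gid (int (i + 1))" using gid_iff[OF lf[OF d]] unfolding dehom_mult by blast
      then have "?L * dehom (f - g) \<in> G.gid (int i + 1)" by (simp only: of_nat_add of_nat_1)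
      then have "dehom (f - g) \<in> G.gid (int i)"
        using inj_i dehom_in[OF d] unfolding G.injective_at_def by blast
      then show "a = b" using gid_iff[OF d] unfolding fg(2,4) cls_eq by blast
    qed
    then show ?thesis unfolding max_rank_mult_def by blast
  next
    case False
    have "(\<lambda>a. x \<otimes>\<^bsub>A\<^esub> a) ` graded_piece I i = graded_piece I (i + 1)"
    proof (intro subset_antisym subsetI)
      fix y assume "y \<in> (\<lambda>a. x \<otimes>\<^bsub>A\<^esub> a) ` graded_piece I i"
      then show "y \<in> graded_piece I (i + 1)" unfolding graded_piece_def using xc lf by auto
    next
      fix y assume "y \<in> graded_piece I (i + 1)"
      then obtain g where g: "g \<in> forms (i + 1)" "y = cls g" unfolding graded_piece_def by blast
      have "\<exists>f\<in>forms i. g - lift x * f \<in> I"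
      proof (cases "i < e")
        case True
        let ?i = "int e - 1 - int i"
        have inj': "G.injective_at ?L ?i" by (rule G.injective_below[OF L inj]) (use False t in simp_all)
        have gi: "dehom g \<in> tpolys (int e - ?i)" using dehom_in[OF g(1)] by (simp add: add.commute)
        obtain F where F: "F \<in> tpolys (int e - 1 - ?i)" "dehom g - ?L * F \<in> G.gid (int e - ?i)"
          by (rule G.surjective_dual[OF L inj' _ gi]) simp_all
        have e1: "int e - 1 - ?i = int i" "int e - ?i = int (i + 1)" by simp_all
        obtain f where f: "f \<in> forms i" "dehom f = F" using F(1) unfolding e1 by (rule dehom_onto)
        have "dehom (g - lift x * f) \<in> G.gid (int (i + 1))" using F(2) unfolding e1 f(2)[symmetric] dehom_diff dehom_mult .
        then have "g - lift x * f \<in> I" using gid_iff[OF forms_diff[OF g(1) lf[OF f(1)]]] by blast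
        then show ?thesis using f(1) by blast
      next
        case False
        then have "g \<in> I" using forms_above[OF g(1)] by simp
        then show ?thesis by (intro bexI[OF _ forms_0]) simp
      qed
      then obtain f where f: "f \<in> forms i" "g - lift x * f \<in> I" by blast
      then have "y = x \<otimes>\<^bsub>A\<^esub> cls f" unfolding g(2) xc cls_eq by simp
      then show "y \<in> (\<lambda>a. x \<otimes>\<^bsub>A\<^esub> a) ` graded_piece I i" unfolding graded_piece_def using f(1) by blast
    qed
    then show ?thesis unfolding max_rank_mult_def by blast
  qed
qed

lemma weak_lefschetz_from_middle:
  assumes L: "L \<in> tpolys 1" and inj: "G.injective_at L (int t)" and t: "t \<le> e" "e \<le> 2 * t + 2"
  shows "weak_lefschetz I"
proof -
  obtain l where l: "l \<in> forms 1" "dehom l = L" using dehom_onto[of L 1] L by auto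
  let ?x0 = "cls l"
  have x0: "?x0 \<in> graded_piece I 1" unfolding graded_piece_def using l(1) by blast
  have d: "dehom (lift ?x0) - L \<in> G.gid 1"
  proof -
    have "dehom (lift ?x0 - l) \<in> G.gid (int 1)"
      using gid_iff[OF forms_diff[OF lift_in l(1)]] cls_lift[OF x0] unfolding cls_eq by blast
    then show ?thesis unfolding dehom_diff l(2) by simp
  qed
  \<comment> \<open>The chosen representative may differ from L, but only by an element of the ideal
    in degree 1, which does not affect products modulo the ideal.\<close>
  have inj0: "G.injective_at (dehom (lift ?x0)) (int t)" unfolding G.injective_at_def
  proof (intro ballI impI)
    fix F assume F: "F \<in> tpolys (int t)" "dehom (lift ?x0) * F \<in> G.gid (int t + 1)"
    have "F * (dehom (lift ?x0) - L) \<in> G.gid (1 + int t)" by (rule G.gid_mult[OF d F(1)])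
    then have "F * (dehom (lift ?x0) - L) \<in> G.gid (int t + 1)" by (simp only: add.commute)
    then have "dehom (lift ?x0) * F - F * (dehom (lift ?x0) - L) \<in> G.gid (int t + 1)"
      by (rule VR.subspace_diff[OF G.subspace_gid F(2)])
    then have "L * F \<in> G.gid (int t + 1)" by (simp add: algebra_simps)
    then show "F \<in> G.gid (int t)" using inj F(1) unfolding G.injective_at_def by blast
  qed
  have PP: "fun_algebra (polynomial_functions I)"
    by unfold_locales (rule polynomial_functions.const, erule (1) polynomial_functions.add, erule (1) polynomial_functions.mult)
  have lin: "(\<lambda>x. \<phi> (dehom (lift x) * H)) \<in> polynomial_functions I" if "H \<in> tpolys (int e - 1)" for H
    by (rule polynomial_functions.linear[OF linear_functional_lift[OF that]])
  have in1: "dehom (lift x) \<in> tpolys 1" for x using dehom_in[OF lift_in] by simp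
  have "\<exists>p. p \<in> polynomial_functions I \<and> p ?x0 \<noteq> 0 \<and> (\<forall>x. p x \<noteq> 0 \<longrightarrow> G.injective_at (dehom (lift x)) (int t))"
  proof (rule G.injective_open[where l = "\<lambda>x. dehom (lift x)", OF PP in1 lin inj0])
    fix p assume "p \<in> polynomial_functions I" "p ?x0 \<noteq> 0"
      "\<And>x. p x \<noteq> 0 \<Longrightarrow> G.injective_at (dehom (lift x)) (int t)"
    then show ?thesis by blast
  qed
  then obtain p where p: "p \<in> polynomial_functions I" "p ?x0 \<noteq> 0"
    "\<forall>x. p x \<noteq> 0 \<longrightarrow> G.injective_at (dehom (lift x)) (int t)" by blast
  define U where "U = {x \<in> graded_piece I 1. \<exists>f\<in>{p}. f x \<noteq> 0}"
  have "zariski_open I U" unfolding zariski_open_def U_def using p(1) by blast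
  moreover have "?x0 \<in> U" unfolding U_def using x0 p(2) by simp
  moreover have "\<forall>x\<in>U. \<forall>i. max_rank_mult I x i"
  proof (intro ballI allI)
    fix x i assume "x \<in> U"
    then have "x \<in> graded_piece I 1" "p x \<noteq> 0" unfolding U_def by auto
    then show "max_rank_mult I x i" using max_rank_from_middle[OF _ mp[OF spec[OF p(3)]] t] by blast
  qed
  ultimately show ?thesis unfolding weak_lefschetz_def by blast
qed

end

theorem theorem3p6:
  fixes I :: "(3, 'k::field_char_0) mpoly set" and e :: nat
  assumes "homogeneous_ideal I"
    and "artinian (quot_alg I)"
    and "gorenstein I"
    and "has_socle_degree I e"
    and "\<exists>s::nat. 3 \<le> s \<and> real s \<le> real e / 2 - 1 \<and>
           int (hilbert_function I s) \<le> 3 * int s - 1"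
  shows "weak_lefschetz I"
proof -
  interpret gorenstein_ideal I e by unfold_locales (fact assms)+
  obtain s :: nat where s: "3 \<le> s" "real s \<le> real e / 2 - 1" "int (hilbert_function I s) \<le> 3 * int s - 1"
    using assms(5) by blast
  then have "3 \<le> int s" "2 * int s + 2 \<le> int e" "G.h (int s) \<le> 3 * int s - 1"
    using h_le_hilbert_function[of s] by linarith+
  then obtain a b where ab: "\<And>F. F \<in> tpolys ((int e - 1) div 2) \<Longrightarrow> line a b * F \<in> G.gid ((int e - 1) div 2 + 1)
      \<Longrightarrow> F \<in> G.gid ((int e - 1) div 2)"
    by (rule G.middle_injective) blast
  define t where "t = (e - 1) div 2"
  have "(int e - 1) div 2 = int t" unfolding t_def using s(1,2) by (simp add: zdiv_int of_nat_diff)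
  then have "G.injective_at (line a b) (int t)" using ab unfolding G.injective_at_def by simp
  moreover have "t \<le> e" "e \<le> 2 * t + 2" unfolding t_def by auto
  ultimately show ?thesis by (rule weak_lefschetz_from_middle[OF line_in])
qed

end
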